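(* Let $1<p<\infty$, $q=p/(p-1)$, let $\Phi\in L_1(\mathbb{R}^d)\cap C(\mathbb{R}^d)$ be a positive definite function with $\hat{\Phi}^{\min\{p,q\}-1}\in L_1(\mathbb{R}^d)$, and let $\Omega\subseteq\mathbb{R}^d$. Define \[ \mathcal{B}_{\Phi}^p(\Omega):=\left\{h:\Omega\to\mathbb{C}:\ \text{there exists } f\in\mathcal{B}_{\Phi}^p(\mathbb{R}^d)\text{ with } f|_{\Omega}=h\right\},\qquad \|h\|_{\mathcal{B}_{\Phi}^p(\Omega)}:=\inf\left\{\|f\|_{\mathcal{B}_{\Phi}^p(\mathbb{R}^d)}: f\in\mathcal{B}_{\Phi}^p(\mathbb{R}^d),\ f|_{\Omega}=h\right\}. \] Then $\mathcal{B}_{\Phi}^p(\Omega)$ is a reproducing kernel Banach space with the two-sided reproducing kernel $K|_{\mathbb{R}^d\times\Omega}(\boldsymbol{x},\boldsymbol{y}):=\Phi(\boldsymbol{x}-\boldsymbol{y})$, $\boldsymbol{x}\in\mathbb{R}^d$, $\boldsymbol{y}\in\Omega$. Its dual space $\mathcal{B}_{\Phi}^p(\Omega)'$ is isometrically equivalent to the closed subspace \[ \mathcal{N}_0^{\perp}=\left\{g\in\mathcal{B}_{\Phi}^q(\mathbb{R}^d):\ \langle f,g\rangle_{\mathcal{B}_{\Phi}^p(\mathbb{R}^d)}=0\text{ for all }f\in\mathcal{N}_0\right\} \] of $\mathcal{B}_{\Phi}^q(\mathbb{R}^d)$, where $\mathcal{N}_0:=\{f\in\mathcal{B}_{\Phi}^p(\mathbb{R}^d):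 f|_{\Omega}=0\}$. Moreover, $\mathcal{B}_{\Phi}^p(\Omega)$ is uniformly convex and smooth.
   Context: Fourier transform: $\hat f(\boldsymbol{x})=(2\pi)^{-d/2}\int f(\boldsymbol{y})e^{-i\boldsymbol{x}^T\boldsymbol{y}}d\boldsymbol{y}$, extended to tempered distributions. A continuous $\Phi$ with $\Phi(\boldsymbol{x})=\overline{\Phi(-\boldsymbol{x})}$ is positive definite if $\sum_{j,k}c_j\overline{c_k}\Phi(\boldsymbol{x}_j-\boldsymbol{x}_k)>0$ for all pairwise distinct finite point sets and nonzero $\boldsymbol{c}$. Slowly increasing: $O(\|\boldsymbol{x}\|_2^m)$ at infinity for some $m$. For $1<r<\infty$ with conjugate $r'$, $\mathcal{B}_{\Phi}^r(\mathbb{R}^d)$ is the space of continuous slowly increasing $f$ whose distributional Fourier transform is a measurable function with $\hat f/\hat\Phi^{1/r'}\in L_{r'}(\mathbb{R}^d)$, normed by $\left((2\pi)^{-d/2}\int|\hat f|^{r'}/\hat\Phi\right)^{1/r'}$. The dual of $\mathcal{B}_\Phi^p(\mathbb{R}^d)$ is identified (antilinearly, isometrically) with $\mathcal{B}_\Phi^q(\mathbb{R}^d)$ via the pairing $\langle f,g\rangle_{\mathcal{B}_\Phi^p(\mathbb{R}^d)}=(2\pi)^{-d/2}\int\hat f\,\overline{\hat g}/\hat\Phi$. RKBS with two-sided kernel: $\mathcal{B}$ is a Banach space of functions on $\Omega_1$ whose dual is identified via an antilinear isometric isomorphism with a Banach space $\mathcal{F}$ of functions on $\Omega_2$, with pairing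 $\langle f,g\rangle_{\mathcal{B}}$; $K:\Omega_2\times\Omega_1\to\mathbb{C}$ is two-sided reproducing if $K(\cdot,\boldsymbol{y})\in\mathcal{F}$, $f(\boldsymbol{y})=\langle f,K(\cdot,\boldsymbol{y})\rangle_{\mathcal{B}}$ for $f\in\mathcal{B}$, $\boldsymbol{y}\in\Omega_1$, and $\overline{K(\boldsymbol{x},\cdot)}\in\mathcal{B}$, $\overline{g(\boldsymbol{x})}=\langle\overline{K(\boldsymbol{x},\cdot)},g\rangle_{\mathcal{B}}$ for $g\in\mathcal{F}$, $\boldsymbol{x}\in\Omega_2$. Here $\Omega_1=\Omega$, $\Omega_2=\mathbb{R}^d$. *)

theory Defs
  imports "HOL-Analysis.Analysis"
begin

definition FT :: "('a::euclidean_space \<Rightarrow> complex) \<Rightarrow> 'a \<Rightarrow> complex" where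
  "FT f \<xi> = complex_of_real ((2*pi) powr (- real DIM('a) / 2)) *
      integral\<^sup>L lborel (\<lambda>y. f y * exp (- \<i> * complex_of_real (\<xi> \<bullet> y)))"

inductive_set pderivs :: "('a::euclidean_space \<Rightarrow> complex) \<Rightarrow> ('a \<Rightarrow> complex) set"
  for \<gamma> where
  self: "\<gamma> \<in> pderivs \<gamma>"
| step: "h \<in> pderivs \<gamma> \<Longrightarrow> i \<in> Basis \<Longrightarrow> (\<lambda>x. frechet_derivative h (at x) i) \<in> pderivs \<gamma>"

definition schwartz :: "('a::euclidean_space \<Rightarrow> complex) \<Rightarrow> bool" where
  "schwartz \<gamma> \<longleftrightarrow> (\<forall>h\<in>pderivs \<gamma>. (\<forall>x. h differentiable (at x)) \<and>
       (\<forall>N::nat. \<exists>C. \<forall>x. (1 + norm x) ^ N * cmod (h x) \<le> C))"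

definition has_dist_FT :: "('a::euclidean_space \<Rightarrow> complex) \<Rightarrow> ('a \<Rightarrow> complex) \<Rightarrow> bool" where
  "has_dist_FT f g \<longleftrightarrow> g \<in> borel_measurable lborel \<and>
     (\<forall>\<gamma>. schwartz \<gamma> \<longrightarrow> integrable lborel (\<lambda>x. g x * \<gamma> x) \<and>
        integral\<^sup>L lborel (\<lambda>x. f x * FT \<gamma> x) = integral\<^sup>L lborel (\<lambda>x. g x * \<gamma> x))"

definition dFT :: "('a::euclidean_space \<Rightarrow> complex) \<Rightarrow> 'a \<Rightarrow> complex" where
  "dFT f = (SOME g. has_dist_FT f g)"

definition slowly_increasing :: "('a::euclidean_space \<Rightarrow> complex) \<Rightarrow> bool" where
  "slowly_increasing f \<longleftrightarrow> (\<exists>m::nat. \<exists>C R. \<forall>x. norm x \<ge> R \<longrightarrow> cmod (f x) \<le> C * norm x ^ m)"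

definition positive_definite :: "('a::euclidean_space \<Rightarrow> complex) \<Rightarrow> bool" where
  "positive_definite \<Phi> \<longleftrightarrow> continuous_on UNIV \<Phi> \<and> (\<forall>x. \<Phi> x = cnj (\<Phi> (- x))) \<and>
     (\<forall>X c. finite X \<and> (\<exists>x\<in>X. c x \<noteq> 0) \<longrightarrow>
        (let s = (\<Sum>x\<in>X. \<Sum>y\<in>X. c x * cnj (c y) * \<Phi> (x - y)) in s \<in> \<real> \<and> Re s > 0))"

text \<open>Fourier transform of \<Phi> (real and nonnegative for positive definite integrable \<Phi>).\<close>
definition PhiH :: "('a::euclidean_space \<Rightarrow> complex) \<Rightarrow> 'a \<Rightarrow> real" where
  "PhiH \<Phi> x = Re (FT \<Phi> x)"

text \<open>The weighted integral \<open>\<integral> |g|^{r'} / \<Phi>^\<close> in ennreal, so that \<open>a/0 = \<infinity>\<close> for \<open>a > 0\<close>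
  and \<open>0/0 = 0\<close>.\<close>
definition wint :: "real \<Rightarrow> ('a::euclidean_space \<Rightarrow> complex) \<Rightarrow> ('a \<Rightarrow> complex) \<Rightarrow> ennreal" where
  "wint r' \<Phi> g = (\<integral>\<^sup>+ x. ennreal (cmod (g x) powr r') / ennreal (PhiH \<Phi> x) \<partial>lborel)"

definition Bsp :: "real \<Rightarrow> ('a::euclidean_space \<Rightarrow> complex) \<Rightarrow> ('a \<Rightarrow> complex) set" where
  "Bsp r \<Phi> = {f. continuous_on UNIV f \<and> slowly_increasing f \<and>
      (\<exists>g. has_dist_FT f g \<and> wint (r / (r - 1)) \<Phi> g < \<infinity>)}"

definition Bnorm :: "real \<Rightarrow> ('a::euclidean_space \<Rightarrow> complex) \<Rightarrow> ('a \<Rightarrow> complex) \<Rightarrow> real" where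
  "Bnorm r \<Phi> f = ((2*pi) powr (- real DIM('a) / 2) * enn2real (wint (r / (r - 1)) \<Phi> (dFT f)))
      powr (1 / (r / (r - 1)))"

definition bpair :: "('a::euclidean_space \<Rightarrow> complex) \<Rightarrow> ('a \<Rightarrow> complex) \<Rightarrow> ('a \<Rightarrow> complex) \<Rightarrow> complex" where
  "bpair \<Phi> f g = complex_of_real ((2*pi) powr (- real DIM('a) / 2)) *
     integral\<^sup>L lborel (\<lambda>x. dFT f x * cnj (dFT g x) / complex_of_real (PhiH \<Phi> x))"

text \<open>Functions on \<Omega> are represented extensionally: value 0 outside \<Omega>.\<close>
definition restr :: "'a set \<Rightarrow> ('a \<Rightarrow> complex) \<Rightarrow> 'a \<Rightarrow> complex" where
  "restr \<Omega> f = (\<lambda>x. if x \<in> \<Omega> then f x else 0)"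

definition BOm :: "real \<Rightarrow> ('a::euclidean_space \<Rightarrow> complex) \<Rightarrow> 'a set \<Rightarrow> ('a \<Rightarrow> complex) set" where
  "BOm p \<Phi> \<Omega> = restr \<Omega> ` Bsp p \<Phi>"

definition BOm_norm :: "real \<Rightarrow> ('a::euclidean_space \<Rightarrow> complex) \<Rightarrow> 'a set \<Rightarrow> ('a \<Rightarrow> complex) \<Rightarrow> real" where
  "BOm_norm p \<Phi> \<Omega> h = Inf {Bnorm p \<Phi> f |f. f \<in> Bsp p \<Phi> \<and> restr \<Omega> f = h}"

definition N0 :: "real \<Rightarrow> ('a::euclidean_space \<Rightarrow> complex) \<Rightarrow> 'a set \<Rightarrow> ('a \<Rightarrow> complex) set" where
  "N0 p \<Phi> \<Omega> = {f \<in> Bsp p \<Phi>. restr \<Omega> f = (\<lambda>x. 0)}"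

definition N0perp :: "real \<Rightarrow> ('a::euclidean_space \<Rightarrow> complex) \<Rightarrow> 'a set \<Rightarrow> ('a \<Rightarrow> complex) set" where
  "N0perp p \<Phi> \<Omega> = {g \<in> Bsp (p / (p - 1)) \<Phi>. \<forall>f\<in>N0 p \<Phi> \<Omega>. bpair \<Phi> f g = 0}"

text \<open>Pairing on B_\<Phi>^p(\<Omega>) \<times> N0perp: pair an (arbitrary) extension of h.\<close>
definition POm :: "real \<Rightarrow> ('a::euclidean_space \<Rightarrow> complex) \<Rightarrow> 'a set \<Rightarrow> ('a \<Rightarrow> complex) \<Rightarrow> ('a \<Rightarrow> complex) \<Rightarrow> complex" where
  "POm p \<Phi> \<Omega> h g = bpair \<Phi> (SOME f. f \<in> Bsp p \<Phi> \<and> restr \<Omega> f = h) g"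

definition normed_fspace :: "('a \<Rightarrow> complex) set \<Rightarrow> (('a \<Rightarrow> complex) \<Rightarrow> real) \<Rightarrow> bool" where
  "normed_fspace V N \<longleftrightarrow> (\<lambda>x. 0) \<in> V \<and>
     (\<forall>f\<in>V. \<forall>g\<in>V. (\<lambda>x. f x + g x) \<in> V) \<and> (\<forall>c. \<forall>f\<in>V. (\<lambda>x. c * f x) \<in> V) \<and>
     (\<forall>f\<in>V. N f \<ge> 0 \<and> (N f = 0 \<longleftrightarrow> f = (\<lambda>x. 0))) \<and>
     (\<forall>c. \<forall>f\<in>V. N (\<lambda>x. c * f x) = cmod c * N f) \<and>
     (\<forall>f\<in>V. \<forall>g\<in>V. N (\<lambda>x. f x + g x) \<le> N f + N g)"

definition banach_fspace :: "('a \<Rightarrow> complex) set \<Rightarrow> (('a \<Rightarrow> complex) \<Rightarrow> real) \<Rightarrow> bool" where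
  "banach_fspace V N \<longleftrightarrow> normed_fspace V N \<and>
     (\<forall>s. (\<forall>n. s n \<in> V) \<and> (\<forall>e>0. \<exists>M. \<forall>m\<ge>M. \<forall>n\<ge>M. N (\<lambda>x. s m x - s n x) < e) \<longrightarrow>
        (\<exists>f\<in>V. (\<lambda>n. N (\<lambda>x. s n x - f x)) \<longlonglongrightarrow> 0))"

definition closed_in_fspace :: "('a \<Rightarrow> complex) set \<Rightarrow> (('a \<Rightarrow> complex) \<Rightarrow> real) \<Rightarrow> ('a \<Rightarrow> complex) set \<Rightarrow> bool" where
  "closed_in_fspace W N F \<longleftrightarrow> F \<subseteq> W \<and>
     (\<forall>s f. (\<forall>n. s n \<in> F) \<and> f \<in> W \<and> (\<lambda>n. N (\<lambda>x. s n x - f x)) \<longlonglongrightarrow> 0 \<longrightarrow> f \<in> F)"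

definition bounded_linear_functional :: "('a \<Rightarrow> complex) set \<Rightarrow> (('a \<Rightarrow> complex) \<Rightarrow> real) \<Rightarrow> (('a \<Rightarrow> complex) \<Rightarrow> complex) \<Rightarrow> bool" where
  "bounded_linear_functional V N \<phi> \<longleftrightarrow>
     (\<forall>f\<in>V. \<forall>g\<in>V. \<phi> (\<lambda>x. f x + g x) = \<phi> f + \<phi> g) \<and>
     (\<forall>c. \<forall>f\<in>V. \<phi> (\<lambda>x. c * f x) = c * \<phi> f) \<and>
     (\<exists>C. \<forall>f\<in>V. cmod (\<phi> f) \<le> C * N f)"

definition dual_norm :: "('a \<Rightarrow> complex) set \<Rightarrow> (('a \<Rightarrow> complex) \<Rightarrow> real) \<Rightarrow> (('a \<Rightarrow> complex) \<Rightarrow> complex) \<Rightarrow> real" where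
  "dual_norm V N \<phi> = Sup {cmod (\<phi> f) |f. f \<in> V \<and> N f \<le> 1}"

definition uniformly_convex_fspace :: "('a \<Rightarrow> complex) set \<Rightarrow> (('a \<Rightarrow> complex) \<Rightarrow> real) \<Rightarrow> bool" where
  "uniformly_convex_fspace V N \<longleftrightarrow> (\<forall>e>0. \<exists>\<delta>>0. \<forall>f\<in>V. \<forall>g\<in>V.
      N f = 1 \<and> N g = 1 \<and> N (\<lambda>x. f x - g x) \<ge> e \<longrightarrow> N (\<lambda>x. (f x + g x) / 2) \<le> 1 - \<delta>)"

definition smooth_fspace :: "('a \<Rightarrow> complex) set \<Rightarrow> (('a \<Rightarrow> complex) \<Rightarrow> real) \<Rightarrow> bool" where
  "smooth_fspace V N \<longleftrightarrow> (\<forall>f\<in>V. f \<noteq> (\<lambda>x. 0) \<longrightarrow> (\<forall>g\<in>V. \<exists>L.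
      ((\<lambda>t::real. (N (\<lambda>x. f x + complex_of_real t * g x) - N f) / t) \<longlongrightarrow> L) (at 0)))"

text \<open>RKBS with two-sided reproducing kernel K : \<Omega>2 \<times> \<Omega>1 \<rightarrow> C (functions on \<Omega>i are
  represented extensionally, vanishing outside \<Omega>i). The dual of (V,N) is identified with
  the Banach space (F,NF) via the antilinear isometric isomorphism g \<mapsto> (f \<mapsto> P f g).\<close>
definition rkbs_two_sided ::
  "('a \<Rightarrow> complex) set \<Rightarrow> (('a \<Rightarrow> complex) \<Rightarrow> real) \<Rightarrow> 'a set \<Rightarrow>
   ('b \<Rightarrow> complex) set \<Rightarrow> (('b \<Rightarrow> complex) \<Rightarrow> real) \<Rightarrow> 'b set \<Rightarrow>
   (('a \<Rightarrow> complex) \<Rightarrow> ('b \<Rightarrow> complex) \<Rightarrow> complex) \<Rightarrow> ('b \<Rightarrow> 'a \<Rightarrow> complex) \<Rightarrow> bool" where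
  "rkbs_two_sided V N \<Omega>1 F NF \<Omega>2 P K \<longleftrightarrow>
     banach_fspace V N \<and> banach_fspace F NF \<and>
     (\<forall>g\<in>F. bounded_linear_functional V N (\<lambda>f. P f g) \<and> dual_norm V N (\<lambda>f. P f g) = NF g) \<and>
     (\<forall>c. \<forall>g1\<in>F. \<forall>g2\<in>F. \<forall>f\<in>V. P f (\<lambda>x. c * g1 x + g2 x) = cnj c * P f g1 + P f g2) \<and>
     (\<forall>\<phi>. bounded_linear_functional V N \<phi> \<longrightarrow> (\<exists>!g. g \<in> F \<and> (\<forall>f\<in>V. \<phi> f = P f g))) \<and>
     (\<forall>y\<in>\<Omega>1. (\<lambda>x. if x \<in> \<Omega>2 then K x y else 0) \<in> F \<and>
        (\<forall>f\<in>V. f y = P f (\<lambda>x. if x \<in> \<Omega>2 then K x y else 0))) \<and>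
     (\<forall>x\<in>\<Omega>2. (\<lambda>y. if y \<in> \<Omega>1 then cnj (K x y) else 0) \<in> V \<and>
        (\<forall>g\<in>F. cnj (g x) = P (\<lambda>y. if y \<in> \<Omega>1 then cnj (K x y) else 0) g))"

end

theory Submission
  imports Defs "HOL-Probability.Probability"
begin

text \<open>
  Put \<open>P = \<Phi>^\<close>. Bochner's argument gives \<open>P \<ge> 0\<close>, and the integrability hypothesis gives \<open>P \<in> L\<^sub>1\<close>. By
  Hoelder's inequality every \<open>g\<close> with \<open>g / P\<^sup>1\<^sup>/\<^sup>s \<in> L\<^sub>s\<close>, \<open>s \<in> {p, q}\<close>, is integrable, so the native spaces consist
  of inverse Fourier transforms and are isometric to \<open>L\<^sub>s\<close> of the measure with density \<open>(2\<pi>)\<^sup>-\<^sup>d\<^sup>/\<^sup>2 / P\<close> on \<open>{P \<noteq> 0}\<close>,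
  with \<open>s\<close> the conjugate exponent; the pairing becomes the \<open>L\<^sub>q\<close>-\<open>L\<^sub>p\<close> pairing, and inversion of \<open>\<Phi>\<close> is the
  reproducing property.

  No duality theorem for \<open>L\<^sub>s\<close> is needed: by uniform convexity a bounded functional \<open>\<phi>\<close> has an element \<open>f\<close> of least
  norm in \<open>{\<phi> = 1}\<close>, and the derivative of the norm at \<open>f\<close>, which is given by an explicit element of the
  conjugate space, annihilates \<open>ker \<phi>\<close> and hence is a multiple of \<open>\<phi>\<close>. Least-norm extensions also carry completeness, uniform convexity
  and smoothness over to the quotient: the quotient norm along a line is squeezed between the norm of the extension and
  the real part of the functional that supports it.
\<close>

section \<open>Quotients of uniformly convex function spaces\<close>

text \<open>Conjugate exponents satisfy \<open>min p q \<le> 2\<close> and the transform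
  \<open>P\<close> of \<open>\<Phi>\<close> is bounded, so the one hypothesis on \<open>P\<close>
  makes \<open>P\<close>, \<open>P powr (p - 1)\<close> and \<open>P powr (q - 1)\<close>
  integrable. The last two say that \<open>P\<close> lies in \<open>L^p\<close> and
  \<open>L^q\<close> for a density proportional to \<open>1 / P\<close>: the kernel functions belong
  to both model spaces.

  The obstacle is that \<open>dFT\<close> is a choice: a transform is fixed only almost everywhere,
  and that only once distributional transforms are known to be unique among functions that are
  merely integrable against Schwartz functions. Modulated Gaussians settle this: they are Schwartz
  functions, their transforms are explicit approximate identities, and they yield both inversion and
  uniqueness.

  \<open>P\<close> may vanish somewhere. Since \<open>a / 0 = \<infinity>\<close> in
  \<open>wint\<close>, a finite norm makes transforms vanish there almost everywhere, in accordance
  with a measure that ignores this set.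

  Continuity of point evaluations, from the reproducing property, closes the set of extensions of a
  function on \<open>\<Omega>\<close>; this is why least-norm extensions exist.\<close>

locale normed_fspace_loc =
  fixes V :: "('a \<Rightarrow> complex) set" and N :: "('a \<Rightarrow> complex) \<Rightarrow> real"
  assumes normed: "normed_fspace V N"
begin

lemma zero_mem: "(\<lambda>x. 0) \<in> V"
  and add_mem: "f \<in> V \<Longrightarrow> g \<in> V \<Longrightarrow> (\<lambda>x. f x + g x) \<in> V"
  and scale_mem: "f \<in> V \<Longrightarrow> (\<lambda>x. c * f x) \<in> V"
  and N_nonneg: "f \<in> V \<Longrightarrow> 0 \<le> N f"
  and N_eq_0: "f \<in> V \<Longrightarrow> N f = 0 \<longleftrightarrow> f = (\<lambda>x. 0)"
  and N_scale: "f \<in> V \<Longrightarrow> N (\<lambda>x. c * f x) = cmod c * N f"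
  and N_triangle: "f \<in> V \<Longrightarrow> g \<in> V \<Longrightarrow> N (\<lambda>x. f x + g x) \<le> N f + N g"
  using normed unfolding normed_fspace_def by blast+

lemma lincomb_mem: "f \<in> V \<Longrightarrow> g \<in> V \<Longrightarrow> (\<lambda>x. a * f x + b * g x) \<in> V"
  using add_mem[OF scale_mem scale_mem] by simp

lemma N_lincomb: "f \<in> V \<Longrightarrow> g \<in> V \<Longrightarrow> N (\<lambda>x. a * f x + b * g x) \<le> cmod a * N f + cmod b * N g"
  using N_triangle[OF scale_mem scale_mem, of f g a b] by (simp add: N_scale)

lemma diff_mem: "f \<in> V \<Longrightarrow> g \<in> V \<Longrightarrow> (\<lambda>x. f x - g x) \<in> V"
  using lincomb_mem[of f g 1 "-1"] by simp

lemma N_diff_le: "f \<in> V \<Longrightarrow> g \<in> V \<Longrightarrow> N (\<lambda>x. f x - g x) \<le> N f + N g"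
  using N_lincomb[of f g 1 "-1"] by simp

lemma N_diff_commute: "f \<in> V \<Longrightarrow> g \<in> V \<Longrightarrow> N (\<lambda>x. f x - g x) = N (\<lambda>x. g x - f x)"
  using N_scale[OF diff_mem, of f g "-1"] by simp

lemma N_diff_triangle:
  assumes "f \<in> V" "g \<in> V" "h \<in> V"
  shows "N (\<lambda>x. f x - h x) \<le> N (\<lambda>x. f x - g x) + N (\<lambda>x. g x - h x)"
  using N_triangle[OF diff_mem[OF assms(1,2)] diff_mem[OF assms(2,3)]] by simp

lemma N_diff_ge: "f \<in> V \<Longrightarrow> g \<in> V \<Longrightarrow> N f - N g \<le> N (\<lambda>x. f x - g x)"
  using N_triangle[OF diff_mem, of f g g] by simp

lemma N_zero: "N (\<lambda>x. 0) = 0"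
  using N_eq_0[OF zero_mem] by simp

lemma sum_mem: "(\<And>j::nat. d j \<in> V) \<Longrightarrow> (\<lambda>x. \<Sum>j<k. d j x) \<in> V"
  by (induction k) (simp_all add: zero_mem add_mem)

lemma N_lim:
  assumes "\<And>n::nat. s n \<in> V" "f \<in> V" "(\<lambda>n. N (\<lambda>x. s n x - f x)) \<longlonglongrightarrow> 0"
  shows "(\<lambda>n. N (s n)) \<longlonglongrightarrow> N f"
proof (rule LIM_zero_cancel, rule Lim_null_comparison[OF _ assms(3)])
  show "\<forall>\<^sub>F n in sequentially. norm (N (s n) - N f) \<le> N (\<lambda>x. s n x - f x)"
    using N_diff_ge[of "s _" f] N_diff_ge[of f "s _"] N_diff_commute[of f "s _"] assms(1,2)
    by (intro always_eventually allI) (auto simp: abs_le_iff)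
qed

text \<open>The right-hand side is the exact value of the geometric sum of \<open>(1/2) ^ j\<close>
  over \<open>m \<le> j < n\<close>; keeping the subtracted term lets the induction close without
  slack.\<close>

lemma fast_diff_bound:
  assumes s: "\<And>n::nat. s n \<in> V" and fast: "\<And>n. N (\<lambda>x. s (Suc n) x - s n x) \<le> (1/2) ^ n"
  shows "m \<le> n \<Longrightarrow> N (\<lambda>x. s n x - s m x) \<le> 2 * (1/2) ^ m - 2 * (1/2) ^ n"
proof (induction n rule: dec_induct)
  case base then show ?case by (simp add: N_zero)
next
  case (step n)
  have "N (\<lambda>x. s (Suc n) x - s m x) \<le> (1/2) ^ n + (2 * (1/2) ^ m - 2 * (1/2) ^ n)"
    using N_diff_triangle[of "s (Suc n)" "s n" "s m"] s fast[of n] step by (smt (verit))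
  then show ?case by simp
qed

lemma fast_Cauchy:
  assumes s: "\<And>n::nat. s n \<in> V" and fast: "\<And>n. N (\<lambda>x. s (Suc n) x - s n x) \<le> (1/2) ^ n" and "e > 0"
  shows "\<exists>M. \<forall>m\<ge>M. \<forall>n\<ge>M. N (\<lambda>x. s m x - s n x) < e"
proof -
  have "(\<lambda>n. (1/2::real) ^ n) \<longlonglongrightarrow> 0" by (rule LIMSEQ_realpow_zero) auto
  then obtain M where M: "\<And>n. n \<ge> M \<Longrightarrow> (1/2::real) ^ n < e / 2"
    using \<open>e > 0\<close> order_tendstoD(2)[of _ 0 sequentially "e/2"] unfolding eventually_sequentially
    by (metis half_gt_zero)
  have *: "N (\<lambda>x. s m x - s n x) < e" if "M \<le> m" "m \<le> n" for m n
  proof -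
    have "N (\<lambda>x. s n x - s m x) \<le> 2 * (1/2) ^ m" 
      using fast_diff_bound[OF s fast that(2)] zero_le_power[of "1/2::real" n] by linarith
    then show ?thesis using M[OF that(1)] N_diff_commute[of "s m" "s n"] s by auto
  qed
  show ?thesis
    using * N_diff_commute s by (intro exI[of _ M] allI impI) (metis linorder_le_cases)
qed

text \<open>A Cauchy sequence has a subsequence with increments at most \<open>(1/2) ^ k\<close> and
  converges as soon as that subsequence does. Completeness is thus reduced to sequences with
  summable increments, which can be lifted one by one from a quotient or controlled pointwise in an
  \<open>L^s\<close> space.\<close>

lemma banachI_fast:
  assumes conv: "\<And>s. (\<And>n::nat. s n \<in> V) \<Longrightarrow> (\<And>n. N (\<lambda>x. s (Suc n) x - s n x) \<le> (1/2) ^ n) \<Longrightarrow>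
      \<exists>f\<in>V. (\<lambda>n. N (\<lambda>x. s n x - f x)) \<longlonglongrightarrow> 0"
  shows "banach_fspace V N"
  unfolding banach_fspace_def
proof (intro conjI normed allI impI, elim conjE)
  fix s :: "nat \<Rightarrow> 'a \<Rightarrow> complex"
  assume "\<forall>n. s n \<in> V" and C: "\<forall>e>0. \<exists>M. \<forall>m\<ge>M. \<forall>n\<ge>M. N (\<lambda>x. s m x - s n x) < e"
  then have s: "\<And>n. s n \<in> V" by blast
  have "\<forall>k. \<exists>M. \<forall>m\<ge>M. \<forall>n\<ge>M. N (\<lambda>x. s m x - s n x) < (1/2)^k"
    using C by auto
  then obtain M where M: "\<And>k m n. m \<ge> M k \<Longrightarrow> n \<ge> M k \<Longrightarrow> N (\<lambda>x. s m x - s n x) < (1/2)^k"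
    by metis
  \<comment> \<open>Summing the thresholds makes \<open>r\<close> dominate every earlier one, so
    that both \<open>r k\<close> and \<open>r (Suc k)\<close> lie beyond \<open>M k\<close>; the
    summand \<open>k\<close> makes \<open>r\<close> tend to infinity.\<close>
  define r where "r k = (\<Sum>j\<le>k. M j) + k" for k
  have r: "r k \<ge> M k" "r (Suc k) \<ge> M k" for k
    unfolding r_def by (auto simp: trans_le_add1 lessThan_Suc_atMost[symmetric])
  have "\<exists>f\<in>V. (\<lambda>n. N (\<lambda>x. s (r n) x - f x)) \<longlonglongrightarrow> 0"
    using M r s by (intro conv) (auto intro: less_imp_le)
  then obtain f where f: "f \<in> V" "(\<lambda>n. N (\<lambda>x. s (r n) x - f x)) \<longlonglongrightarrow> 0" by blast
  have "(\<lambda>n. N (\<lambda>x. s n x - f x)) \<longlonglongrightarrow> 0"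
  proof (rule LIMSEQ_I)
    fix e :: real assume "e > 0"
    then obtain K where K: "\<And>m n. m \<ge> K \<Longrightarrow> n \<ge> K \<Longrightarrow> N (\<lambda>x. s m x - s n x) < e/2"
      using C half_gt_zero by meson
    obtain L where L: "\<And>n. n \<ge> L \<Longrightarrow> N (\<lambda>x. s (r n) x - f x) < e/2"
      using LIMSEQ_D[OF f(2), of "e/2"] \<open>e > 0\<close> N_nonneg diff_mem s f(1) by auto
    define j where "j = max K L"
    have j: "r j \<ge> K" "j \<ge> L" unfolding j_def r_def by auto
    have "N (\<lambda>x. s n x - f x) < e" if "n \<ge> K" for n
      using N_diff_triangle[OF s s f(1), of n "r j"] K[OF that j(1)] L[OF j(2)] by linarith
    then show "\<exists>no. \<forall>n\<ge>no. norm (N (\<lambda>x. s n x - f x) - 0) < e"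
      using N_nonneg[OF diff_mem[OF s f(1)]] by auto
  qed
  then show "\<exists>f\<in>V. (\<lambda>n. N (\<lambda>x. s n x - f x)) \<longlonglongrightarrow> 0" using f(1) by blast
qed

text \<open>Write \<open>f = a u\<close> and \<open>g = b v\<close> with unit vectors and
  \<open>a\<close>, \<open>b\<close> in \<open>[d, d + \<eta>)\<close>. The midpoint is
  \<open>d\<close> times that of \<open>u\<close> and \<open>v\<close> up to an error below
  \<open>\<eta>\<close>, so \<open>mid\<close> forces the norm of the latter above
  \<open>1 - \<delta>\<close>, and \<open>u - v\<close> has norm below \<open>e\<close>. The errors
  in \<open>f - g\<close> add up to less than \<open>2 * \<eta>\<close>.\<close>

lemma midpoint_minimizing_bound:
  assumes V: "f \<in> V" "g \<in> V" and d: "d > 0" "d \<le> N f" "d \<le> N g"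
    and mid: "d \<le> N (\<lambda>x. (f x + g x) / 2)"
    and small: "N f < d + \<eta>" "N g < d + \<eta>" and "\<eta> \<le> d * \<delta>"
    and uc: "\<And>f g. f \<in> V \<Longrightarrow> g \<in> V \<Longrightarrow> N f = 1 \<Longrightarrow> N g = 1 \<Longrightarrow> N (\<lambda>x. f x - g x) \<ge> e \<Longrightarrow>
      N (\<lambda>x. (f x + g x) / 2) \<le> 1 - \<delta>"
  shows "N (\<lambda>x. f x - g x) < d * e + 2 * \<eta>"
proof -
  define a b where "a = N f" and "b = N g"
  have ab: "a > 0" "b > 0" using d unfolding a_def b_def by auto
  define u v where "u = (\<lambda>x. complex_of_real (1/a) * f x)" and "v = (\<lambda>x. complex_of_real (1/b) * g x)"
  have uv: "u \<in> V" "v \<in> V" unfolding u_def v_def using V by (auto intro: scale_mem simp del: of_real_divide)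
  have n1: "N u = 1" "N v = 1" unfolding u_def v_def N_scale[OF V(1)] N_scale[OF V(2)]
    using ab by (auto simp: a_def[symmetric] b_def[symmetric] norm_divide)
  have f: "f = (\<lambda>x. complex_of_real a * u x)" and g: "g = (\<lambda>x. complex_of_real b * v x)"
    unfolding u_def v_def using ab by auto
  have m: "(\<lambda>x. (u x + v x)/2) \<in> V" using lincomb_mem[OF uv, of "1/2" "1/2"] by (simp add: field_simps)
  have l: "(\<lambda>x. complex_of_real ((a-d)/2) * u x + complex_of_real ((b-d)/2) * v x) \<in> V"
     by (rule lincomb_mem[OF uv])
  have "d \<le> N (\<lambda>x. (complex_of_real d * ((u x + v x)/2)) +
      (complex_of_real ((a-d)/2) * u x + complex_of_real ((b-d)/2) * v x))"
    using mid unfolding f g by (simp add: algebra_simps add_divide_distrib diff_divide_distrib)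
  also have "\<dots> \<le> d * N (\<lambda>x. (u x + v x)/2) + ((a-d)/2 + (b-d)/2)"
    using N_triangle[OF scale_mem[OF m, of d] l] N_lincomb[OF uv, of "complex_of_real ((a-d)/2)" "complex_of_real ((b-d)/2)"] 
      N_scale[OF m, of d] d unfolding n1 norm_of_real a_def b_def by simp
  also have "(a-d)/2 + (b-d)/2 < \<eta>" using small unfolding a_def[symmetric] b_def[symmetric] by (simp add: field_simps)
  finally have "d * (1 - \<delta>) < d * N (\<lambda>x. (u x + v x)/2)" using \<open>\<eta> \<le> d * \<delta>\<close> by (simp add: algebra_simps)
  then have "1 - \<delta> < N (\<lambda>x. (u x + v x)/2)" using d by simp
  then have lt: "N (\<lambda>x. u x - v x) < e" using uc[OF uv n1] by (meson linorder_not_le)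
  have l2: "(\<lambda>x. complex_of_real (a-d) * u x + complex_of_real (d - b) * v x) \<in> V"
     by (rule lincomb_mem[OF uv])
  have "N (\<lambda>x. f x - g x) = N (\<lambda>x. complex_of_real d * (u x - v x) + 
      (complex_of_real (a-d) * u x + complex_of_real (d - b) * v x))"
    unfolding f g by (simp add: algebra_simps)
  also have "\<dots> \<le> d * N (\<lambda>x. u x - v x) + ((a-d) + (b-d))"
    using N_triangle[OF scale_mem[OF diff_mem[OF uv], of d] l2] N_lincomb[OF uv, of "complex_of_real (a-d)" "complex_of_real (d-b)"] 
      N_scale[OF diff_mem[OF uv], of d] d unfolding n1 norm_of_real a_def b_def by simp
  also have "\<dots> < d * e + 2 * \<eta>" using lt d small unfolding a_def b_def 
    by (smt (verit) mult_strict_left_mono)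
  finally show ?thesis .
qed

end

section \<open>Least-norm elements of closed convex sets\<close>

locale uc_banach_fspace = normed_fspace_loc +
  assumes banach: "banach_fspace V N" and uc: "uniformly_convex_fspace V N"
begin

lemma convergent:
  assumes "\<And>n::nat. s n \<in> V" "\<And>e. e > 0 \<Longrightarrow> \<exists>M. \<forall>m\<ge>M. \<forall>n\<ge>M. N (\<lambda>x. s m x - s n x) < e"
  shows "\<exists>f\<in>V. (\<lambda>n. N (\<lambda>x. s n x - f x)) \<longlonglongrightarrow> 0"
  using banach assms unfolding banach_fspace_def by simp

text \<open>The midpoint of two nearly minimal elements stays in \<open>C\<close> and so has norm at
  least the infimum \<open>d\<close>. Uniform convexity then keeps the two close, so every
  minimising sequence is Cauchy.\<close>

lemma min_norm_exists:
  assumes C: "C \<subseteq> V" "C \<noteq> {}"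
    and mid: "\<And>f g. f \<in> C \<Longrightarrow> g \<in> C \<Longrightarrow> (\<lambda>x. (f x + g x) / 2) \<in> C"
    and closed: "\<And>s f. (\<And>n::nat. s n \<in> C) \<Longrightarrow> f \<in> V \<Longrightarrow> (\<lambda>n. N (\<lambda>x. s n x - f x)) \<longlonglongrightarrow> 0 \<Longrightarrow> f \<in> C"
  shows "\<exists>f\<in>C. \<forall>g\<in>C. N f \<le> N g"
proof -
  define d where "d = Inf (N ` C)"
  have bdd: "bdd_below (N ` C)" using N_nonneg C by (intro bdd_belowI[of _ 0]) auto
  have lower: "d \<le> N g" if "g \<in> C" for g unfolding d_def using that bdd by (simp add: cINF_lower)
  have d0: "d \<ge> 0" unfolding d_def using C N_nonneg by (intro cINF_greatest) auto
  have "\<exists>f\<in>C. N f < d + inverse (Suc n)" for n :: nat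
    using cInf_lessD[of "N ` C" "d + inverse (Suc n)"] C(2) unfolding d_def by auto
  then obtain s where s: "\<And>n. s n \<in> C" "\<And>n. N (s n) < d + inverse (Suc n)" by metis
  have sV: "s n \<in> V" for n using s C by auto
  have lim: "(\<lambda>n. N (s n)) \<longlonglongrightarrow> d"
  proof (rule tendsto_sandwich[of "\<lambda>_. d" _ _ "\<lambda>n. d + inverse (Suc n)"])
    show "(\<lambda>n. d + inverse (Suc n)) \<longlonglongrightarrow> d"
      using tendsto_add[OF tendsto_const LIMSEQ_inverse_real_of_nat] by simp
    show "(\<lambda>n. d) \<longlonglongrightarrow> d" by simp
  qed (use lower s(1) less_imp_le[OF s(2)] in \<open>auto intro!: always_eventually simp del: of_nat_Suc\<close>)
  have Cauchy: "\<exists>M. \<forall>m\<ge>M. \<forall>n\<ge>M. N (\<lambda>x. s m x - s n x) < e" if "e > 0" for e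
  \<comment> \<open>Rescaling to the unit sphere needs \<open>d > 0\<close>. If
    \<open>d = 0\<close>, the sequence itself tends to zero in norm.\<close>
  proof (cases "d = 0")
    case True
    obtain M where "\<And>n. n \<ge> M \<Longrightarrow> N (s n) < e / 2"
      using order_tendstoD(2)[OF lim, of "e/2"] half_gt_zero[OF \<open>e > 0\<close>] True unfolding eventually_sequentially
      by auto
    then have "\<forall>m\<ge>M. \<forall>n\<ge>M. N (\<lambda>x. s m x - s n x) < e"
      using N_diff_le[OF sV sV] by (smt (verit) field_sum_of_halves)
    then show ?thesis by blast
  next
    case False
    then have d: "d > 0" using d0 by simp
    \<comment> \<open>The term \<open>d * e'\<close> becomes half of \<open>e\<close>; the bound
      \<open>e / 4\<close> on \<open>\<eta>\<close> below accounts for the other half.\<close>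
    define e' where "e' = e / (2 * d)"
    have "e' > 0" using that d by (simp add: e'_def)
    then obtain \<delta> where \<delta>: "\<delta> > 0" and uc': "\<And>f g. f \<in> V \<Longrightarrow> g \<in> V \<Longrightarrow> N f = 1 \<Longrightarrow> N g = 1 \<Longrightarrow> N (\<lambda>x. f x - g x) \<ge> e' \<Longrightarrow>
      N (\<lambda>x. (f x + g x) / 2) \<le> 1 - \<delta>"
      using uc unfolding uniformly_convex_fspace_def by metis
    define \<eta> where "\<eta> = min (d * \<delta>) (e / 4)"
    have "\<eta> > 0" using d \<delta> that by (simp add: \<eta>_def)
    then obtain M where M: "\<And>n. n \<ge> M \<Longrightarrow> N (s n) < d + \<eta>"
      using order_tendstoD(2)[OF lim, of "d + \<eta>"] unfolding eventually_sequentially by auto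
    have "N (\<lambda>x. s m x - s n x) < e" if "m \<ge> M" "n \<ge> M" for m n
    proof -
      have "N (\<lambda>x. s m x - s n x) < d * e' + 2 * \<eta>"
        by (rule midpoint_minimizing_bound[OF sV sV d _ _ _ M M _ uc'])
           (use that s mid lower in \<open>auto simp: \<eta>_def\<close>)
      also have "d * e' + 2 * \<eta> \<le> e" using d by (simp add: e'_def \<eta>_def)
      finally show ?thesis .
    qed
    then show ?thesis by blast
  qed
  obtain f where f: "f \<in> V" "(\<lambda>n. N (\<lambda>x. s n x - f x)) \<longlonglongrightarrow> 0" using convergent[OF sV Cauchy] by blast
  have "N f = d" using N_lim[OF sV f] lim LIMSEQ_unique by blast
  then show ?thesis using closed[OF s(1) f] lower by auto
qed

end

section \<open>Functionals represented through the derivative of the norm\<close>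

locale dual_pair = uc_banach_fspace V N
  for V :: "('a \<Rightarrow> complex) set" and N :: "('a \<Rightarrow> complex) \<Rightarrow> real" +
  fixes W :: "('b \<Rightarrow> complex) set" and NW :: "('b \<Rightarrow> complex) \<Rightarrow> real"
    and B :: "('a \<Rightarrow> complex) \<Rightarrow> ('b \<Rightarrow> complex) \<Rightarrow> complex"
  assumes banach_W: "banach_fspace W NW"
    and B_add: "f \<in> V \<Longrightarrow> g \<in> V \<Longrightarrow> u \<in> W \<Longrightarrow> B (\<lambda>x. f x + g x) u = B f u + B g u"
    and B_scale: "f \<in> V \<Longrightarrow> u \<in> W \<Longrightarrow> B (\<lambda>x. c * f x) u = c * B f u"
    and B_antilinear: "f \<in> V \<Longrightarrow> u \<in> W \<Longrightarrow> v \<in> W \<Longrightarrow> B f (\<lambda>x. c * u x + v x) = cnj c * B f u + B f v"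
    and B_bound: "f \<in> V \<Longrightarrow> u \<in> W \<Longrightarrow> cmod (B f u) \<le> N f * NW u"
    and norming: "u \<in> W \<Longrightarrow> \<exists>f\<in>V. N f \<le> 1 \<and> B f u = complex_of_real (NW u)"
    and norm_deriv: "f \<in> V \<Longrightarrow> f \<noteq> (\<lambda>x. 0) \<Longrightarrow> \<exists>g\<in>W. NW g \<le> 1 \<and> B f g = complex_of_real (N f) \<and>
      (\<forall>k\<in>V. ((\<lambda>t::real. (N (\<lambda>x. f x + complex_of_real t * k x) - N f) / t) \<longlongrightarrow> Re (B k g)) (at 0))"
begin

sublocale W: normed_fspace_loc W NW
  using banach_W by unfold_locales (simp add: banach_fspace_def)

lemma B_diff: "f \<in> V \<Longrightarrow> g \<in> V \<Longrightarrow> h \<in> W \<Longrightarrow> B (\<lambda>x. f x - g x) h = B f h - B g h"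
  using B_add[of "\<lambda>x. f x - g x" g h] diff_mem by simp

lemma B_diff_right: "f \<in> V \<Longrightarrow> g \<in> W \<Longrightarrow> h \<in> W \<Longrightarrow> B f (\<lambda>x. g x - h x) = B f g - B f h"
  using B_antilinear[of f h g "-1"] by simp

lemma B_scale_right: "f \<in> V \<Longrightarrow> g \<in> W \<Longrightarrow> B f (\<lambda>x. c * g x) = cnj c * B f g"
  using B_antilinear[of f g g "c - 1"] by (simp add: algebra_simps)

text \<open>At a minimum the difference quotients are nonnegative to the right of 0 and nonpositive
  to the left, so the two one-sided limits pin \<open>L\<close> to zero.\<close>

lemma norm_deriv_eq_0:
  assumes "f \<in> V" "k \<in> V" and min: "\<And>t::real. N f \<le> N (\<lambda>x. f x + complex_of_real t * k x)"
    and lim: "((\<lambda>t::real. (N (\<lambda>x. f x + complex_of_real t * k x) - N f) / t) \<longlongrightarrow> L) (at 0)"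
  shows "L = 0"
proof (rule antisym)
  have r: "((\<lambda>t::real. (N (\<lambda>x. f x + complex_of_real t * k x) - N f) / t) \<longlongrightarrow> L) (at_right 0)"
      and l: "((\<lambda>t::real. (N (\<lambda>x. f x + complex_of_real t * k x) - N f) / t) \<longlongrightarrow> L) (at_left 0)"
    using lim by (auto simp: filterlim_at_split)
  show "0 \<le> L"
    by (rule tendsto_lowerbound[OF r]) (use min in \<open>auto simp: eventually_at_filter intro!: always_eventually divide_nonneg_pos\<close>)
  show "L \<le> 0"
    by (rule tendsto_upperbound[OF l]) (use min in \<open>auto simp: eventually_at_filter intro!: always_eventually divide_nonneg_neg\<close>)
qed

text \<open>Vanishing of the real derivative along \<open>K\<close> gives only
  \<open>Re (B k g) = 0\<close>. As \<open>K\<close> is closed under complex multiples, the same for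
  \<open>\<i> * k\<close> removes the imaginary part.\<close>

lemma minimal_imp_annihilating:
  assumes f: "f \<in> V" "f \<noteq> (\<lambda>x. 0)" and K: "K \<subseteq> V" "\<And>c k. k \<in> K \<Longrightarrow> (\<lambda>x. c * k x) \<in> K"
    and min: "\<And>k. k \<in> K \<Longrightarrow> N f \<le> N (\<lambda>x. f x + k x)"
  shows "\<exists>g\<in>W. NW g \<le> 1 \<and> B f g = complex_of_real (N f) \<and> (\<forall>k\<in>K. B k g = 0) \<and>
      (\<forall>k\<in>V. ((\<lambda>t::real. (N (\<lambda>x. f x + complex_of_real t * k x) - N f) / t) \<longlongrightarrow> Re (B k g)) (at 0))"
proof -
  obtain g where g: "g \<in> W" "NW g \<le> 1" "B f g = complex_of_real (N f)"
    and lim: "\<And>k. k \<in> V \<Longrightarrow> ((\<lambda>t::real. (N (\<lambda>x. f x + complex_of_real t * k x) - N f) / t) \<longlongrightarrow> Re (B k g)) (at 0)"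
    using norm_deriv[OF f] by blast
  have Re0: "Re (B k g) = 0" if "k \<in> K" for k
    using that K min by (intro norm_deriv_eq_0[OF f(1) _ _ lim]) auto
  have "B k g = 0" if "k \<in> K" for k
  proof -
    have "Re (B (\<lambda>x. \<i> * k x) g) = 0" using Re0 K that by blast
    then have "Im (B k g) = 0" using B_scale[of k g \<i>] that K g by auto
    then show ?thesis using Re0[OF that] by (simp add: complex_eq_iff)
  qed
  then show ?thesis using g lim by (intro bexI[of _ g]) auto
qed

lemma functional_bound:
  assumes "bounded_linear_functional V N \<phi>"
  obtains C where "\<And>f. f \<in> V \<Longrightarrow> cmod (\<phi> f) \<le> C * N f" "C \<ge> 0"
proof -
  obtain C where "\<And>f. f \<in> V \<Longrightarrow> cmod (\<phi> f) \<le> C * N f"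
    using assms unfolding bounded_linear_functional_def by blast
  then have "cmod (\<phi> f) \<le> max C 0 * N f" if "f \<in> V" for f
    using that N_nonneg[OF that] by (meson max.cobounded1 mult_right_mono order_trans)
  then show ?thesis using that[of "max C 0"] by auto
qed

lemma representation:
  assumes \<phi>: "bounded_linear_functional V N \<phi>"
  shows "\<exists>g\<in>W. \<forall>f\<in>V. \<phi> f = B f g"
proof (cases "\<forall>f\<in>V. \<phi> f = 0")
  case True
  have "B f (\<lambda>x. 0) = 0" if "f \<in> V" for f
    using B_scale_right[OF that W.zero_mem, of 0] by simp
  then show ?thesis using True W.zero_mem by (intro bexI[of _ "\<lambda>x. 0"]) auto
next
  case False
  have add: "\<And>f g. f \<in> V \<Longrightarrow> g \<in> V \<Longrightarrow> \<phi> (\<lambda>x. f x + g x) = \<phi> f + \<phi> g"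
    and scale: "\<And>c f. f \<in> V \<Longrightarrow> \<phi> (\<lambda>x. c * f x) = c * \<phi> f"
    using \<phi> unfolding bounded_linear_functional_def by blast+
  have diff: "\<phi> (\<lambda>x. f x - g x) = \<phi> f - \<phi> g" if "f \<in> V" "g \<in> V" for f g
    using add[OF diff_mem[OF that] that(2)] by simp
  obtain C where C: "\<And>f. f \<in> V \<Longrightarrow> cmod (\<phi> f) \<le> C * N f" "C \<ge> 0" using functional_bound[OF \<phi>] by blast
  obtain e where e: "e \<in> V" "\<phi> e \<noteq> 0" using False by blast
  define S where "S = {f \<in> V. \<phi> f = 1}"
  have "(\<lambda>x. (1 / \<phi> e) * e x) \<in> S" unfolding S_def using scale[OF e(1), of "1 / \<phi> e"] scale_mem[OF e(1), of "1 / \<phi> e"] e by simp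
  then have "S \<noteq> {}" by blast
  moreover have "(\<lambda>x. (f x + g x) / 2) \<in> S" if "f \<in> S" "g \<in> S" for f g
  proof -
    have h: "(\<lambda>x. f x / 2) \<in> V \<and> \<phi> (\<lambda>x. f x / 2) = 1 / 2" if "f \<in> S" for f
      using that scale[of f "1/2"] scale_mem[of f "1/2"] unfolding S_def by simp
    show ?thesis
      using h[OF that(1)] h[OF that(2)] add_mem[of "\<lambda>x. f x / 2" "\<lambda>x. g x / 2"] add[of "\<lambda>x. f x / 2" "\<lambda>x. g x / 2"]
      unfolding S_def by (simp add: add_divide_distrib del: eq_divide_eq_numeral1 divide_eq_eq_numeral1)
  qed
  moreover have "f \<in> S" if s: "\<And>n::nat. s n \<in> S" "f \<in> V" "(\<lambda>n. N (\<lambda>x. s n x - f x)) \<longlonglongrightarrow> 0" for s f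
  proof -
    have "(\<lambda>n. C * N (\<lambda>x. s n x - f x)) \<longlonglongrightarrow> 0" using tendsto_mult_left[OF s(3), of C] by simp
    moreover have "cmod (1 - \<phi> f) \<le> C * N (\<lambda>x. s n x - f x)" for n
      using s(1)[of n] C(1)[OF diff_mem, of "s n" f] diff[of "s n" f] s(2) by (simp add: S_def)
    ultimately have "cmod (1 - \<phi> f) \<le> 0" by (intro LIMSEQ_le_const) auto
    then show ?thesis using s(2) by (simp add: S_def)
  qed
  ultimately obtain f where f: "f \<in> S" "\<And>g. g \<in> S \<Longrightarrow> N f \<le> N g"
    using min_norm_exists[of S] unfolding S_def by auto
  have fV: "f \<in> V" "\<phi> f = 1" using f(1) by (auto simp: S_def)
  have f0: "f \<noteq> (\<lambda>x. 0)" using C(1)[OF fV(1)] fV N_zero by auto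
  define K where "K = {k \<in> V. \<phi> k = 0}"
  have "\<exists>g\<in>W. NW g \<le> 1 \<and> B f g = complex_of_real (N f) \<and> (\<forall>k\<in>K. B k g = 0) \<and>
      (\<forall>k\<in>V. ((\<lambda>t::real. (N (\<lambda>x. f x + complex_of_real t * k x) - N f) / t) \<longlongrightarrow> Re (B k g)) (at 0))"
    using f fV scale_mem add_mem add scale by (intro minimal_imp_annihilating f0) (auto simp: K_def S_def)
  then obtain g where g: "g \<in> W" "B f g = complex_of_real (N f)" "\<And>k. k \<in> K \<Longrightarrow> B k g = 0" by blast
  have Nf: "N f > 0" using N_nonneg N_eq_0 fV f0 by (metis less_eq_real_def)
  \<comment> \<open>\<open>B f g = N f\<close> while \<open>\<phi> f = 1\<close>, so dividing by
    \<open>N f\<close> makes the two functionals agree at \<open>f\<close>. They agree on the kernel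
    \<open>K\<close>, and \<open>h - \<phi> h * f\<close> lies in \<open>K\<close> for every
    \<open>h\<close>.\<close>
  define G where "G = (\<lambda>x. complex_of_real (1 / N f) * g x)"
  have "\<phi> h = B h G" if h: "h \<in> V" for h
  proof -
    have k: "(\<lambda>x. h x - \<phi> h * f x) \<in> K"
      unfolding K_def using diff_mem[OF h scale_mem[OF fV(1)]] diff[OF h scale_mem[OF fV(1)]] scale[OF fV(1)] fV(2) by simp
    have "B h g = \<phi> h * B f g"
      using g(3)[OF k] B_diff[OF h scale_mem[OF fV(1)] g(1)] B_scale[OF fV(1) g(1)] by simp
    then show ?thesis unfolding G_def B_scale_right[OF h g(1)] g(2) using Nf by simp
  qed
  moreover have "G \<in> W" unfolding G_def using g(1) by (rule W.scale_mem)
  ultimately show ?thesis by blast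
qed

end

section \<open>Restriction to \<open>\<Omega>\<close> as a quotient\<close>

locale two_sided_kernel_pair = dual_pair V N W NW B
  for V :: "('a \<Rightarrow> complex) set" and N :: "('a \<Rightarrow> complex) \<Rightarrow> real"
    and W :: "('a \<Rightarrow> complex) set" and NW :: "('a \<Rightarrow> complex) \<Rightarrow> real"
    and B :: "('a \<Rightarrow> complex) \<Rightarrow> ('a \<Rightarrow> complex) \<Rightarrow> complex" +
  fixes K :: "'a \<Rightarrow> 'a \<Rightarrow> complex"
  assumes K_right: "(\<lambda>x. K x y) \<in> W" and reproducing: "f \<in> V \<Longrightarrow> f y = B f (\<lambda>x. K x y)"
    and K_left: "(\<lambda>y. cnj (K x y)) \<in> V" and reproducing_dual: "g \<in> W \<Longrightarrow> cnj (g x) = B (\<lambda>y. cnj (K x y)) g"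
  fixes \<Omega> :: "'a set"
begin

text \<open>These five are \<open>BOm\<close>, \<open>BOm_norm\<close>, \<open>N0\<close>,
  \<open>N0perp\<close> and \<open>POm\<close> for an abstract pair of spaces; in the final theorem
  they are matched by unfolding.\<close>

definition "quot = restr \<Omega> ` V"
definition "quot_norm h = Inf {N f |f. f \<in> V \<and> restr \<Omega> f = h}"
definition "null = {f \<in> V. restr \<Omega> f = (\<lambda>x. 0)}"
definition "annih = {g \<in> W. \<forall>f\<in>null. B f g = 0}"
definition "quot_pair h g = B (SOME f. f \<in> V \<and> restr \<Omega> f = h) g"

lemma restr_add: "restr \<Omega> (\<lambda>x. f x + g x) = (\<lambda>x. restr \<Omega> f x + restr \<Omega> g x)"
  and restr_scale: "restr \<Omega> (\<lambda>x. c * f x) = (\<lambda>x. c * restr \<Omega> f x)"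
  and restr_diff: "restr \<Omega> (\<lambda>x. f x - g x) = (\<lambda>x. restr \<Omega> f x - restr \<Omega> g x)"
  and restr_zero: "restr \<Omega> (\<lambda>x. 0) = (\<lambda>x. 0)"
  by (auto simp: restr_def)

text \<open>Point evaluations are continuous because they are pairings with kernel sections.
  Convergence in norm therefore implies pointwise convergence, and restrictions to
  \<open>\<Omega>\<close> survive limits.\<close>

lemma point_bound: "f \<in> V \<Longrightarrow> cmod (f y) \<le> N f * NW (\<lambda>x. K x y)"
  using B_bound[OF _ K_right[of y]] reproducing[of f y] by simp

lemma point_lim:
  assumes "\<And>n::nat. s n \<in> V" "f \<in> V" "(\<lambda>n. N (\<lambda>x. s n x - f x)) \<longlonglongrightarrow> 0"
  shows "(\<lambda>n. s n y) \<longlonglongrightarrow> f y"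
proof (rule LIM_zero_cancel, rule Lim_null_comparison)
  show "(\<lambda>n. N (\<lambda>x. s n x - f x) * NW (\<lambda>x. K x y)) \<longlonglongrightarrow> 0"
    using tendsto_mult_right[OF assms(3), of "NW (\<lambda>x. K x y)"] by simp
qed (use point_bound[OF diff_mem[OF assms(1,2)]] in \<open>auto intro: always_eventually\<close>)

lemma restr_lim:
  assumes "\<And>n::nat. s n \<in> V" "f \<in> V" "(\<lambda>n. N (\<lambda>x. s n x - f x)) \<longlonglongrightarrow> 0" and eq: "\<And>n. restr \<Omega> (s n) = h"
  shows "restr \<Omega> f = h"
proof
  fix y
  have "(\<lambda>n. restr \<Omega> (s n) y) \<longlonglongrightarrow> restr \<Omega> f y"
    using point_lim[OF assms(1-3), of y] by (simp add: restr_def)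
  then show "restr \<Omega> f y = h y" unfolding eq using LIMSEQ_unique tendsto_const by blast
qed

lemma quot_norm_le: "f \<in> V \<Longrightarrow> quot_norm (restr \<Omega> f) \<le> N f"
  unfolding quot_norm_def by (rule cInf_lower) (auto intro!: bdd_belowI[of _ 0] N_nonneg)

text \<open>By \<open>restr_lim\<close> the extensions of \<open>h\<close> form a closed set, convex
  as well, so \<open>min_norm_exists\<close> turns the infimum in \<open>quot_norm\<close> into a
  minimum. Most facts about the quotient norm are read off from such an extension.\<close>

lemma minimal_extension:
  assumes "h \<in> quot"
  obtains f where "f \<in> V" "restr \<Omega> f = h" "N f = quot_norm h"
proof -
  define C where "C = {f \<in> V. restr \<Omega> f = h}"
  have "\<exists>f\<in>C. \<forall>g\<in>C. N f \<le> N g"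
  proof (rule min_norm_exists)
    show "C \<noteq> {}" using assms unfolding quot_def C_def by auto
    show "(\<lambda>x. (f x + g x) / 2) \<in> C" if "f \<in> C" "g \<in> C" for f g
      using that lincomb_mem[of f g "1/2" "1/2"] unfolding C_def
      by (auto simp: add_divide_distrib restr_def fun_eq_iff split: if_splits)
    show "f \<in> C" if "\<And>n::nat. s n \<in> C" "f \<in> V" "(\<lambda>n. N (\<lambda>x. s n x - f x)) \<longlonglongrightarrow> 0" for s f
      using restr_lim[of s f h] that unfolding C_def by auto
  qed (auto simp: C_def)
  then obtain f where f: "f \<in> C" "\<And>g. g \<in> C \<Longrightarrow> N f \<le> N g" by blast
  have "quot_norm h = N f"
    unfolding quot_norm_def by (rule cInf_eq_minimum) (use f in \<open>auto simp: C_def\<close>)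
  then show ?thesis using that f(1) unfolding C_def by auto
qed

lemma normed_quot: "normed_fspace quot quot_norm"
proof -
  have 1: "(\<lambda>x. 0) \<in> quot" unfolding quot_def using zero_mem restr_zero by (metis imageI)
  have 2: "(\<lambda>x. f x + g x) \<in> quot" if "f \<in> quot" "g \<in> quot" for f g
    using that restr_add add_mem unfolding quot_def by (auto simp: restr_add[symmetric])
  have 3: "(\<lambda>x. c * f x) \<in> quot" if "f \<in> quot" for f c
    using that restr_scale scale_mem unfolding quot_def by (auto simp: restr_scale[symmetric])
  have 4: "quot_norm f \<ge> 0" if "f \<in> quot" for f
    using minimal_extension[OF that] N_nonneg by metis
  have 5: "quot_norm (\<lambda>x. 0) = 0"
    using quot_norm_le[OF zero_mem] 4[OF 1] by (simp add: restr_zero N_zero)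
  have 6: "f = (\<lambda>x. 0)" if "f \<in> quot" "quot_norm f = 0" for f
    using minimal_extension[OF that(1)] N_eq_0 restr_zero that(2) by metis
  have le: "quot_norm (\<lambda>x. c * f x) \<le> cmod c * quot_norm f" if f: "f \<in> quot" for f c
  proof -
    obtain g where "g \<in> V" "restr \<Omega> g = f" "N g = quot_norm f" using minimal_extension[OF f] by blast
    then show ?thesis using quot_norm_le[OF scale_mem, of g c] by (simp add: restr_scale N_scale)
  qed
  have 7: "quot_norm (\<lambda>x. c * f x) = cmod c * quot_norm f" if f: "f \<in> quot" for f c
  proof (cases "c = 0")
    case True then show ?thesis using 5 by simp
  next
    case False
    \<comment> \<open>The reverse inequality is the inequality \<open>le\<close> for the factor
      \<open>inverse c\<close>.\<close>
    have "quot_norm f \<le> cmod (inverse c) * quot_norm (\<lambda>x. c * f x)"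
      using le[OF 3[OF f, of c], of "inverse c"] False by (simp add: mult.assoc[symmetric])
    then have "cmod c * quot_norm f \<le> quot_norm (\<lambda>x. c * f x)"
      using False by (simp add: norm_divide field_simps)
    then show ?thesis using le[OF f, of c] by simp
  qed
  have 8: "quot_norm (\<lambda>x. f x + g x) \<le> quot_norm f + quot_norm g" if fg: "f \<in> quot" "g \<in> quot" for f g
  proof -
    obtain f' where f': "f' \<in> V" "restr \<Omega> f' = f" "N f' = quot_norm f" using minimal_extension[OF fg(1)] by blast
    obtain g' where g': "g' \<in> V" "restr \<Omega> g' = g" "N g' = quot_norm g" using minimal_extension[OF fg(2)] by blast
    show ?thesis using quot_norm_le[OF add_mem[OF f'(1) g'(1)]] N_triangle[OF f'(1) g'(1)] f' g'
      by (simp add: restr_add)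
  qed
  show ?thesis unfolding normed_fspace_def by (intro conjI ballI allI 1 2 3 4 7 8) (use 5 6 in auto)
qed

sublocale quot: normed_fspace_loc quot quot_norm
  using normed_quot by unfold_locales

text \<open>Extending the terms one by one would lose control of their differences. Instead the
  increments are extended with least norm, at most \<open>(1/2) ^ n\<close>, and summed to a
  sequence \<open>F\<close> in \<open>V\<close> that restricts to \<open>s\<close>.\<close>

lemma banach_quot: "banach_fspace quot quot_norm"
proof (rule quot.banachI_fast)
  fix s :: "nat \<Rightarrow> 'a \<Rightarrow> complex"
  assume s: "\<And>n. s n \<in> quot" and fast: "\<And>n. quot_norm (\<lambda>x. s (Suc n) x - s n x) \<le> (1/2) ^ n"
  obtain f0 where f0: "f0 \<in> V" "restr \<Omega> f0 = s 0" using minimal_extension[OF s] by metis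
  have "\<exists>d. d \<in> V \<and> restr \<Omega> d = (\<lambda>x. s (Suc n) x - s n x) \<and> N d \<le> (1/2)^n" for n
    using minimal_extension[OF quot.diff_mem[OF s s], of "Suc n" n] fast[of n] by metis
  then obtain d where d: "\<And>n. d n \<in> V" "\<And>n. restr \<Omega> (d n) = (\<lambda>x. s (Suc n) x - s n x)" "\<And>n. N (d n) \<le> (1/2)^n"
    by metis
  define F where "F n = (\<lambda>x. f0 x + (\<Sum>j<n. d j x))" for n
  have F: "F n \<in> V" for n unfolding F_def by (intro add_mem f0 sum_mem d)
  have "restr \<Omega> (F n) = s n" for n
  proof (induction n)
    case 0 then show ?case by (simp add: F_def f0)
  next
    case (Suc n)
    have "F (Suc n) = (\<lambda>x. F n x + d n x)" by (simp add: F_def add.assoc)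
    then show ?case using Suc d(2) by (simp add: restr_add)
  qed
  moreover have fastF: "N (\<lambda>x. F (Suc n) x - F n x) \<le> (1/2)^n" for n
    using d(3)[of n] by (simp add: F_def)
  obtain f where f: "f \<in> V" "(\<lambda>n. N (\<lambda>x. F n x - f x)) \<longlonglongrightarrow> 0"
    using convergent[OF F fast_Cauchy[OF F fastF]] by blast
  ultimately have le: "quot_norm (\<lambda>x. s n x - restr \<Omega> f x) \<le> N (\<lambda>x. F n x - f x)" for n
    using quot_norm_le[OF diff_mem[OF F f(1)], of n] by (simp add: restr_diff)
  have fq: "restr \<Omega> f \<in> quot" using f(1) by (simp add: quot_def)
  have "(\<lambda>n. quot_norm (\<lambda>x. s n x - restr \<Omega> f x)) \<longlonglongrightarrow> 0"
    by (rule Lim_null_comparison[OF _ f(2)])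
       (use le quot.N_nonneg[OF quot.diff_mem[OF s fq]] in \<open>auto intro: always_eventually\<close>)
  then show "\<exists>f\<in>quot. (\<lambda>n. quot_norm (\<lambda>x. s n x - f x)) \<longlonglongrightarrow> 0" using fq by blast
qed

text \<open>The modulus \<open>\<delta>\<close> of \<open>V\<close> serves unchanged: least-norm
  extensions of unit vectors are unit vectors, restriction does not increase norms, so their
  difference is at least as large as in the quotient and their midpoint bounds the quotient
  midpoint.\<close>

lemma uc_quot: "uniformly_convex_fspace quot quot_norm"
  unfolding uniformly_convex_fspace_def
proof (intro allI impI)
  fix e :: real assume "e > 0"
  then obtain \<delta> where \<delta>: "\<delta> > 0" "\<And>f g. f \<in> V \<Longrightarrow> g \<in> V \<Longrightarrow> N f = 1 \<Longrightarrow> N g = 1 \<Longrightarrow> N (\<lambda>x. f x - g x) \<ge> e \<Longrightarrow>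
      N (\<lambda>x. (f x + g x) / 2) \<le> 1 - \<delta>"
    using uc unfolding uniformly_convex_fspace_def by metis
  have "quot_norm (\<lambda>x. (f x + g x) / 2) \<le> 1 - \<delta>"
    if fg: "f \<in> quot" "g \<in> quot" "quot_norm f = 1" "quot_norm g = 1" "quot_norm (\<lambda>x. f x - g x) \<ge> e" for f g
  proof -
    obtain f' where f': "f' \<in> V" "restr \<Omega> f' = f" "N f' = 1" using minimal_extension[OF fg(1)] fg by metis
    obtain g' where g': "g' \<in> V" "restr \<Omega> g' = g" "N g' = 1" using minimal_extension[OF fg(2)] fg by metis
    have "e \<le> N (\<lambda>x. f' x - g' x)"
      using quot_norm_le[OF diff_mem[OF f'(1) g'(1)]] fg f' g' by (simp add: restr_diff)
    then have "N (\<lambda>x. (f' x + g' x) / 2) \<le> 1 - \<delta>" using \<delta>(2) f' g' by blast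
    moreover have "(\<lambda>x. (f' x + g' x) / 2) \<in> V"
      using lincomb_mem[OF f'(1) g'(1), of "1/2" "1/2"] by (simp add: add_divide_distrib)
    moreover have "restr \<Omega> (\<lambda>x. (f' x + g' x) / 2) = (\<lambda>x. (f x + g x) / 2)"
      unfolding f'(2)[symmetric] g'(2)[symmetric] by (auto simp: restr_def)
    ultimately show ?thesis using quot_norm_le by fastforce
  qed
  then show "\<exists>\<delta>>0. \<forall>f\<in>quot. \<forall>g\<in>quot. quot_norm f = 1 \<and> quot_norm g = 1 \<and> e \<le> quot_norm (\<lambda>x. f x - g x) \<longrightarrow>
      quot_norm (\<lambda>x. (f x + g x) / 2) \<le> 1 - \<delta>" using \<delta>(1) by blast
qed

text \<open>Two extensions differ by an element of \<open>null\<close>, which \<open>g\<close>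
  annihilates. This is what makes the choice of extension in \<open>quot_pair\<close>
  harmless.\<close>

lemma annih_pair_eq:
  assumes "g \<in> annih" "f \<in> V" "f' \<in> V" "restr \<Omega> f = restr \<Omega> f'"
  shows "B f g = B f' g"
proof -
  have "(\<lambda>x. f x - f' x) \<in> null"
    using assms diff_mem[of f f'] by (simp add: null_def restr_diff)
  then show ?thesis using assms B_diff[of f f' g] by (auto simp: annih_def)
qed

lemma quot_pair_eq:
  assumes "g \<in> annih" "f \<in> V"
  shows "quot_pair (restr \<Omega> f) g = B f g"
proof -
  have "(SOME f'. f' \<in> V \<and> restr \<Omega> f' = restr \<Omega> f) \<in> V \<and> restr \<Omega> (SOME f'. f' \<in> V \<and> restr \<Omega> f' = restr \<Omega> f) = restr \<Omega> f"
    by (rule someI[of _ f]) (use assms in auto)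
  then show ?thesis unfolding quot_pair_def using annih_pair_eq[OF assms(1) _ assms(2)] by blast
qed

lemma annih_sub: "annih \<subseteq> W" by (auto simp: annih_def)

lemma quot_pair_bound:
  assumes "h \<in> quot" "g \<in> annih"
  shows "cmod (quot_pair h g) \<le> quot_norm h * NW g"
proof -
  obtain f where f: "f \<in> V" "restr \<Omega> f = h" "N f = quot_norm h" using minimal_extension[OF assms(1)] by metis
  then show ?thesis using quot_pair_eq[OF assms(2) f(1)] B_bound[OF f(1)] annih_sub assms(2) by auto
qed

lemma quot_pair_add:
  assumes "h \<in> quot" "h' \<in> quot" "g \<in> annih"
  shows "quot_pair (\<lambda>x. h x + h' x) g = quot_pair h g + quot_pair h' g"
proof -
  obtain f f' where f: "f \<in> V" "h = restr \<Omega> f" "f' \<in> V" "h' = restr \<Omega> f'" using assms by (auto simp: quot_def)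
  have "g \<in> W" using assms(3) annih_sub by auto
  then show ?thesis
    unfolding f restr_add[symmetric] using quot_pair_eq[OF assms(3)] f B_add[OF f(1,3)] add_mem[OF f(1,3)] by simp
qed

lemma quot_pair_scale:
  assumes "h \<in> quot" "g \<in> annih"
  shows "quot_pair (\<lambda>x. c * h x) g = c * quot_pair h g"
proof -
  obtain f where f: "f \<in> V" "h = restr \<Omega> f" using assms by (auto simp: quot_def)
  have "g \<in> W" using assms(2) annih_sub by auto
  then show ?thesis
    unfolding f restr_scale[symmetric] using quot_pair_eq[OF assms(2)] f B_scale[OF f(1)] scale_mem[OF f(1)] by simp
qed

lemma bounded_quot_pair: "g \<in> annih \<Longrightarrow> bounded_linear_functional quot quot_norm (\<lambda>h. quot_pair h g)"
  unfolding bounded_linear_functional_def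
  using quot_pair_add quot_pair_scale quot_pair_bound by (auto simp: mult.commute intro!: exI[of _ "NW g"])

lemma smooth_quot: "smooth_fspace quot quot_norm"
  unfolding smooth_fspace_def
proof (intro ballI impI)
  fix h k assume h: "h \<in> quot" "h \<noteq> (\<lambda>x. 0)" and k: "k \<in> quot"
  obtain f where f: "f \<in> V" "restr \<Omega> f = h" "N f = quot_norm h" using minimal_extension[OF h(1)] by metis
  obtain k' where k': "k' \<in> V" "restr \<Omega> k' = k" using k by (auto simp: quot_def)
  have f0: "f \<noteq> (\<lambda>x. 0)" using f h(2) restr_zero by auto
  have min: "N f \<le> N (\<lambda>x. f x + u x)" if "u \<in> null" for u
    using that quot_norm_le[OF add_mem[OF f(1)], of u] f by (simp add: null_def restr_add)
  have "\<exists>g\<in>W. NW g \<le> 1 \<and> B f g = complex_of_real (N f) \<and> (\<forall>k\<in>null. B k g = 0) \<and>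
      (\<forall>k\<in>V. ((\<lambda>t::real. (N (\<lambda>x. f x + complex_of_real t * k x) - N f) / t) \<longlongrightarrow> Re (B k g)) (at 0))"
    by (intro minimal_imp_annihilating f f0 min) (auto simp: null_def restr_scale scale_mem)
  then obtain g where g: "g \<in> annih" "g \<in> W" "NW g \<le> 1" "B f g = complex_of_real (N f)"
    and lim: "((\<lambda>t::real. (N (\<lambda>x. f x + complex_of_real t * k' x) - N f) / t) \<longlongrightarrow> Re (B k' g)) (at 0)"
    using k'(1) by (auto simp: annih_def)
  define U where "U t = (\<lambda>x. f x + complex_of_real t * k' x)" for t
  define Q where "Q t = quot_norm (\<lambda>x. h x + complex_of_real t * k x)" for t
  have U: "U t \<in> V" "restr \<Omega> (U t) = (\<lambda>x. h x + complex_of_real t * k x)" for t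
    unfolding U_def using f k' add_mem scale_mem by (auto simp: restr_add restr_scale)
  have up: "Q t \<le> N (U t)" for t using quot_norm_le[OF U(1)] U(2) by (simp add: Q_def)
  \<comment> \<open>\<open>g\<close> annihilates \<open>null\<close>, hence acts on the quotient,
    with norm at most 1. The real part of its value at \<open>U t\<close> is affine in
    \<open>t\<close> and bounds the quotient norm from below.\<close>
  have low: "N f + t * Re (B k' g) \<le> Q t" for t
  proof -
    have "B (U t) g = complex_of_real (N f) + complex_of_real t * B k' g"
      unfolding U_def using B_add[OF f(1) scale_mem[OF k'(1)] g(2)] B_scale[OF k'(1) g(2)] g(4) by simp
    then have "N f + t * Re (B k' g) \<le> cmod (B (U t) g)"
      using complex_Re_le_cmod[of "B (U t) g"] by simp
    also have "\<dots> = cmod (quot_pair (restr \<Omega> (U t)) g)" using quot_pair_eq[OF g(1) U(1)] by simp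
    also have "\<dots> \<le> Q t * NW g"
      unfolding Q_def U(2)[symmetric] using U(1) g(1) by (intro quot_pair_bound) (auto simp: quot_def)
    also have "\<dots> \<le> Q t" using g(3) quot.N_nonneg[of "restr \<Omega> (U t)"] U(1) W.N_nonneg[OF g(2)]
      unfolding Q_def U(2)[symmetric] by (simp add: quot_def mult_left_le)
    finally show ?thesis .
  qed
  have "((\<lambda>t. (Q t - quot_norm h) / t) \<longlongrightarrow> Re (B k' g)) (at 0)"
  proof (rule tendsto_sandwich)
    \<comment> \<open>Division by a negative \<open>t\<close> reverses both bounds; minimum and
      maximum give one sandwich for either sign.\<close>
    define m M where "m = (\<lambda>t. min (Re (B k' g)) ((N (U t) - N f) / t))" and "M = (\<lambda>t. max (Re (B k' g)) ((N (U t) - N f) / t))"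
    show "(m \<longlongrightarrow> Re (B k' g)) (at 0)" "(M \<longlongrightarrow> Re (B k' g)) (at 0)"
      unfolding m_def M_def U_def using tendsto_min[OF tendsto_const[of "Re (B k' g)"] lim] tendsto_max[OF tendsto_const[of "Re (B k' g)"] lim] by simp_all
    have "m t \<le> (Q t - quot_norm h) / t \<and> (Q t - quot_norm h) / t \<le> M t" if "t \<noteq> 0" for t
    proof (cases "t > 0")
      case True
      then have "Re (B k' g) \<le> (Q t - quot_norm h) / t" "(Q t - quot_norm h) / t \<le> (N (U t) - N f) / t"
        using low[of t] up[of t] f(3) by (auto simp: field_simps)
      then show ?thesis unfolding m_def M_def by auto
    next
      case False
      then have "t < 0" using that by simp
      then have "(Q t - quot_norm h) / t \<le> Re (B k' g)" "(N (U t) - N f) / t \<le> (Q t - quot_norm h) / t"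
        using low[of t] up[of t] f(3) by (auto simp: field_simps)
      then show ?thesis unfolding m_def M_def by auto
    qed
    then show "\<forall>\<^sub>F t in at 0. m t \<le> (Q t - quot_norm h) / t" "\<forall>\<^sub>F t in at 0. (Q t - quot_norm h) / t \<le> M t"
      by (auto simp: eventually_at_filter)
  qed
  then show "\<exists>L. ((\<lambda>t. (quot_norm (\<lambda>x. h x + complex_of_real t * k x) - quot_norm h) / t) \<longlongrightarrow> L) (at 0)"
    unfolding Q_def by blast
qed

lemma closed_annih: "closed_in_fspace W NW annih"
  unfolding closed_in_fspace_def
proof (intro conjI annih_sub allI impI, elim conjE)
  fix s g assume "\<forall>n. s n \<in> annih" and g: "g \<in> W" and lim: "(\<lambda>n. NW (\<lambda>x. s n x - g x)) \<longlonglongrightarrow> 0"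
  then have s: "s n \<in> annih" "s n \<in> W" for n using annih_sub by auto
  have "B f g = 0" if f: "f \<in> null" for f
  proof -
    have fV: "f \<in> V" using f by (simp add: null_def)
    have "(\<lambda>n. N f * NW (\<lambda>x. s n x - g x)) \<longlonglongrightarrow> 0" using tendsto_mult_left[OF lim, of "N f"] by simp
    moreover have "cmod (B f g) \<le> N f * NW (\<lambda>x. s n x - g x)" for n
      using s(1)[of n] f B_bound[OF fV W.diff_mem[OF s(2) g], of n] B_diff_right[OF fV s(2) g, of n] by (simp add: annih_def)
    ultimately have "cmod (B f g) \<le> 0" by (intro LIMSEQ_le_const) auto
    then show ?thesis by simp
  qed
  then show "g \<in> annih" using g by (simp add: annih_def)
qed

lemma annih_antilinear:
  "f \<in> annih \<Longrightarrow> g \<in> annih \<Longrightarrow> (\<lambda>x. c * f x + g x) \<in> annih"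
  using B_antilinear[of _ f g c] W.lincomb_mem[of f g c 1] by (auto simp: annih_def null_def)

lemma banach_annih: "banach_fspace annih NW"
proof -
  have z: "(\<lambda>x. 0) \<in> annih" 
    using W.zero_mem B_scale_right[OF _ W.zero_mem, of _ 0] by (auto simp: annih_def null_def)
  have a: "(\<lambda>x. f x + g x) \<in> annih" if "f \<in> annih" "g \<in> annih" for f g using annih_antilinear[OF that, of 1] by simp
  have c: "(\<lambda>x. c * f x) \<in> annih" if "f \<in> annih" for f c using annih_antilinear[OF that z, of c] by simp
  have "normed_fspace annih NW"
    unfolding normed_fspace_def using z a c annih_sub W.N_nonneg W.N_eq_0 W.N_scale W.N_triangle by (auto simp: subset_eq)
  moreover have "\<exists>f\<in>annih. (\<lambda>n. NW (\<lambda>x. s n x - f x)) \<longlonglongrightarrow> 0"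
    if s: "\<forall>n. s n \<in> annih" "\<forall>e>0. \<exists>M. \<forall>m\<ge>M. \<forall>n\<ge>M. NW (\<lambda>x. s m x - s n x) < e" for s
  proof -
    obtain f where f: "f \<in> W" "(\<lambda>n. NW (\<lambda>x. s n x - f x)) \<longlonglongrightarrow> 0"
      using banach_W s annih_sub unfolding banach_fspace_def by blast
    then show ?thesis using closed_annih s(1) unfolding closed_in_fspace_def by blast
  qed
  ultimately show ?thesis unfolding banach_fspace_def by blast
qed

text \<open>The element of \<open>V\<close> that norms \<open>g\<close> restricts to a quotient
  element of norm at most 1 with the same pairing, so the supremum is attained.\<close>

lemma dual_norm_quot:
  assumes g: "g \<in> annih"
  shows "dual_norm quot quot_norm (\<lambda>h. quot_pair h g) = NW g"
  unfolding dual_norm_def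
proof (rule cSup_eq_maximum)
  have gW: "g \<in> W" using g annih_sub by auto
  obtain f where f: "f \<in> V" "N f \<le> 1" "B f g = complex_of_real (NW g)" using norming[OF gW] by blast
  then have "NW g = cmod (quot_pair (restr \<Omega> f) g) \<and> restr \<Omega> f \<in> quot \<and> quot_norm (restr \<Omega> f) \<le> 1"
    using quot_pair_eq[OF g f(1)] W.N_nonneg[OF gW] quot_norm_le[OF f(1)] by (auto simp: quot_def)
  then show "NW g \<in> {cmod (quot_pair f g) |f. f \<in> quot \<and> quot_norm f \<le> 1}" by blast
  fix y assume "y \<in> {cmod (quot_pair f g) |f. f \<in> quot \<and> quot_norm f \<le> 1}"
  then obtain h where h: "h \<in> quot" "quot_norm h \<le> 1" "y = cmod (quot_pair h g)" by blast
  then show "y \<le> NW g" using quot_pair_bound[OF h(1) g] mult_right_mono[OF h(2) W.N_nonneg[OF gW]] by simp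
qed

text \<open>Composition with the restriction is a bounded functional on \<open>V\<close>. It
  vanishes on \<open>null\<close>, so the element of \<open>W\<close> that represents it lies in
  \<open>annih\<close>.\<close>

lemma quot_representation:
  assumes \<phi>: "bounded_linear_functional quot quot_norm \<phi>"
  shows "\<exists>g\<in>annih. \<forall>h\<in>quot. \<phi> h = quot_pair h g"
proof -
  have add: "\<And>f g. f \<in> quot \<Longrightarrow> g \<in> quot \<Longrightarrow> \<phi> (\<lambda>x. f x + g x) = \<phi> f + \<phi> g"
    and scale: "\<And>c f. f \<in> quot \<Longrightarrow> \<phi> (\<lambda>x. c * f x) = c * \<phi> f"
    using \<phi> unfolding bounded_linear_functional_def by blast+
  obtain C where C: "\<And>f. f \<in> quot \<Longrightarrow> cmod (\<phi> f) \<le> C * quot_norm f"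
    using \<phi> unfolding bounded_linear_functional_def by blast
  have q: "restr \<Omega> f \<in> quot" if "f \<in> V" for f using that by (simp add: quot_def)
  have "cmod (\<phi> (restr \<Omega> f)) \<le> max C 0 * N f" if f: "f \<in> V" for f
  proof -
    have "cmod (\<phi> (restr \<Omega> f)) \<le> C * quot_norm (restr \<Omega> f)" using C q f by blast
    also have "\<dots> \<le> max C 0 * quot_norm (restr \<Omega> f)" using quot.N_nonneg[OF q[OF f]] by (simp add: mult_right_mono)
    also have "\<dots> \<le> max C 0 * N f" using quot_norm_le[OF f] by (simp add: mult_left_mono)
    finally show ?thesis .
  qed
  then have "bounded_linear_functional V N (\<lambda>f. \<phi> (restr \<Omega> f))"
    unfolding bounded_linear_functional_def using add scale q by (auto simp: restr_add restr_scale)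
  then obtain g where g: "g \<in> W" "\<And>f. f \<in> V \<Longrightarrow> \<phi> (restr \<Omega> f) = B f g" using representation by blast
  have "\<phi> (\<lambda>x. 0) = 0" using scale[OF quot.zero_mem, of 0] by simp
  then have "g \<in> annih" using g by (auto simp: annih_def null_def g(2)[symmetric])
  then show ?thesis using g(2) quot_pair_eq by (intro bexI[of _ g]) (auto simp: quot_def)
qed

lemma quot_rkbs: "rkbs_two_sided quot quot_norm \<Omega> annih NW UNIV quot_pair K"
proof -
  \<comment> \<open>Pairing \<open>f\<close> with this section gives \<open>f y\<close>, which is
    zero when \<open>f\<close> vanishes on \<open>\<Omega>\<close>.\<close>
  have kr: "(\<lambda>x. K x y) \<in> annih" if "y \<in> \<Omega>" for y
    using K_right reproducing that by (auto simp: annih_def null_def restr_def fun_eq_iff)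
  have kr2: "f y = quot_pair f (\<lambda>x. K x y)" if "y \<in> \<Omega>" "f \<in> quot" for f y
  proof -
    obtain f' where "f' \<in> V" "f = restr \<Omega> f'" using \<open>f \<in> quot\<close> by (auto simp: quot_def)
    then show ?thesis using quot_pair_eq[OF kr[OF that(1)]] reproducing that(1) by (simp add: restr_def)
  qed
  have kl: "(\<lambda>y. if y \<in> \<Omega> then cnj (K x y) else 0) = restr \<Omega> (\<lambda>y. cnj (K x y))" for x
    by (simp add: restr_def)
  have kl1: "(\<lambda>y. if y \<in> \<Omega> then cnj (K x y) else 0) \<in> quot" for x
    unfolding kl using K_left by (simp add: quot_def)
  have kl2: "cnj (g x) = quot_pair (\<lambda>y. if y \<in> \<Omega> then cnj (K x y) else 0) g" if "g \<in> annih" for g x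
    unfolding kl quot_pair_eq[OF that K_left] using reproducing_dual that annih_sub by auto
  have anti: "quot_pair f (\<lambda>x. c * g1 x + g2 x) = cnj c * quot_pair f g1 + quot_pair f g2"
    if "g1 \<in> annih" "g2 \<in> annih" "f \<in> quot" for c g1 g2 f
  proof -
    obtain f' where "f' \<in> V" "f = restr \<Omega> f'" using \<open>f \<in> quot\<close> by (auto simp: quot_def)
    then show ?thesis using quot_pair_eq annih_antilinear that B_antilinear[of f' g1 g2 c] subsetD[OF annih_sub] by simp
  qed
  have uniq: "\<exists>!g. g \<in> annih \<and> (\<forall>f\<in>quot. \<phi> f = quot_pair f g)" if bl: "bounded_linear_functional quot quot_norm \<phi>" for \<phi>
  proof -
    obtain g where g: "g \<in> annih" "\<forall>h\<in>quot. \<phi> h = quot_pair h g" using quot_representation[OF bl] by blast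
    \<comment> \<open>The values of a representative are recovered by pairing it with the conjugated
      kernel sections, so the functional determines it at every point.\<close>
    have "g' = g" if "g' \<in> annih" "\<forall>h\<in>quot. \<phi> h = quot_pair h g'" for g'
    proof
      fix x show "g' x = g x" using kl1[of x] kl2[OF g(1), of x] kl2[OF that(1), of x] g(2) that(2) by (metis complex_cnj_cnj)
    qed
    then show ?thesis using g by blast
  qed
  have K_UNIV: "(\<lambda>x. if x \<in> UNIV then K x y else 0) = (\<lambda>x. K x y)" for y by simp
  show ?thesis
    unfolding rkbs_two_sided_def K_UNIV
    by (intro conjI allI ballI impI;
        (rule banach_quot banach_annih bounded_quot_pair dual_norm_quot anti uniq kr kr2 kl1 kl2; assumption))
qed

end

section \<open>Complex $L^s$ spaces\<close>

lemma borel_measurable_cnj [measurable]: "cnj \<in> borel_measurable borel"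
  by (intro borel_measurable_continuous_onI continuous_intros)

text \<open>The mean value theorem on each half of the interval reduces the claim to
  \<open>l < l'\<close>, as the derivative \<open>s * z powr (s - 1)\<close> increases strictly.
  Only interior points are differentiated, so \<open>x = 0\<close> is allowed.\<close>

lemma powr_strict_midpoint:
  fixes x y s :: real
  assumes "1 < s" "0 \<le> x" "x < y"
  shows "((x + y) / 2) powr s < (x powr s + y powr s) / 2"
proof -
  define m where "m = (x + y) / 2"
  have m: "x < m" "m < y" using assms unfolding m_def by auto
  have D: "((\<lambda>x. x powr s) has_real_derivative s * z powr (s - 1)) (at z)" if "z > 0" for z
    using has_real_derivative_powr[OF that, of s] by simp
  have C: "continuous_on {a..b} (\<lambda>x. x powr s)" if "0 \<le> a" for a b :: real
    using that assms by (intro continuous_on_powr' continuous_intros) auto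
  obtain l z where z: "x < z" "z < m" "DERIV (\<lambda>x. x powr s) z :> l" "m powr s - x powr s = (m - x) * l"
    using MVT[OF m(1) C] D assms(2) real_differentiable_def by (smt (verit))
  obtain l' w where w: "m < w" "w < y" "DERIV (\<lambda>x. x powr s) w :> l'" "y powr s - m powr s = (y - m) * l'"
    using MVT[OF m(2) C] D assms(2) m(1) real_differentiable_def by (smt (verit))
  have "l = s * z powr (s - 1)" "l' = s * w powr (s - 1)"
    using DERIV_unique[OF z(3) D] DERIV_unique[OF w(3) D] assms z w m by auto
  moreover have "z powr (s - 1) < w powr (s - 1)" using z w assms by (intro powr_less_mono2) auto
  ultimately have "l < l'" using assms by simp
  then have "(m - x) * l < (y - m) * l'" using m mult_strict_left_mono[of l l' "m - x"] by (simp add: m_def field_simps)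
  then show ?thesis using z(4) w(4) unfolding m_def[symmetric] by simp
qed

lemma powr_convex_nonneg:
  fixes a b s t :: real
  assumes "1 < s" "0 \<le> a" "0 \<le> b" "0 \<le> t" "t \<le> 1"
  shows "(t * a + (1 - t) * b) powr s \<le> t * a powr s + (1 - t) * b powr s"
proof -
  \<comment> \<open>Covers the cases where \<open>a\<close> or \<open>b\<close> is zero and the
    combination collapses to a multiple of the other; it rests on \<open>r powr s \<le> r\<close> in
    the unit interval.\<close>
  have le: "(r * c) powr s \<le> r * c powr s" if "0 \<le> r" "r \<le> 1" "0 \<le> c" for r c
  proof -
    have "r powr s \<le> r" using powr_mono'[of 1 s r] that assms by (cases "r = 0") auto
    then show ?thesis using that by (simp add: powr_mult mult_right_mono)
  qed
  consider "a = 0" | "b = 0" | "a > 0" "b > 0" using assms by linarith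
  then show ?thesis
  proof cases
    case 1 then show ?thesis using le[of "1 - t" b] assms by simp
  next
    case 2 then show ?thesis using le[of t a] assms by simp
  next
    case 3
    then show ?thesis using convex_onD[OF powr_convex, of s "1 - t" a b] assms by simp
  qed
qed

text \<open>For equal moduli the strictness comes from the parallelogram law, where the term
  \<open>cmod (a - b)\<close> is lost; for different moduli it comes from strict convexity of
  \<open>x powr s\<close> after the triangle inequality.\<close>

lemma cmod_strict_midpoint:
  assumes "1 < s" "a \<noteq> b"
  shows "cmod ((a + b) / 2) powr s < (cmod a powr s + cmod b powr s) / 2"
proof (cases "cmod a = cmod b")
  case True
  have "(cmod (a + b))\<^sup>2 + (cmod (a - b))\<^sup>2 = 2 * (cmod a)\<^sup>2 + 2 * (cmod b)\<^sup>2"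
    unfolding cmod_power2 by (simp add: power2_eq_square algebra_simps)
  moreover have "(cmod (a - b))\<^sup>2 > 0" using assms by simp
  ultimately have "(cmod (a + b))\<^sup>2 < (2 * cmod a)\<^sup>2" using True by (simp add: power2_eq_square)
  then have "cmod (a + b) < 2 * cmod a" by (rule power2_less_imp_less) simp
  then have "cmod ((a + b) / 2) powr s < cmod a powr s"
    using assms by (intro powr_less_mono2) (auto simp: norm_divide)
  then show ?thesis using True by simp
next
  case False
  have "cmod ((a + b) / 2) powr s \<le> ((cmod a + cmod b) / 2) powr s"
    using assms norm_triangle_ineq[of a b] by (intro powr_mono2) (auto simp: norm_divide)
  also have "\<dots> < (cmod a powr s + cmod b powr s) / 2"
  proof (cases "cmod a < cmod b")
    case True then show ?thesis using powr_strict_midpoint[OF assms(1), of "cmod a" "cmod b"] by simp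
  next
    case False
    then show ?thesis using powr_strict_midpoint[OF assms(1), of "cmod b" "cmod a"] \<open>cmod a \<noteq> cmod b\<close> by (simp add: add.commute)
  qed
  finally show ?thesis .
qed

lemma cmod_midpoint:
  assumes "1 < s"
  shows "cmod ((a + b) / 2) powr s \<le> (cmod a powr s + cmod b powr s) / 2"
  using cmod_strict_midpoint[OF assms, of a b] by (cases "a = b") auto

lemma cmod_add_powr_le:
  assumes "1 < s"
  shows "cmod (a + b) powr s \<le> 2 powr s * ((cmod a powr s + cmod b powr s) / 2)"
proof -
  have "cmod (a + b) powr s = 2 powr s * cmod ((a + b) / 2) powr s"
    by (simp add: powr_mult[symmetric] norm_divide)
  then show ?thesis using cmod_midpoint[OF assms, of a b] by (simp add: mult_left_mono)
qed

text \<open>On the compact set of pairs with \<open>max \<bar>a\<bar> \<bar>b\<bar> = 1\<close> and \<open>\<bar>a - b\<bar> \<ge> \<epsilon>\<close> the gap in the strict midpoint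
  inequality has a positive minimum; homogeneity and a separate estimate for \<open>\<bar>a - b\<bar> < \<epsilon>\<close> give a
  pointwise inequality that only has to be integrated to yield uniform convexity of \<open>L\<^sup>s\<close>.\<close>
lemma uniform_midpoint:
  fixes s \<eta> :: real
  assumes s: "1 < s" and "\<eta> > 0"
  obtains \<delta> where "\<delta> > 0" "\<And>a b. cmod ((a + b) / 2) powr s + \<delta> * (cmod (a - b) powr s - \<eta> * ((cmod a powr s + cmod b powr s) / 2))
      \<le> (cmod a powr s + cmod b powr s) / 2"
proof -
  define X where "X = (\<lambda>a b. (cmod a powr s + cmod b powr s) / 2)"
  \<comment> \<open>If \<open>cmod (a - b)\<close> is below \<open>\<epsilon>\<close> times the
    larger modulus, its power is at most \<open>\<eta> / 2\<close> times the larger of the two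
    powers, and that one is at most \<open>2 * X a b\<close>.\<close>
  define \<epsilon> where "\<epsilon> = (\<eta> / 2) powr (1 / s)"
  have \<epsilon>: "\<epsilon> > 0" "\<epsilon> powr s = \<eta> / 2" using assms by (auto simp: \<epsilon>_def powr_powr)
  define S where "S = {p::complex \<times> complex. max (cmod (fst p)) (cmod (snd p)) = 1 \<and> \<epsilon> \<le> cmod (fst p - snd p)}"
  define F where "F = (\<lambda>p. X (fst p) (snd p) - cmod ((fst p + snd p) / 2) powr s)"
  have "closed S" unfolding S_def by (intro closed_Collect_conj closed_Collect_eq closed_Collect_le continuous_intros)
  moreover have "bounded S"
  proof (rule bounded_subset)
    show "S \<subseteq> cball 0 1 \<times> cball 0 1" unfolding S_def by (auto simp: max_def split: if_splits)
    show "bounded (cball 0 1 \<times> cball (0::complex) 1 :: (complex\<times>complex) set)" by (intro bounded_Times bounded_cball)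
  qed
  ultimately have S: "compact S" using compact_eq_bounded_closed by blast
  have "continuous_on S F" unfolding F_def X_def using s
    by (intro continuous_intros continuous_on_powr') (auto intro!: continuous_intros)
  then have "\<exists>\<kappa>>0. \<forall>p\<in>S. \<kappa> \<le> F p"
  \<comment> \<open>\<open>S\<close> is empty if \<open>\<epsilon> > 2\<close>; then any positive
    \<open>\<kappa>\<close> does.\<close>
  proof (cases "S = {}")
    case False
    then obtain p where p: "p \<in> S" "\<And>r. r \<in> S \<Longrightarrow> F p \<le> F r"
      using continuous_attains_inf[OF S False \<open>continuous_on S F\<close>] by blast
    then have "fst p \<noteq> snd p" using \<epsilon> by (auto simp: S_def)
    then have "F p > 0" using cmod_strict_midpoint[OF s] by (auto simp: F_def X_def)
    then show ?thesis using p by blast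
  qed (auto intro: exI[of _ 1])
  then obtain \<kappa> where \<kappa>: "\<kappa> > 0" "\<And>p. p \<in> S \<Longrightarrow> \<kappa> \<le> F p" by blast
  \<comment> \<open>\<open>cmod (a - b) powr s\<close> is at most \<open>2 powr s * X a b\<close>,
    so this factor keeps the new term below the gap \<open>\<kappa> * X a b\<close>.\<close>
  define \<delta> where "\<delta> = \<kappa> / 2 powr s"
  have \<delta>: "\<delta> > 0" "\<delta> * 2 powr s = \<kappa>" using \<kappa> by (auto simp: \<delta>_def)
  have main: "cmod ((a + b) / 2) powr s + \<delta> * (cmod (a - b) powr s - \<eta> * X a b) \<le> X a b" for a b
  proof (cases "cmod (a - b) < \<epsilon> * max (cmod a) (cmod b)")
    case True
    have "cmod (a - b) powr s \<le> (\<epsilon> * max (cmod a) (cmod b)) powr s" using True s by (intro powr_mono2) auto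
    also have "\<dots> = \<eta> / 2 * max (cmod a powr s) (cmod b powr s)"
      using \<epsilon> s by (auto simp: powr_mult max_def powr_mono2 not_le intro!: antisym) 
    also have "\<dots> \<le> \<eta> * X a b" unfolding X_def using assms by (auto simp: max_def field_simps)
    finally have "\<delta> * (cmod (a - b) powr s - \<eta> * X a b) \<le> 0" using \<delta> by (intro mult_nonneg_nonpos) auto
    then show ?thesis using cmod_midpoint[OF s, of a b] unfolding X_def by linarith
  next
    case False
    define m where "m = max (cmod a) (cmod b)"
    have "cmod ((a + b) / 2) powr s + \<kappa> * X a b \<le> X a b"
    proof (cases "m = 0")
      case True
      then have "a = 0" "b = 0" unfolding m_def by (auto simp: max_def split: if_splits)
      then show ?thesis by (simp add: X_def)
    next
      case m0: False
      then have m: "m > 0" unfolding m_def by (smt (verit) norm_ge_zero)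
      define a' b' where "a' = a / of_real m" and "b' = b / of_real m"
      have ab: "a = of_real m * a'" "b = of_real m * b'" using m by (auto simp: a'_def b'_def)
      have c: "cmod a' = cmod a / m" "cmod b' = cmod b / m" "cmod (a' - b') = cmod (a - b) / m"
        using m by (auto simp: a'_def b'_def norm_divide diff_divide_distrib[symmetric])
      have mx: "max (cmod a') (cmod b') = 1" unfolding c using m by (auto simp: m_def max_def field_simps)
      then have "(a', b') \<in> S" unfolding S_def using c(3) False m by (simp add: m_def[symmetric] pos_le_divide_eq)
      then have "\<kappa> \<le> X a' b' - cmod ((a' + b') / 2) powr s" using \<kappa>(2) by (force simp: F_def)
      moreover have "X a' b' \<le> 1"
        using mx powr_mono2[of s "cmod a'" 1] powr_mono2[of s "cmod b'" 1] s unfolding X_def by (auto simp: max_def split: if_splits)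
      then have "\<kappa> * X a' b' \<le> \<kappa>" using \<kappa> by simp
      ultimately have "cmod ((a' + b') / 2) powr s + \<kappa> * X a' b' \<le> X a' b'" by linarith
      then have "m powr s * (cmod ((a' + b') / 2) powr s + \<kappa> * X a' b') \<le> m powr s * X a' b'"
        by (intro mult_left_mono) auto
      moreover have "X a b = m powr s * X a' b'" unfolding X_def ab using m by (simp add: norm_mult powr_mult field_simps)
      moreover have "cmod ((a + b) / 2) powr s = m powr s * cmod ((a' + b') / 2) powr s"
        unfolding ab distrib_left[symmetric] using m by (simp add: norm_mult powr_mult norm_divide powr_divide)
      ultimately show ?thesis by (simp add: algebra_simps)
    qed
    moreover have "\<delta> * (cmod (a - b) powr s - \<eta> * X a b) \<le> \<kappa> * X a b"
    proof -
      have "cmod (a - b) powr s - \<eta> * X a b \<le> 2 powr s * X a b"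
      proof -
        have "0 \<le> \<eta> * X a b" using assms by (simp add: X_def)
        moreover have "cmod (a - b) powr s \<le> 2 powr s * X a b"
          using cmod_add_powr_le[OF s, of a "-b"] by (simp add: X_def)
        ultimately show ?thesis by linarith
      qed
      then show ?thesis using \<delta> mult_left_mono[of _ _ \<delta>] by (metis mult.assoc less_imp_le)
    qed
    ultimately show ?thesis by linarith
  qed
  show ?thesis by (rule that[OF \<delta>(1)]) (use main in \<open>simp add: X_def\<close>)
qed

text \<open>Members are functions rather than classes modulo null sets, so \<open>Lnorm\<close> is
  only a seminorm. The quotient is never formed: the transform \<open>T\<close> below sends a
  function of seminorm zero to the zero function.\<close>

definition Lspace :: "real \<Rightarrow> 'a measure \<Rightarrow> ('a \<Rightarrow> complex) set" where
  "Lspace s M = {u \<in> borel_measurable M. integrable M (\<lambda>x. cmod (u x) powr s)}"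

definition Lnorm :: "real \<Rightarrow> 'a measure \<Rightarrow> ('a \<Rightarrow> complex) \<Rightarrow> real" where
  "Lnorm s M u = (\<integral>x. cmod (u x) powr s \<partial>M) powr (1 / s)"

lemma Lspace_measurable [measurable_dest]: "u \<in> Lspace s M \<Longrightarrow> u \<in> borel_measurable M"
  by (simp add: Lspace_def)

lemma LspaceD: "u \<in> Lspace s M \<Longrightarrow> integrable M (\<lambda>x. cmod (u x) powr s)"
  by (simp add: Lspace_def)

lemma Lspace_bound:
  assumes "u \<in> borel_measurable M" "integrable M w" "\<And>x. cmod (u x) powr s \<le> w x"
  shows "u \<in> Lspace s M"
  unfolding Lspace_def using assms
  by (auto intro!: Bochner_Integration.integrable_bound[OF assms(2)] intro!: AE_I2 order_trans[OF assms(3) abs_ge_self])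

lemma Lspace_zero: "(\<lambda>x. 0) \<in> Lspace s M"
  by (rule Lspace_bound[of _ _ "\<lambda>x. 0"]) auto

lemma Lspace_add:
  assumes "1 < s" "u \<in> Lspace s M" "v \<in> Lspace s M"
  shows "(\<lambda>x. u x + v x) \<in> Lspace s M"
  by (rule Lspace_bound[OF _ _ cmod_add_powr_le[OF assms(1)]]) (use assms in \<open>auto simp: Lspace_def\<close>)

lemma Lspace_scale: "u \<in> Lspace s M \<Longrightarrow> (\<lambda>x. c * u x) \<in> Lspace s M"
  by (auto simp: Lspace_def norm_mult powr_mult)

lemma Lspace_diff:
  assumes "1 < s" "u \<in> Lspace s M" "v \<in> Lspace s M"
  shows "(\<lambda>x. u x - v x) \<in> Lspace s M"
  using Lspace_add[OF assms(1,2) Lspace_scale[OF assms(3), of "-1"]] by simp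

lemma Lnorm_nonneg: "0 \<le> Lnorm s M u" by (simp add: Lnorm_def)

lemma Lnorm_powr: "1 < s \<Longrightarrow> Lnorm s M u powr s = (\<integral>x. cmod (u x) powr s \<partial>M)"
  by (simp add: Lnorm_def powr_powr)

lemma Lnorm_scale: "1 < s \<Longrightarrow> Lnorm s M (\<lambda>x. c * u x) = cmod c * Lnorm s M u"
  by (simp add: Lnorm_def norm_mult powr_mult powr_powr)

lemma Lnorm_zero: "Lnorm s M (\<lambda>x. 0) = 0"
  by (simp add: Lnorm_def)

lemma Lnorm_cong_AE:
  assumes "AE x in M. u x = v x" "u \<in> borel_measurable M" "v \<in> borel_measurable M"
  shows "Lnorm s M u = Lnorm s M v"
  unfolding Lnorm_def using assms by (auto intro!: arg_cong[of _ _ "\<lambda>z. z powr _"] integral_cong_AE)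

lemma Lnorm_eq_0:
  assumes "1 < s" "u \<in> Lspace s M" "Lnorm s M u = 0"
  shows "AE x in M. u x = 0"
proof -
  have "(\<integral>x. cmod (u x) powr s \<partial>M) = 0" using Lnorm_powr[OF assms(1), of M u] assms(1,3) by simp
  then have "AE x in M. cmod (u x) powr s = 0"
    using integral_nonneg_eq_0_iff_AE[OF LspaceD[OF assms(2)]] by auto
  then show ?thesis by simp
qed

text \<open>With weights \<open>a / (a + b)\<close> and \<open>b / (a + b)\<close> the sum
  \<open>u + v\<close> is \<open>a + b\<close> times a convex combination of \<open>u / a\<close>
  and \<open>v / b\<close>, both of norm 1; convexity of \<open>x powr s\<close> is then integrated.
  If a norm is zero, that function vanishes almost everywhere.\<close>

lemma Lnorm_triangle:
  assumes s: "1 < s" and u: "u \<in> Lspace s M" and v: "v \<in> Lspace s M"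
  shows "Lnorm s M (\<lambda>x. u x + v x) \<le> Lnorm s M u + Lnorm s M v"
proof -
  define a b where "a = Lnorm s M u" and "b = Lnorm s M v"
  have [measurable]: "u \<in> borel_measurable M" "v \<in> borel_measurable M" using u v by (auto simp: Lspace_def)
  consider "a = 0" | "b = 0" | "a > 0" "b > 0" using Lnorm_nonneg[of s M u] Lnorm_nonneg[of s M v] unfolding a_def b_def by linarith
  then show ?thesis
  proof cases
    case 1
    then have "AE x in M. u x + v x = v x" using Lnorm_eq_0[OF s u] by (auto simp: a_def)
    then show ?thesis using Lnorm_cong_AE[of "\<lambda>x. u x + v x" v M s] Lnorm_nonneg[of s M u] by simp
  next
    case 2
    then have "AE x in M. u x + v x = u x" using Lnorm_eq_0[OF s v] by (auto simp: b_def)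
    then show ?thesis using Lnorm_cong_AE[of "\<lambda>x. u x + v x" u M s] Lnorm_nonneg[of s M v] by simp
  next
    case 3
    define t where "t = a / (a + b)"
    have t: "0 \<le> t" "t \<le> 1" "1 - t = b / (a + b)" using 3 by (auto simp: t_def field_simps)
    have le: "cmod (u x + v x) powr s \<le> (a + b) powr s * (t * (cmod (u x) powr s / a powr s) + (1 - t) * (cmod (v x) powr s / b powr s))" for x
    proof -
      have "cmod (u x + v x) powr s \<le> ((a + b) * (t * (cmod (u x) / a) + (1 - t) * (cmod (v x) / b))) powr s"
      proof -
        have "t * (cmod (u x) / a) + (1 - t) * (cmod (v x) / b) = (cmod (u x) + cmod (v x)) / (a + b)"
          unfolding t(3) unfolding t_def using 3 by (simp add: add_divide_distrib)
        then show ?thesis using 3 s norm_triangle_ineq[of "u x" "v x"] by (intro powr_mono2) auto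
      qed
      also have "\<dots> = (a + b) powr s * (t * (cmod (u x) / a) + (1 - t) * (cmod (v x) / b)) powr s"
        using 3 t by (subst powr_mult) auto
      also have "\<dots> \<le> (a + b) powr s * (t * (cmod (u x) / a) powr s + (1 - t) * (cmod (v x) / b) powr s)"
        using powr_convex_nonneg[OF s _ _ t(1,2), of "cmod (u x) / a" "cmod (v x) / b"] 3 by (intro mult_left_mono) auto
      finally show ?thesis using 3 by (simp add: powr_divide)
    qed
    have iu: "integrable M (\<lambda>x. cmod (u x) powr s)" and iv: "integrable M (\<lambda>x. cmod (v x) powr s)" using u v LspaceD by auto
    have "(\<integral>x. cmod (u x + v x) powr s \<partial>M) \<le> (\<integral>x. (a + b) powr s * (t * (cmod (u x) powr s / a powr s) + (1 - t) * (cmod (v x) powr s / b powr s)) \<partial>M)"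
      using iu iv LspaceD[OF Lspace_add[OF s u v]] le by (intro integral_mono) auto
    also have "\<dots> = (a + b) powr s * (t * ((\<integral>x. cmod (u x) powr s \<partial>M) / a powr s) + (1 - t) * ((\<integral>x. cmod (v x) powr s \<partial>M) / b powr s))"
      using iu iv by simp
    also have "\<dots> = (a + b) powr s" using 3 unfolding Lnorm_powr[OF s, symmetric] a_def b_def by simp
    finally have "Lnorm s M (\<lambda>x. u x + v x) \<le> ((a + b) powr s) powr (1 / s)"
      unfolding Lnorm_def using s by (intro powr_mono2) auto
    then show ?thesis using 3 s by (simp add: powr_powr a_def b_def)
  qed
qed

text \<open>Young's inequality is used twice: as it stands for integrability, and after scaling both
  factors to norm 1 for the bound, where \<open>1 / s + 1 / r = 1\<close> makes the integrated
  right-hand side the product of the norms.\<close>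

lemma Holder:
  assumes s: "1 < s" and r: "r = s / (s - 1)" and u: "u \<in> Lspace s M" and v: "v \<in> Lspace r M"
  shows "integrable M (\<lambda>x. u x * cnj (v x))" "cmod (\<integral>x. u x * cnj (v x) \<partial>M) \<le> Lnorm s M u * Lnorm r M v"
proof -
  have [measurable]: "u \<in> borel_measurable M" "v \<in> borel_measurable M" using u v by (auto simp: Lspace_def)
  have r1: "1 < r" "1 / s + 1 / r = 1" using s by (auto simp: r field_simps)
  have iu: "integrable M (\<lambda>x. cmod (u x) powr s)" and iv: "integrable M (\<lambda>x. cmod (v x) powr r)" using u v LspaceD by auto
  have Y: "cmod (u x) * cmod (v x) \<le> cmod (u x) powr s / s + cmod (v x) powr r / r" for x
    using Youngs_inequality[OF s r1] by simp
  show int: "integrable M (\<lambda>x. u x * cnj (v x))"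
  proof (rule Bochner_Integration.integrable_bound[of _ "\<lambda>x. cmod (u x) powr s / s + cmod (v x) powr r / r"])
    show "(\<lambda>x. u x * cnj (v x)) \<in> borel_measurable M" by measurable
    show "AE x in M. cmod (u x * cnj (v x)) \<le> norm (cmod (u x) powr s / s + cmod (v x) powr r / r)"
      using order_trans[OF Y abs_ge_self] by (auto simp: norm_mult)
  qed (use iu iv in auto)
  define a b where "a = Lnorm s M u" and "b = Lnorm r M v"
  consider "a = 0" | "b = 0" | "a > 0" "b > 0" using Lnorm_nonneg[of s M u] Lnorm_nonneg[of r M v] unfolding a_def b_def by linarith
  then show "cmod (\<integral>x. u x * cnj (v x) \<partial>M) \<le> Lnorm s M u * Lnorm r M v"
  proof cases
    case 1
    then have "AE x in M. u x * cnj (v x) = 0" using Lnorm_eq_0[OF s u] by (auto simp: a_def)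
    then have "(\<integral>x. u x * cnj (v x) \<partial>M) = 0" by (rule integral_eq_zero_AE)
    then show ?thesis by (simp add: Lnorm_nonneg)
  next
    case 2
    then have "AE x in M. u x * cnj (v x) = 0" using Lnorm_eq_0[OF r1(1) v] by (auto simp: b_def)
    then have "(\<integral>x. u x * cnj (v x) \<partial>M) = 0" by (rule integral_eq_zero_AE)
    then show ?thesis by (simp add: Lnorm_nonneg)
  next
    case 3
    have le: "cmod (u x * cnj (v x)) \<le> (a * b) * (cmod (u x) powr s / a powr s / s + cmod (v x) powr r / b powr r / r)" for x
    proof -
      have "(cmod (u x) / a) * (cmod (v x) / b) \<le> (cmod (u x) / a) powr s / s + (cmod (v x) / b) powr r / r"
        using Youngs_inequality[OF s r1, of "cmod (u x) / a" "cmod (v x) / b"] 3 by simp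
      then have "(a * b) * ((cmod (u x) / a) * (cmod (v x) / b)) \<le> (a * b) * ((cmod (u x) / a) powr s / s + (cmod (v x) / b) powr r / r)"
        using 3 by (intro mult_left_mono) auto
      then show ?thesis using 3 by (simp add: powr_divide norm_mult)
    qed
    have "cmod (\<integral>x. u x * cnj (v x) \<partial>M) \<le> (\<integral>x. cmod (u x * cnj (v x)) \<partial>M)" by (rule integral_norm_bound)
    also have "\<dots> \<le> (\<integral>x. (a * b) * (cmod (u x) powr s / a powr s / s + cmod (v x) powr r / b powr r / r) \<partial>M)"
      using int iu iv le by (intro integral_mono) auto
    also have "\<dots> = (a * b) * ((\<integral>x. cmod (u x) powr s \<partial>M) / a powr s / s + (\<integral>x. cmod (v x) powr r \<partial>M) / b powr r / r)"
      using iu iv by simp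
    also have "\<dots> = a * b" using 3 r1 unfolding Lnorm_powr[OF s, symmetric] Lnorm_powr[OF r1(1), symmetric] a_def b_def by simp
    finally show ?thesis by (simp add: a_def b_def)
  qed
qed

lemma Lnorm_uniformly_convex:
  assumes s: "1 < s" and "e > 0"
  shows "\<exists>\<delta>>0. \<forall>u\<in>Lspace s M. \<forall>v\<in>Lspace s M. Lnorm s M u = 1 \<and> Lnorm s M v = 1 \<and> Lnorm s M (\<lambda>x. u x - v x) \<ge> e \<longrightarrow>
    Lnorm s M (\<lambda>x. (u x + v x) / 2) \<le> 1 - \<delta>"
proof -
  \<comment> \<open>For unit vectors the mean of the two powers integrates to 1, and the power of
    the difference to at least \<open>e powr s = 2 * \<eta>\<close>. Integrating the pointwise
    inequality leaves a deficit of at least \<open>\<delta> * \<eta>\<close>.\<close>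
  define \<eta> where "\<eta> = e powr s / 2"
  have "\<eta> > 0" using assms by (simp add: \<eta>_def)
  then obtain \<delta> where \<delta>: "\<delta> > 0" "\<And>a b. cmod ((a + b) / 2) powr s + \<delta> * (cmod (a - b) powr s - \<eta> * ((cmod a powr s + cmod b powr s) / 2))
      \<le> (cmod a powr s + cmod b powr s) / 2"
    using uniform_midpoint[OF s] by blast
  \<comment> \<open>\<open>1 - \<delta> * \<eta>\<close> might be negative; the maximum keeps the
    base in the range where \<open>powr\<close> is monotone.\<close>
  define D where "D = 1 - (max 0 (1 - \<delta> * \<eta>)) powr (1 / s)"
  have "max 0 (1 - \<delta> * \<eta>) powr (1 / s) < 1 powr (1 / s)"
    using s \<delta> \<open>\<eta> > 0\<close> by (intro powr_less_mono2) auto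
  then have "D > 0" by (simp add: D_def)
  have "Lnorm s M (\<lambda>x. (u x + v x) / 2) \<le> 1 - D"
    if uv: "u \<in> Lspace s M" "v \<in> Lspace s M" and n: "Lnorm s M u = 1" "Lnorm s M v = 1" and d: "Lnorm s M (\<lambda>x. u x - v x) \<ge> e" for u v
  proof -
    have m: "(\<lambda>x. (u x + v x) / 2) \<in> Lspace s M" using Lspace_scale[OF Lspace_add[OF s uv], of "1/2"] by simp
    note i = LspaceD[OF m] LspaceD[OF Lspace_diff[OF s uv]] LspaceD[OF uv(1)] LspaceD[OF uv(2)]
    have "(\<integral>x. cmod ((u x + v x) / 2) powr s + \<delta> * (cmod (u x - v x) powr s - \<eta> * ((cmod (u x) powr s + cmod (v x) powr s) / 2)) \<partial>M)
      \<le> (\<integral>x. (cmod (u x) powr s + cmod (v x) powr s) / 2 \<partial>M)"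
      using i \<delta>(2) by (intro integral_mono) auto
    then have *: "(\<integral>x. cmod ((u x + v x) / 2) powr s \<partial>M) + \<delta> * ((\<integral>x. cmod (u x - v x) powr s \<partial>M) - \<eta>) \<le> 1"
      using i n Lnorm_powr[OF s, of M u] Lnorm_powr[OF s, of M v] by simp
    have "e powr s \<le> (\<integral>x. cmod (u x - v x) powr s \<partial>M)"
      unfolding Lnorm_powr[OF s, symmetric] using d assms by (intro powr_mono2) auto
    then have "\<delta> * \<eta> \<le> \<delta> * ((\<integral>x. cmod (u x - v x) powr s \<partial>M) - \<eta>)" using \<delta> by (simp add: \<eta>_def)
    then have "(\<integral>x. cmod ((u x + v x) / 2) powr s \<partial>M) \<le> max 0 (1 - \<delta> * \<eta>)" using * by simp
    then show ?thesis unfolding Lnorm_def D_def using s by (simp add: powr_mono2)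
  qed
  then show ?thesis using \<open>D > 0\<close> by blast
qed

text \<open>The duality map of the plane: \<open>Re (k * cnj (dual_map s z))\<close> is the
  derivative of \<open>cmod z powr s / s\<close> in direction \<open>k\<close>.\<close>

definition dual_map :: "real \<Rightarrow> complex \<Rightarrow> complex" where
  "dual_map s z = complex_of_real (cmod z powr (s - 2)) * z"

lemma cmod_dual_map: "cmod (dual_map s z) = cmod z powr (s - 1)"
  using powr_mult_base[of "cmod z" "s - 2"] by (simp add: dual_map_def norm_mult mult.commute)

lemma mult_cnj_dual_map: "z * cnj (dual_map s z) = complex_of_real (cmod z powr s)"
proof -
  have "z * cnj (dual_map s z) = complex_of_real (cmod z powr (s - 2)) * (z * cnj z)" by (simp add: dual_map_def)
  also have "\<dots> = complex_of_real (cmod z powr (s - 2) * (cmod z)\<^sup>2)" by (simp only: complex_norm_square of_real_mult)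
  finally show ?thesis by (cases "z = 0") (auto simp: powr_diff)
qed

text \<open>For \<open>s < 2\<close> the factor \<open>cmod z powr (s - 2)\<close> is unbounded near
  0, but the modulus of the product is \<open>cmod z powr (s - 1)\<close>, which tends to 0.\<close>

lemma isCont_dual_map:
  assumes "1 < s"
  shows "isCont (dual_map s) z"
proof (cases "z = 0")
  case True
  have "((\<lambda>w. cmod w powr (s - 1)) \<longlongrightarrow> 0) (at (0::complex))"
    using tendsto_powr'[of cmod 0 "at 0" "\<lambda>_. s - 1" "s - 1"] assms tendsto_norm_zero[OF tendsto_ident_at[of "0::complex" UNIV]]
    by simp
  then have "(dual_map s \<longlongrightarrow> 0) (at 0)" by (simp add: tendsto_norm_zero_iff[symmetric, of "dual_map s"] cmod_dual_map)
  then show ?thesis using True by (simp add: isCont_def dual_map_def)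
next
  case False
  have "isCont (\<lambda>w. complex_of_real (cmod w powr (s - 2)) * w) z"
    using False by (intro continuous_intros) auto
  then show ?thesis by (simp add: dual_map_def[abs_def])
qed

lemma borel_measurable_dual_map [measurable]: "dual_map s \<in> borel_measurable borel"
  unfolding dual_map_def[abs_def] by measurable

lemma dual_map_Lspace:
  assumes s: "1 < s" and r: "r = s / (s - 1)" and u: "u \<in> Lspace s M"
  shows "(\<lambda>x. dual_map s (u x)) \<in> Lspace r M" "Lnorm r M (\<lambda>x. dual_map s (u x)) = Lnorm s M u powr (s - 1)"
    "(\<integral>x. u x * cnj (dual_map s (u x)) \<partial>M) = complex_of_real (Lnorm s M u powr s)"
proof -
  have e: "cmod (dual_map s z) powr r = cmod z powr s" for z
    using s by (simp add: cmod_dual_map powr_powr r)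
  show "(\<lambda>x. dual_map s (u x)) \<in> Lspace r M"
    using u by (auto simp: Lspace_def e)
  show "Lnorm r M (\<lambda>x. dual_map s (u x)) = Lnorm s M u powr (s - 1)"
    unfolding Lnorm_def e using s by (simp add: powr_powr r)
  show "(\<integral>x. u x * cnj (dual_map s (u x)) \<partial>M) = complex_of_real (Lnorm s M u powr s)"
    using Lnorm_powr[OF s, of M u] by (simp add: mult_cnj_dual_map)
qed

text \<open>The gradient of \<open>Lnorm s M\<close> at \<open>u\<close>. The power in front matches
  the degree \<open>s - 1\<close> of \<open>dual_map\<close>, so scaling \<open>u\<close> by a
  positive factor does not change it.\<close>

definition normed_dual :: "real \<Rightarrow> 'a measure \<Rightarrow> ('a \<Rightarrow> complex) \<Rightarrow> 'a \<Rightarrow> complex" where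
  "normed_dual s M u x = complex_of_real (1 / Lnorm s M u powr (s - 1)) * dual_map s (u x)"

lemma normed_dual:
  assumes s: "1 < s" and r: "r = s / (s - 1)" and u: "u \<in> Lspace s M" and n: "Lnorm s M u > 0"
  shows "normed_dual s M u \<in> Lspace r M" "Lnorm r M (normed_dual s M u) \<le> 1"
    "(\<integral>x. u x * cnj (normed_dual s M u x) \<partial>M) = complex_of_real (Lnorm s M u)"
proof -
  have r1: "1 < r" using s by (simp add: r)
  define c where "c = complex_of_real (1 / Lnorm s M u powr (s - 1))"
  have J: "normed_dual s M u = (\<lambda>x. c * dual_map s (u x))" by (simp add: normed_dual_def c_def fun_eq_iff)
  note d = dual_map_Lspace[OF s r u]
  show "normed_dual s M u \<in> Lspace r M" unfolding J by (rule Lspace_scale[OF d(1)])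
  show "Lnorm r M (normed_dual s M u) \<le> 1" unfolding J Lnorm_scale[OF r1] d c_def using n by (simp add: norm_divide)
  have "(\<lambda>x. u x * cnj (normed_dual s M u x)) = (\<lambda>x. c * (u x * cnj (dual_map s (u x))))"
    by (simp add: J c_def mult.left_commute)
  then have "(\<integral>x. u x * cnj (normed_dual s M u x) \<partial>M) = c * (\<integral>x. u x * cnj (dual_map s (u x)) \<partial>M)" by simp
  also have "\<dots> = complex_of_real (Lnorm s M u powr s / Lnorm s M u powr (s - 1))" unfolding d c_def by simp
  also have "Lnorm s M u powr s / Lnorm s M u powr (s - 1) = Lnorm s M u" using n by (simp add: powr_diff[symmetric])
  finally show "(\<integral>x. u x * cnj (normed_dual s M u x) \<partial>M) = complex_of_real (Lnorm s M u)" .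
qed

lemma Lspace_norming:
  assumes s: "1 < s" and r: "r = s / (s - 1)" and u: "u \<in> Lspace s M"
  shows "\<exists>v\<in>Lspace r M. Lnorm r M v \<le> 1 \<and> (\<integral>x. u x * cnj (v x) \<partial>M) = complex_of_real (Lnorm s M u)"
proof (cases "Lnorm s M u = 0")
  case True
  then show ?thesis by (intro bexI[of _ "\<lambda>x. 0"]) (auto simp: Lspace_zero Lnorm_zero)
next
  case False
  then have "Lnorm s M u > 0" using Lnorm_nonneg[of s M u] by simp
  then show ?thesis using normed_dual[OF s r u] by blast
qed

lemma Lnorm_diff_ge:
  assumes "1 < s" "u \<in> Lspace s M" "v \<in> Lspace s M"
  shows "\<bar>Lnorm s M u - Lnorm s M v\<bar> \<le> Lnorm s M (\<lambda>x. u x - v x)"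
proof -
  have "Lnorm s M u \<le> Lnorm s M (\<lambda>x. u x - v x) + Lnorm s M v" 
    using Lnorm_triangle[OF assms(1) Lspace_diff[OF assms] assms(3)] by simp
  moreover have "Lnorm s M v \<le> Lnorm s M (\<lambda>x. u x - v x) + Lnorm s M u" 
    using Lnorm_triangle[OF assms(1) Lspace_diff[OF assms(1,3,2)] assms(2)] Lnorm_scale[OF assms(1), of M "-1" "\<lambda>x. u x - v x"] by simp
  ultimately show ?thesis by linarith
qed

text \<open>The difference quotient at \<open>t\<close> lies between the values at \<open>k\<close> of the normalised duality maps of \<open>u\<close>
  and \<open>u + t k\<close>, and the latter depend continuously on \<open>t\<close>.\<close>
lemma Lnorm_has_derivative:
  assumes s: "1 < s" and r: "r = s / (s - 1)" and u: "u \<in> Lspace s M" and n0: "Lnorm s M u \<noteq> 0"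
  shows "\<exists>v\<in>Lspace r M. Lnorm r M v \<le> 1 \<and> (\<integral>x. u x * cnj (v x) \<partial>M) = complex_of_real (Lnorm s M u) \<and>
    (\<forall>k\<in>Lspace s M. ((\<lambda>t::real. (Lnorm s M (\<lambda>x. u x + complex_of_real t * k x) - Lnorm s M u) / t)
        \<longlongrightarrow> Re (\<integral>x. k x * cnj (v x) \<partial>M)) (at 0))"
proof -
  define c where "c = (\<lambda>w. 1 / Lnorm s M w powr (s - 1))"
  define J where "J = normed_dual s M"
  have J_eq: "J w x = complex_of_real (c w) * dual_map s (w x)" for w x by (simp add: J_def normed_dual_def c_def)
  note J = normed_dual[OF s r, of _ M, folded J_def]
  have nu: "Lnorm s M u > 0" using n0 Lnorm_nonneg[of s M u] by simp
  have "((\<lambda>t::real. (Lnorm s M (\<lambda>x. u x + complex_of_real t * k x) - Lnorm s M u) / t)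
        \<longlongrightarrow> Re (\<integral>x. k x * cnj (J u x) \<partial>M)) (at 0)" if k: "k \<in> Lspace s M" for k
  proof -
    have [measurable]: "u \<in> borel_measurable M" "k \<in> borel_measurable M" using u k by (auto simp: Lspace_def)
    define U where "U = (\<lambda>(t::real) x. u x + complex_of_real t * k x)"
    define n where "n = (\<lambda>t. Lnorm s M (U t))"
    have U: "U t \<in> Lspace s M" for t unfolding U_def by (intro Lspace_add s u Lspace_scale k)
    have U0: "U 0 = u" by (simp add: U_def)
    have [measurable]: "U t \<in> borel_measurable M" for t using U[of t] by (simp add: Lspace_def)
    define I where "I = (\<lambda>t. \<integral>x. k x * cnj (dual_map s (U t x)) \<partial>M)"
    define R where "R = (\<lambda>t. Re (\<integral>x. k x * cnj (J (U t) x) \<partial>M))"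
    have R: "R t = c (U t) * Re (I t)" for t
    proof -
      have "(\<lambda>x. k x * cnj (J (U t) x)) = (\<lambda>x. complex_of_real (c (U t)) * (k x * cnj (dual_map s (U t x))))"
        by (simp add: J_eq mult.left_commute)
      then show ?thesis by (simp add: R_def I_def)
    qed
    have nt: "(n \<longlongrightarrow> n 0) (at 0)"
    proof (rule LIM_zero_cancel, rule Lim_null_comparison)
      show "\<forall>\<^sub>F t in at 0. norm (n t - n 0) \<le> \<bar>t\<bar> * Lnorm s M k"
      proof (rule always_eventually, rule allI)
        fix t
        have "(\<lambda>x. U t x - U 0 x) = (\<lambda>x. complex_of_real t * k x)" by (simp add: U_def)
        then show "norm (n t - n 0) \<le> \<bar>t\<bar> * Lnorm s M k"
          using Lnorm_diff_ge[OF s U U, of t 0] Lnorm_scale[OF s, of M "complex_of_real t" k] by (simp add: n_def)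
      qed
      show "((\<lambda>t. \<bar>t\<bar> * Lnorm s M k) \<longlongrightarrow> 0) (at 0)" by (auto intro!: tendsto_eq_intros)
    qed
    have It: "(I \<longlongrightarrow> I 0) (at 0)"
      unfolding tendsto_at_iff_sequentially o_def
    proof (intro allI impI)
      fix X :: "nat \<Rightarrow> real" assume X0: "X \<longlonglongrightarrow> 0"
      then obtain B where B: "\<And>i. \<bar>X i\<bar> \<le> B" using convergent_imp_bounded[OF X0] by (auto simp: bounded_iff)
      have B0: "B \<ge> 0" using B[of 0] by linarith
      \<comment> \<open>\<open>W\<close> dominates in modulus every \<open>U (X i)\<close>, because
        \<open>B\<close> bounds the sequence, and also \<open>k\<close>, because of the
        \<open>+ 1\<close>. Its power \<open>s\<close> then dominates all integrands at
        once.\<close>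
      define W where "W = (\<lambda>x. complex_of_real (cmod (u x) + (B + 1) * cmod (k x)))"
      have W: "W \<in> Lspace s M"
      proof -
        have "(\<lambda>x. complex_of_real (cmod (w x))) \<in> Lspace s M" if "w \<in> Lspace s M" for w
          using that by (auto simp: Lspace_def)
        from Lspace_add[OF s this[OF u] Lspace_scale[OF this[OF k]]] show ?thesis
          unfolding W_def of_real_add of_real_mult .
      qed
      show "(\<lambda>i. I (X i)) \<longlonglongrightarrow> I 0"
        unfolding I_def
      proof (rule integral_dominated_convergence)
        show "integrable M (\<lambda>x. cmod (W x) powr s)" using W by (rule LspaceD)
        show "AE x in M. (\<lambda>i. k x * cnj (dual_map s (U (X i) x))) \<longlonglongrightarrow> k x * cnj (dual_map s (U 0 x))"
        proof (rule AE_I2)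
          fix x
          have "(\<lambda>i. U (X i) x) \<longlonglongrightarrow> U 0 x" unfolding U_def by (intro tendsto_intros X0)
          then have "(\<lambda>i. dual_map s (U (X i) x)) \<longlonglongrightarrow> dual_map s (U 0 x)"
            by (rule isCont_tendsto_compose[OF isCont_dual_map[OF s]])
          then show "(\<lambda>i. k x * cnj (dual_map s (U (X i) x))) \<longlonglongrightarrow> k x * cnj (dual_map s (U 0 x))"
            by (intro tendsto_intros)
        qed
        fix i
        show "AE x in M. norm (k x * cnj (dual_map s (U (X i) x))) \<le> cmod (W x) powr s"
        proof (rule AE_I2)
          fix x
          have w: "cmod (W x) = cmod (u x) + (B + 1) * cmod (k x)"
            unfolding W_def norm_of_real using B0 by simp
          have "cmod (U (X i) x) \<le> cmod (u x) + \<bar>X i\<bar> * cmod (k x)"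
            unfolding U_def using norm_triangle_ineq[of "u x" "complex_of_real (X i) * k x"] by (simp add: norm_mult)
          also have "\<dots> \<le> cmod (W x)" unfolding w using B[of i] by (simp add: mult_right_mono)
          finally have 1: "cmod (U (X i) x) powr (s - 1) \<le> cmod (W x) powr (s - 1)" using s by (intro powr_mono2) auto
          have 2: "cmod (k x) \<le> cmod (W x)" unfolding w using B0 by (simp add: distrib_right add_increasing)
          have "norm (k x * cnj (dual_map s (U (X i) x))) = cmod (k x) * cmod (U (X i) x) powr (s - 1)"
            by (simp add: norm_mult cmod_dual_map)
          also have "\<dots> \<le> cmod (W x) * cmod (W x) powr (s - 1)" using 1 2 by (intro mult_mono) auto
          also have "\<dots> = cmod (W x) powr s" by (cases "W x = 0") (auto simp: powr_mult_base)
          finally show "norm (k x * cnj (dual_map s (U (X i) x))) \<le> cmod (W x) powr s" .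
        qed
      qed measurable
    qed
    have Rt: "(R \<longlongrightarrow> R 0) (at 0)"
      unfolding R c_def n_def[symmetric, unfolded fun_eq_iff, rule_format]
      using nu U0 nt by (intro tendsto_intros It) (auto simp: n_def)
    have pos: "\<forall>\<^sub>F t in at 0. n t > 0" using order_tendstoD(1)[OF nt, of 0] nu by (simp add: n_def U0)
    have add: "(\<integral>x. U t x * cnj (v x) \<partial>M) = (\<integral>x. u x * cnj (v x) \<partial>M) + t * (\<integral>x. k x * cnj (v x) \<partial>M)"
      if v: "v \<in> Lspace r M" for v t
    proof -
      have "(\<lambda>x. U t x * cnj (v x)) = (\<lambda>x. u x * cnj (v x) + complex_of_real t * (k x * cnj (v x)))"
        by (simp add: U_def algebra_simps)
      then show ?thesis using Holder(1)[OF s r u v] Holder(1)[OF s r k v] by simp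
    qed
    have bd: "Re (\<integral>x. w x * cnj (v x) \<partial>M) \<le> Lnorm s M w" if "w \<in> Lspace s M" "v \<in> Lspace r M" "Lnorm r M v \<le> 1" for w v
    proof -
      have "Re (\<integral>x. w x * cnj (v x) \<partial>M) \<le> Lnorm s M w * Lnorm r M v"
        using Holder(2)[OF s r that(1,2)] complex_Re_le_cmod order_trans by blast
      also have "\<dots> \<le> Lnorm s M w" using that(3) Lnorm_nonneg[of s M w] by (simp add: mult_left_le)
      finally show ?thesis .
    qed
    have low: "n 0 + t * R 0 \<le> n t" for t
      using bd[OF U[of t] J(1,2)[OF u nu]] add[OF J(1)[OF u nu], of t] J(3)[OF u nu] U0 by (simp add: n_def R_def)
    \<comment> \<open>Here the functional that supports the norm at \<open>U t\<close> is tested at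
      \<open>u\<close>; for \<open>low\<close> the one of \<open>u\<close> was tested at
      \<open>U t\<close>. Its properties need \<open>n t > 0\<close>, which holds for small
      \<open>t\<close>.\<close>
    have up: "n t \<le> n 0 + t * R t" if "n t > 0" for t
    proof -
      have nt: "Lnorm s M (U t) > 0" using that by (simp add: n_def)
      show ?thesis
        using bd[OF u J(1,2)[OF U nt]] add[OF J(1)[OF U nt], of t] J(3)[OF U nt] U0 by (simp add: n_def R_def complex_eq_iff)
    qed
    have "((\<lambda>t. (n t - n 0) / t) \<longlongrightarrow> R 0) (at 0)"
    proof (rule tendsto_sandwich)
      define m M where "m = (\<lambda>t. min (R 0) (R t))" and "M = (\<lambda>t. max (R 0) (R t))"
      show "(m \<longlongrightarrow> R 0) (at 0)" "(M \<longlongrightarrow> R 0) (at 0)"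
        unfolding m_def M_def using tendsto_min[OF tendsto_const[of "R 0"] Rt] tendsto_max[OF tendsto_const[of "R 0"] Rt] by simp_all
      have *: "m t \<le> (n t - n 0) / t \<and> (n t - n 0) / t \<le> M t" if "t \<noteq> 0" "n t > 0" for t
      proof (cases "t > 0")
        case True
        then have "R 0 \<le> (n t - n 0) / t" "(n t - n 0) / t \<le> R t"
          using low[of t] up[OF that(2)] by (auto simp: field_simps)
        then show ?thesis unfolding m_def M_def by auto
      next
        case False
        then have "t < 0" using that by simp
        then have "(n t - n 0) / t \<le> R 0" "R t \<le> (n t - n 0) / t"
          using low[of t] up[OF that(2)] by (auto simp: field_simps)
        then show ?thesis unfolding m_def M_def by auto
      qed
      show "\<forall>\<^sub>F t in at 0. m t \<le> (n t - n 0) / t" "\<forall>\<^sub>F t in at 0. (n t - n 0) / t \<le> M t"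
        using pos eventually_neq_at_within[of 0] by (eventually_elim; use * in blast)+
    qed
    then show ?thesis unfolding n_def R_def U0 by (simp add: U_def)
  qed
  then show ?thesis using J[OF u nu] by blast
qed

text \<open>\<open>Lnorm\<close> is only a seminorm, so \<open>fast_Cauchy\<close> does not speak of
  \<open>Lspace\<close>; \<open>Cauchy\<close> is the form in which the isometric normed space of
  transforms hands over its conclusion.\<close>

lemma Lspace_complete:
  assumes s: "1 < s" and u: "\<And>n::nat. u n \<in> Lspace s M"
    and fast: "\<And>n. Lnorm s M (\<lambda>x. u (Suc n) x - u n x) \<le> (1/2) ^ n"
    and Cauchy: "\<And>e. e > 0 \<Longrightarrow> \<exists>N. \<forall>m\<ge>N. \<forall>n\<ge>N. Lnorm s M (\<lambda>x. u m x - u n x) < e"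
  shows "\<exists>v\<in>Lspace s M. (\<lambda>n. Lnorm s M (\<lambda>x. u n x - v x)) \<longlonglongrightarrow> 0"
proof -
  have [measurable]: "u n \<in> borel_measurable M" for n using u by (simp add: Lspace_def)
  \<comment> \<open>The weights \<open>(1/q)\<^sup>n\<close> leave a convergent sum of integrals, so almost everywhere the increments
    decay geometrically and \<open>u\<^sub>n\<close> converges pointwise; Fatou's lemma then gives convergence in norm.\<close>
  define q where "q = (1/2::real) powr (s/2)"
  have q: "0 < q" "q < 1" using s powr_less_mono2_neg[of "-(s/2)" 1 "2"] unfolding q_def by (auto simp: powr_divide powr_minus field_simps)
  define w where "w = (\<lambda>n x. (1/q) ^ n * cmod (u (Suc n) x - u n x) powr s)"
  have w_int: "integrable M (w n)" for n unfolding w_def using LspaceD[OF Lspace_diff[OF s u u]] by simp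
  have w_le: "(\<integral>x. w n x \<partial>M) \<le> q ^ n" for n
  proof -
    have "(\<integral>x. cmod (u (Suc n) x - u n x) powr s \<partial>M) \<le> ((1/2) ^ n) powr s"
      unfolding Lnorm_powr[OF s, symmetric] using fast[of n] s Lnorm_nonneg by (intro powr_mono2) auto
    also have "((1/2::real) ^ n) powr s = (q * q) ^ n"
      by (simp add: q_def powr_add[symmetric] powr_realpow[symmetric] powr_powr mult.commute)
    finally have "(1/q) ^ n * (\<integral>x. cmod (u (Suc n) x - u n x) powr s \<partial>M) \<le> (1/q) ^ n * (q * q) ^ n"
      using q by (intro mult_left_mono) auto
    also have "\<dots> = q ^ n" using q by (simp add: power_mult_distrib[symmetric])
    finally show ?thesis by (simp add: w_def)
  qed
  have "AE x in M. summable (\<lambda>n. w n x)"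
  proof -
    have "(\<integral>\<^sup>+x. (\<Sum>n. ennreal (w n x)) \<partial>M) = (\<Sum>n. \<integral>\<^sup>+x. ennreal (w n x) \<partial>M)"
      using w_int by (intro nn_integral_suminf) auto
    also have "\<dots> \<le> (\<Sum>n. ennreal (q ^ n))"
      using w_int w_le q by (intro suminf_le) (auto simp: nn_integral_eq_integral w_def intro!: ennreal_leI)
    also have "\<dots> < \<infinity>" using q by (subst suminf_ennreal2) (auto intro: summable_geometric)
    finally have "AE x in M. (\<Sum>n. ennreal (w n x)) \<noteq> \<infinity>"
      using w_int by (intro nn_integral_PInf_AE) auto
    then show ?thesis by eventually_elim (auto intro!: summable_suminf_not_top simp: w_def q less_imp_le)
  qed
  then have conv: "AE x in M. (\<lambda>n. u n x) \<longlonglongrightarrow> lim (\<lambda>n. u n x)"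
  proof eventually_elim
    case (elim x)
    have "(\<lambda>n. w n x) \<longlonglongrightarrow> 0" using elim by (rule summable_LIMSEQ_zero)
    then obtain C where C: "\<And>n. \<bar>w n x\<bar> \<le> C" using convergent_imp_bounded[of "\<lambda>n. w n x" 0] by (auto simp: bounded_iff)
    have C0: "C \<ge> 0" using C[of 0] by linarith
    define \<rho> where "\<rho> = q powr (1 / s)"
    have \<rho>: "0 < \<rho>" "\<rho> < 1" using q s powr_less_mono2[of "1/s" q 1] by (auto simp: \<rho>_def)
    have le: "norm (u (Suc n) x - u n x) \<le> C powr (1 / s) * \<rho> ^ n" for n
    proof -
      have "cmod (u (Suc n) x - u n x) powr s \<le> C * q ^ n"
        using C[of n] q unfolding w_def by (simp add: power_divide abs_mult field_simps)
      then have "(cmod (u (Suc n) x - u n x) powr s) powr (1 / s) \<le> (C * q ^ n) powr (1 / s)"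
        using s by (intro powr_mono2) auto
      then show ?thesis using s C0 q unfolding \<rho>_def
        by (simp add: powr_powr powr_mult powr_realpow[symmetric] mult.commute)
    qed
    have "summable (\<lambda>n. C powr (1 / s) * \<rho> ^ n)" using \<rho> by (intro summable_mult summable_geometric) auto
    then have "summable (\<lambda>n. u (Suc n) x - u n x)" by (rule summable_comparison_test'[of _ 0]) (rule le)
    then have "convergent (\<lambda>n. \<Sum>i<n. u (Suc i) x - u i x)" by (simp add: summable_iff_convergent)
    then have "convergent (\<lambda>n. u n x - u 0 x)" unfolding sum_lessThan_telescope[of "\<lambda>n. u n x"] .
    then have "convergent (\<lambda>n. (u n x - u 0 x) + u 0 x)" by (intro convergent_add convergent_const)
    then show ?case by (simp add: convergent_LIMSEQ_iff)
  qed
  \<comment> \<open>Divergence occurs on a null set only, where the value of \<open>lim\<close> does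
    not matter; the pointwise \<open>lim\<close> is measurable as a whole.\<close>
  define v where "v = (\<lambda>x. lim (\<lambda>n. u n x))"
  have [measurable]: "v \<in> borel_measurable M" unfolding v_def by measurable
  have fatou: "(\<integral>\<^sup>+x. ennreal (cmod (u n x - v x) powr s) \<partial>M) \<le> ennreal (e powr s)"
    if e: "e > 0" and N: "\<And>m. m \<ge> N \<Longrightarrow> Lnorm s M (\<lambda>x. u n x - u m x) \<le> e" for n N e
  proof -
    have "(\<integral>\<^sup>+x. ennreal (cmod (u n x - v x) powr s) \<partial>M) \<le> (\<integral>\<^sup>+x. liminf (\<lambda>m. ennreal (cmod (u n x - u m x) powr s)) \<partial>M)"
    proof (rule nn_integral_mono_AE, use conv in eventually_elim)
      case (elim x)
      have "(\<lambda>m. ennreal (cmod (u n x - u m x) powr s)) \<longlonglongrightarrow> ennreal (cmod (u n x - v x) powr s)"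
        using elim s unfolding v_def by (intro tendsto_ennrealI tendsto_powr' tendsto_intros) auto
      from lim_imp_Liminf[OF sequentially_bot this] show ?case by simp
    qed
    also have "\<dots> \<le> liminf (\<lambda>m. \<integral>\<^sup>+x. ennreal (cmod (u n x - u m x) powr s) \<partial>M)"
      by (rule nn_integral_liminf) measurable
    also have "\<dots> \<le> ennreal (e powr s)"
    proof (rule Liminf_le)
      show "\<forall>\<^sub>F m in sequentially. (\<integral>\<^sup>+x. ennreal (cmod (u n x - u m x) powr s) \<partial>M) \<le> ennreal (e powr s)"
        unfolding eventually_sequentially
      proof (intro exI[of _ N] allI impI)
        fix m assume "N \<le> m"
        have "(\<integral>\<^sup>+x. ennreal (cmod (u n x - u m x) powr s) \<partial>M) = ennreal (Lnorm s M (\<lambda>x. u n x - u m x) powr s)"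
          unfolding Lnorm_powr[OF s] using LspaceD[OF Lspace_diff[OF s u u]] by (intro nn_integral_eq_integral) auto
        also have "\<dots> \<le> ennreal (e powr s)" using N[OF \<open>N \<le> m\<close>] s Lnorm_nonneg by (intro ennreal_leI powr_mono2) auto
        finally show "(\<integral>\<^sup>+x. ennreal (cmod (u n x - u m x) powr s) \<partial>M) \<le> ennreal (e powr s)" .
      qed
    qed simp
    finally show ?thesis .
  qed
  have mem: "(\<lambda>x. u n x - v x) \<in> Lspace s M \<and> Lnorm s M (\<lambda>x. u n x - v x) \<le> e"
    if e: "e > 0" and N: "\<And>m. m \<ge> N \<Longrightarrow> Lnorm s M (\<lambda>x. u n x - u m x) \<le> e" for n N e
  proof -
    have f: "(\<integral>\<^sup>+x. ennreal (cmod (u n x - v x) powr s) \<partial>M) \<le> ennreal (e powr s)"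
      using fatou[of e N n] e N by blast
    have int: "integrable M (\<lambda>x. cmod (u n x - v x) powr s)"
      using f by (intro integrableI_nonneg) (auto intro: le_less_trans)
    have "(\<integral>x. cmod (u n x - v x) powr s \<partial>M) \<le> e powr s"
      using f unfolding nn_integral_eq_integral[OF int AE_I2[OF powr_ge_zero]] by simp
    then have "Lnorm s M (\<lambda>x. u n x - v x) \<le> (e powr s) powr (1 / s)"
      unfolding Lnorm_def using s by (intro powr_mono2) auto
    then show ?thesis using int s e by (simp add: Lspace_def powr_powr)
  qed
  obtain N1 where N1: "\<And>m n. m \<ge> N1 \<Longrightarrow> n \<ge> N1 \<Longrightarrow> Lnorm s M (\<lambda>x. u m x - u n x) < 1" using Cauchy[of 1] by auto
  have "(\<lambda>x. u N1 x - v x) \<in> Lspace s M" using mem[of 1 N1 N1] N1[of N1] by (simp add: less_imp_le)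
  then have v: "v \<in> Lspace s M" using Lspace_diff[OF s u[of N1], of "\<lambda>x. u N1 x - v x"] by simp
  have "(\<lambda>n. Lnorm s M (\<lambda>x. u n x - v x)) \<longlonglongrightarrow> 0"
  proof (rule LIMSEQ_I)
    fix e :: real assume "e > 0"
    then obtain N where N: "\<And>m n. m \<ge> N \<Longrightarrow> n \<ge> N \<Longrightarrow> Lnorm s M (\<lambda>x. u m x - u n x) < e / 2" using Cauchy[of "e/2"] by auto
    have "Lnorm s M (\<lambda>x. u n x - v x) \<le> e / 2" if "n \<ge> N" for n
      using mem[of "e/2" N n] N[OF that] \<open>e > 0\<close> by (simp add: less_imp_le)
    then have "Lnorm s M (\<lambda>x. u n x - v x) < e" if "n \<ge> N" for n
      using that \<open>e > 0\<close> by fastforce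
    then show "\<exists>no. \<forall>n\<ge>no. norm (Lnorm s M (\<lambda>x. u n x - v x) - 0) < e"
      using Lnorm_nonneg[of s M] by auto
  qed
  then show ?thesis using v by blast
qed

section \<open>Gaussians and Fourier inversion\<close>

lemma lborel_eq_distr_PiM:
  "(lborel :: 'a::euclidean_space measure) = distr (\<Pi>\<^sub>M b\<in>Basis. (lborel :: real measure)) borel (\<lambda>f. \<Sum>b\<in>Basis. f b *\<^sub>R b)"
  by (subst lborel_def) (simp add: lborel_eq_real)

lemma
  fixes f :: "'a::euclidean_space \<Rightarrow> real \<Rightarrow> 'b::{real_normed_field,banach,second_countable_topology}"
  assumes f: "\<And>b. b \<in> Basis \<Longrightarrow> integrable lborel (f b)"
  shows lborel_integrable_prod: "integrable lborel (\<lambda>x::'a. \<Prod>b\<in>Basis. f b (x \<bullet> b))"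
    and lborel_integral_prod: "(\<integral>x. (\<Prod>b\<in>Basis. f b (x \<bullet> b)) \<partial>(lborel :: 'a measure)) = (\<Prod>b\<in>Basis. \<integral>t. f b t \<partial>lborel)"
proof -
  interpret product_sigma_finite "\<lambda>_::'a. lborel :: real measure" by standard
  have [measurable]: "b \<in> Basis \<Longrightarrow> f b \<in> borel_measurable borel" for b using f[of b] by auto
  have m: "(\<lambda>f. \<Sum>b\<in>Basis. f b *\<^sub>R b) \<in> (\<Pi>\<^sub>M b\<in>Basis. (lborel :: real measure)) \<rightarrow>\<^sub>M (borel :: 'a measure)"
    by (intro borel_measurable_sum borel_measurable_scaleR) (auto intro: measurable_component_singleton)
  have F: "(\<lambda>x::'a. \<Prod>b\<in>Basis. f b (x \<bullet> b)) \<in> borel_measurable borel" by measurable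
  have e: "(\<Prod>b\<in>Basis. f b ((\<Sum>b\<in>Basis. x b *\<^sub>R b) \<bullet> b)) = (\<Prod>b\<in>Basis. f b (x b))" for x :: "'a \<Rightarrow> real"
    by (intro prod.cong refl) (simp add: inner_sum_left inner_Basis if_distrib cong: if_cong)
  show "integrable lborel (\<lambda>x::'a. \<Prod>b\<in>Basis. f b (x \<bullet> b))"
    unfolding lborel_eq_distr_PiM[where 'a='a] integrable_distr_eq[OF m F] e
    using f by (intro product_integrable_prod) auto
  show "(\<integral>x. (\<Prod>b\<in>Basis. f b (x \<bullet> b)) \<partial>(lborel :: 'a measure)) = (\<Prod>b\<in>Basis. \<integral>t. f b t \<partial>lborel)"
    unfolding lborel_eq_distr_PiM[where 'a='a] integral_distr[OF m F] e
    using f by (intro product_integral_prod) auto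
qed

lemma lborel_integral_affine:
  fixes f :: "'a::euclidean_space \<Rightarrow> complex"
  assumes [measurable]: "f \<in> borel_measurable borel" and "c \<noteq> 0"
  shows "(\<integral>x. f x \<partial>lborel) = \<bar>c\<bar> ^ DIM('a) *\<^sub>R (\<integral>x. f (t + c *\<^sub>R x) \<partial>lborel)"
  by (subst lborel_affine[OF assms(2), of t])
     (simp add: integral_density integral_distr)

lemma lborel_integrable_affine:
  fixes f :: "'a::euclidean_space \<Rightarrow> complex"
  assumes f: "integrable lborel f" and "c \<noteq> 0"
  shows "integrable lborel (\<lambda>x. f (t + c *\<^sub>R x))"
proof -
  have [measurable]: "f \<in> borel_measurable borel" using f by auto
  have "integrable (density (distr lborel borel (\<lambda>x. t + c *\<^sub>R x)) (\<lambda>_. \<bar>c\<bar> ^ DIM('a))) f"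
    using f by (subst lborel_affine[OF assms(2), of t, symmetric])
  then have "integrable lborel (\<lambda>x. \<bar>c\<bar> ^ DIM('a) *\<^sub>R f (t + c *\<^sub>R x))"
    by (simp add: integrable_density integrable_distr_eq)
  from integrable_scaleR_right[OF this, of "inverse (\<bar>c\<bar> ^ DIM('a))"] show ?thesis using \<open>c \<noteq> 0\<close> by simp
qed

lemma cmod_exp_minus_i [simp]: "cmod (exp (- (\<i> * complex_of_real a))) = 1"
  by (simp add: norm_exp_eq_Re)

text \<open>The characteristic function of the standard normal distribution is the case
  \<open>e = 1\<close>; substituting \<open>e * s\<close> at frequency \<open>\<tau> / e\<close>
  gives the rest.\<close>

lemma gaussian_integral_1:
  fixes e \<tau> :: real
  assumes "e > 0"
  shows "integrable lborel (\<lambda>s. complex_of_real (exp (- (e\<^sup>2 * s\<^sup>2) / 2)) * exp (\<i> * complex_of_real (\<tau> * s)))"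
    "(\<integral>s. complex_of_real (exp (- (e\<^sup>2 * s\<^sup>2) / 2)) * exp (\<i> * complex_of_real (\<tau> * s)) \<partial>lborel)
      = complex_of_real (sqrt (2 * pi) / e * exp (- (\<tau>\<^sup>2 / (2 * e\<^sup>2))))"
proof -
  define F where "F = (\<lambda>t s. complex_of_real (exp (- s\<^sup>2 / 2)) * exp (\<i> * complex_of_real (t * s)))"
  have [measurable]: "F t \<in> borel_measurable borel" for t unfolding F_def by measurable
  have "integrable lborel (\<lambda>s. sqrt (2 * pi) * std_normal_density s)" by simp
  then have "integrable lborel (\<lambda>s::real. exp (- s\<^sup>2 / 2))" by (simp add: std_normal_density_def)
  then have int: "integrable lborel (F t)" for t
    by (rule Bochner_Integration.integrable_bound) (auto simp: F_def norm_mult)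
  have F: "(\<integral>s. F t s \<partial>lborel) = complex_of_real (sqrt (2 * pi) * exp (- t\<^sup>2 / 2))" for t
  proof -
    have "complex_of_real (exp (- t\<^sup>2 / 2)) = (\<integral>x. std_normal_density x *\<^sub>R exp (\<i> * complex_of_real (t * x)) \<partial>lborel)"
      using fun_cong[OF char_std_normal_distribution, of t] by (simp add: char_def integral_density)
    also have "\<dots> = (\<integral>x. complex_of_real (1 / sqrt (2 * pi)) * F t x \<partial>lborel)"
      by (simp add: F_def std_normal_density_def scaleR_conv_of_real)
    also have "\<dots> = complex_of_real (1 / sqrt (2 * pi)) * (\<integral>x. F t x \<partial>lborel)" by simp
    finally show ?thesis by (simp add: field_simps)
  qed
  have eq: "F (\<tau> / e) (0 + e * s) = complex_of_real (exp (- (e\<^sup>2 * s\<^sup>2) / 2)) * exp (\<i> * complex_of_real (\<tau> * s))" for s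
    using assms by (simp add: F_def power_mult_distrib)
  show "integrable lborel (\<lambda>s. complex_of_real (exp (- (e\<^sup>2 * s\<^sup>2) / 2)) * exp (\<i> * complex_of_real (\<tau> * s)))"
    using lborel_integrable_real_affine[OF int[of "\<tau> / e"], of e 0] assms unfolding eq by simp
  show "(\<integral>s. complex_of_real (exp (- (e\<^sup>2 * s\<^sup>2) / 2)) * exp (\<i> * complex_of_real (\<tau> * s)) \<partial>lborel)
      = complex_of_real (sqrt (2 * pi) / e * exp (- (\<tau>\<^sup>2 / (2 * e\<^sup>2))))"
    using lborel_integral_real_affine[of e "F (\<tau> / e)" 0] assms unfolding eq F
    by (simp add: field_simps power_divide scaleR_conv_of_real)
qed

text \<open>The parameter is an inverse width: as \<open>e\<close> tends to 0 the function tends to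
  1 pointwise, while its transform is a bump of width \<open>e\<close>. One parameter thus
  regularises on one side and localises on the other.\<close>

definition gauss :: "real \<Rightarrow> 'a::euclidean_space \<Rightarrow> real" where
  "gauss e \<xi> = exp (- (e\<^sup>2 * (norm \<xi>)\<^sup>2) / 2)"

definition gaussmod :: "'a::euclidean_space \<Rightarrow> real \<Rightarrow> 'a \<Rightarrow> complex" where
  "gaussmod x e \<xi> = complex_of_real (gauss e \<xi>) * exp (\<i> * complex_of_real (x \<bullet> \<xi>))"

lemma gaussmod_prod:
  "gaussmod x e \<xi> = (\<Prod>b\<in>Basis. complex_of_real (exp (- (e\<^sup>2 * (\<xi> \<bullet> b)\<^sup>2) / 2)) * exp (\<i> * complex_of_real ((x \<bullet> b) * (\<xi> \<bullet> b))))"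
proof -
  have n: "(norm \<xi>)\<^sup>2 = (\<Sum>b\<in>Basis. (\<xi> \<bullet> b)\<^sup>2)"
    unfolding power2_norm_eq_inner by (subst euclidean_inner) (simp add: power2_eq_square)
  have "gauss e \<xi> = (\<Prod>b\<in>Basis. exp (- (e\<^sup>2 * (\<xi> \<bullet> b)\<^sup>2) / 2))"
    unfolding gauss_def n by (simp add: exp_sum[symmetric] sum_distrib_left sum_negf sum_divide_distrib)
  moreover have "exp (\<i> * complex_of_real (x \<bullet> \<xi>)) = (\<Prod>b\<in>Basis. exp (\<i> * complex_of_real ((x \<bullet> b) * (\<xi> \<bullet> b))))"
    by (subst euclidean_inner) (simp add: exp_sum[symmetric] sum_distrib_left)
  ultimately show ?thesis unfolding gaussmod_def by (simp add: prod.distrib)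
qed

lemma gauss_measurable [measurable]: "gauss e \<in> borel_measurable borel"
  unfolding gauss_def[abs_def] by measurable

lemma gaussmod_measurable [measurable]: "gaussmod x e \<in> borel_measurable borel"
  unfolding gaussmod_def[abs_def] by measurable

lemma gauss_pos: "gauss e \<xi> > 0" by (simp add: gauss_def)

lemma gauss_le_1: "gauss e \<xi> \<le> 1" by (simp add: gauss_def)

lemma cmod_gaussmod: "cmod (gaussmod x e \<xi>) = gauss e \<xi>"
  using gauss_pos[of e \<xi>] by (simp add: gaussmod_def norm_mult)

lemma gaussmod_integrable:
  assumes "e > 0" shows "integrable lborel (gaussmod (x::'a::euclidean_space) e)"
  unfolding gaussmod_prod[abs_def]
  by (rule lborel_integrable_prod) (rule gaussian_integral_1(1)[OF assms])

lemma gaussmod_integral: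
  assumes "e > 0"
  shows "(\<integral>\<xi>. gaussmod (x::'a::euclidean_space) e \<xi> \<partial>lborel) = complex_of_real ((2 * pi) powr (DIM('a) / 2) / e ^ DIM('a) * gauss (1/e) x)"
proof -
  have n: "(norm x)\<^sup>2 = (\<Sum>b\<in>Basis. (x \<bullet> b)\<^sup>2)"
    unfolding power2_norm_eq_inner by (subst euclidean_inner) (simp add: power2_eq_square)
  have "gauss (1/e) x = (\<Prod>b\<in>Basis. exp (- ((x \<bullet> b)\<^sup>2 / (2 * e\<^sup>2))))"
    unfolding gauss_def n by (simp add: exp_sum[symmetric] sum_distrib_left sum_negf sum_divide_distrib power_divide mult.commute)
  moreover have "sqrt (2 * pi) ^ DIM('a) = (2 * pi) powr (DIM('a) / 2)"
    by (simp add: powr_half_sqrt[symmetric] powr_realpow[symmetric] powr_powr)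
  moreover have "(\<integral>\<xi>. gaussmod x e \<xi> \<partial>lborel) = (\<Prod>b\<in>Basis. complex_of_real (sqrt (2 * pi) / e * exp (- ((x \<bullet> b)\<^sup>2 / (2 * e\<^sup>2)))))"
    unfolding gaussmod_prod[abs_def]
    by (subst lborel_integral_prod, rule gaussian_integral_1(1)[OF assms]) (simp only: gaussian_integral_1(2)[OF assms])
  ultimately show ?thesis
    by (simp add: prod.distrib prod_dividef power_divide of_real_prod[symmetric] del: of_real_prod of_real_mult of_real_divide of_real_power)
qed

lemma gauss_integrable: "e > 0 \<Longrightarrow> integrable lborel (gauss e :: 'a::euclidean_space \<Rightarrow> real)"
  using integrable_norm[OF gaussmod_integrable[of e "0::'a"]] by (simp add: cmod_gaussmod)

definition FTc :: "'a::euclidean_space itself \<Rightarrow> real" where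
  "FTc _ = (2 * pi) powr (- real DIM('a) / 2)"

lemma FTc_pos: "FTc TYPE('a::euclidean_space) > 0" by (simp add: FTc_def)

lemma FT_eq: "FT f (\<xi>::'a::euclidean_space) = complex_of_real (FTc TYPE('a)) * (\<integral>y. f y * exp (- (\<i> * complex_of_real (\<xi> \<bullet> y))) \<partial>lborel)"
  by (simp add: FT_def FTc_def)

lemma FTc_inverse: "FTc TYPE('a::euclidean_space) * (2 * pi) powr (DIM('a) / 2) = 1"
  unfolding FTc_def by (simp add: powr_add[symmetric])

lemma FT_gaussmod:
  fixes x y :: "'a::euclidean_space"
  assumes "e > 0"
  shows "FT (gaussmod x e) y = complex_of_real (gauss (1/e) (x - y) / e ^ DIM('a))"
proof -
  have "gaussmod x e \<xi> * exp (- (\<i> * complex_of_real (y \<bullet> \<xi>))) = gaussmod (x - y) e \<xi>" for \<xi>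
    by (simp add: gaussmod_def inner_diff_left exp_diff exp_minus field_simps right_diff_distrib)
  then show ?thesis
    unfolding FT_eq using gaussmod_integral[OF assms, of "x - y"] FTc_inverse[where 'a='a]
    by (simp flip: of_real_mult mult.assoc add: mult.assoc[symmetric])
qed

text \<open>The substitution \<open>y = x + e z\<close> turns the Gaussian kernels into an approximate identity at \<open>x\<close>.\<close>
lemma FT_gaussmod_integral:
  fixes h :: "'a::euclidean_space \<Rightarrow> complex"
  assumes [measurable]: "h \<in> borel_measurable borel" and e: "e > 0"
  shows "(\<integral>y. h y * FT (gaussmod x e) y \<partial>lborel) = (\<integral>z. h (x + e *\<^sub>R z) * complex_of_real (gauss 1 z) \<partial>lborel)"
proof -
  have g: "gauss (1/e) (- (e *\<^sub>R z)) = gauss 1 (z::'a)" for z using e by (simp add: gauss_def power_divide power_mult_distrib)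
  have "(\<integral>y. h y * FT (gaussmod x e) y \<partial>lborel) = 
     \<bar>e\<bar> ^ DIM('a) *\<^sub>R (\<integral>z. h (x + e *\<^sub>R z) * (complex_of_real (gauss 1 z) * complex_of_real (1 / e ^ DIM('a))) \<partial>lborel)"
    unfolding FT_gaussmod[OF e]
    by (subst lborel_integral_affine[where t=x and c=e]) (use e in \<open>simp_all add: g\<close>)
  also have "\<dots> = (\<integral>z. h (x + e *\<^sub>R z) * complex_of_real (gauss 1 z) \<partial>lborel)"
    using e by (simp add: mult.assoc[symmetric] scaleR_conv_of_real)
  finally show ?thesis .
qed

text \<open>Each factor \<open>1 + (x \<bullet> b)^2\<close> is at most
  \<open>(1 + norm x)^2\<close>, so the weight with exponent \<open>2 * DIM('a)\<close> dominates
  their product over the basis, whose inverse is integrable factor by factor.\<close>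

lemma integrable_decay:
  fixes h :: "'a::euclidean_space \<Rightarrow> complex"
  assumes "h \<in> borel_measurable borel" and C: "\<And>x. (1 + norm x) ^ (2 * DIM('a)) * cmod (h x) \<le> C"
  shows "integrable lborel h"
proof (rule Bochner_Integration.integrable_bound)
  have "integrable lborel (\<lambda>x::real. inverse (1 + x\<^sup>2))"
    using integrable_inverse_1_plus_square by (simp add: set_integrable_def einterval_def)
  then show "integrable lborel (\<lambda>x::'a. C * (\<Prod>b\<in>Basis. inverse (1 + (x \<bullet> b)\<^sup>2)))"
    by (intro integrable_mult_right lborel_integrable_prod)
  show "AE x in lborel. norm (h x) \<le> norm (C * (\<Prod>b\<in>Basis. inverse (1 + (x \<bullet> b)\<^sup>2)))"
  proof (rule AE_I2)
    fix x :: 'a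
    define P where "P = (\<Prod>b\<in>Basis. (1 + (x \<bullet> b)\<^sup>2))"
    have "P \<le> (\<Prod>b\<in>(Basis::'a set). (1 + norm x)\<^sup>2)"
      unfolding P_def
    proof (rule prod_mono, intro conjI)
      fix b :: 'a assume "b \<in> Basis"
      then have "(x \<bullet> b)\<^sup>2 \<le> (norm x)\<^sup>2" using Basis_le_norm[of b x] by (simp add: abs_le_square_iff[symmetric])
      moreover have "(1 + norm x)\<^sup>2 = 1 + 2 * norm x + (norm x)\<^sup>2" by (simp add: power2_eq_square algebra_simps)
      ultimately show "1 + (x \<bullet> b)\<^sup>2 \<le> (1 + norm x)\<^sup>2" using norm_ge_zero[of x] by linarith
    qed simp
    also have "\<dots> = (1 + norm x) ^ (2 * DIM('a))" by (simp add: power_mult)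
    finally have "P * cmod (h x) \<le> C" using C[of x] mult_right_mono[of P _ "cmod (h x)"] by (meson norm_ge_zero order_trans)
    moreover have "P > 0" unfolding P_def by (intro prod_pos) (auto intro: add_pos_nonneg)
    ultimately have "cmod (h x) \<le> C * inverse P" by (simp add: field_simps)
    then show "norm (h x) \<le> norm (C * (\<Prod>b\<in>Basis. inverse (1 + (x \<bullet> b)\<^sup>2)))"
      unfolding P_def prod_inversef[symmetric] o_def by (metis abs_ge_self order_trans real_norm_def)
  qed
qed (use assms in auto)

text \<open>After \<open>1 + t \<le> exp t\<close> the exponent is \<open>N t - e^2 t^2 / 2\<close>;
  completing the square gives its maximum \<open>N^2 / (2 e^2)\<close>.\<close>

lemma gauss_decay:
  assumes "e > 0"
  shows "(1 + norm (\<xi>::'a::euclidean_space)) ^ N * gauss e \<xi> \<le> exp ((real N)\<^sup>2 / (2 * e\<^sup>2))"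
proof -
  have "(1 + norm \<xi>) ^ N \<le> exp (norm \<xi>) ^ N" by (rule power_mono[OF exp_ge_add_one_self]) simp
  also have "\<dots> = exp (real N * norm \<xi>)" by (simp add: exp_of_nat_mult)
  finally have "(1 + norm \<xi>) ^ N * gauss e \<xi> \<le> exp (real N * norm \<xi>) * gauss e \<xi>"
    using gauss_pos[of e \<xi>] by (simp add: mult_right_mono)
  also have "\<dots> = exp (real N * norm \<xi> - (e\<^sup>2 * (norm \<xi>)\<^sup>2) / 2)"
    unfolding gauss_def by (simp add: exp_add[symmetric])
  also have "\<dots> \<le> exp ((real N)\<^sup>2 / (2 * e\<^sup>2))"
  proof (subst exp_le_cancel_iff)
    have "0 \<le> (real N / e - e * norm \<xi>)\<^sup>2 / 2" by simp
    also have "\<dots> = (real N)\<^sup>2 / (2 * e\<^sup>2) - (real N * norm \<xi> - (e\<^sup>2 * (norm \<xi>)\<^sup>2) / 2)"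
      using assms by (simp add: power2_eq_square field_simps)
    finally show "real N * norm \<xi> - (e\<^sup>2 * (norm \<xi>)\<^sup>2) / 2 \<le> (real N)\<^sup>2 / (2 * e\<^sup>2)" by simp
  qed
  finally show ?thesis .
qed

definition invFT :: "('a::euclidean_space \<Rightarrow> complex) \<Rightarrow> 'a \<Rightarrow> complex" where
  "invFT g x = complex_of_real (FTc TYPE('a)) * (\<integral>\<xi>. g \<xi> * exp (\<i> * complex_of_real (x \<bullet> \<xi>)) \<partial>lborel)"

lemma gauss_poly_integrable:
  assumes "e > 0"
  shows "integrable lborel (\<lambda>z::'a::euclidean_space. (1 + norm z) ^ m * gauss e z)"
proof -
  have "integrable lborel (\<lambda>z::'a. complex_of_real ((1 + norm z) ^ m * gauss e z))"
  proof (rule integrable_decay)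
    fix x :: 'a
    have "(1 + norm x) ^ (2 * DIM('a)) * cmod (complex_of_real ((1 + norm x) ^ m * gauss e x)) = (1 + norm x) ^ (2 * DIM('a) + m) * gauss e x"
      using gauss_pos[of e x] by (simp only: norm_of_real) (simp add: abs_mult power_add mult.assoc)
    also have "\<dots> \<le> exp ((real (2 * DIM('a) + m))\<^sup>2 / (2 * e\<^sup>2))" by (rule gauss_decay[OF assms])
    finally show "(1 + norm x) ^ (2 * DIM('a)) * cmod (complex_of_real ((1 + norm x) ^ m * gauss e x)) \<le> exp ((real (2 * DIM('a) + m))\<^sup>2 / (2 * e\<^sup>2))" .
  qed measurable
  then show ?thesis by (simp only: complex_of_real_integrable_eq)
qed

lemma gauss_integral_1: "(\<integral>z. complex_of_real (gauss 1 z) \<partial>(lborel :: 'a::euclidean_space measure)) = complex_of_real ((2 * pi) powr (DIM('a) / 2))"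
  using gaussmod_integral[of 1 "0::'a"] by (simp add: gaussmod_def gauss_def)

text \<open>The dominating function comes from
  \<open>1 + norm (x + t z) \<le> (1 + norm x) (1 + norm z)\<close> for \<open>t\<close> in the unit
  interval, so polynomial growth of \<open>h\<close> is harmless against the Gaussian. The factor in
  the limit is the total mass of \<open>gauss 1\<close>.\<close>

lemma approx_identity:
  fixes h :: "'a::euclidean_space \<Rightarrow> complex"
  assumes h: "continuous_on UNIV h" and bound: "\<And>x. cmod (h x) \<le> C * (1 + norm x) ^ m"
  shows "(\<lambda>n. \<integral>z. h (x + inverse (real (Suc n)) *\<^sub>R z) * complex_of_real (gauss 1 z) \<partial>lborel)
     \<longlonglongrightarrow> h x * complex_of_real ((2 * pi) powr (DIM('a) / 2))"
proof -
  have [measurable]: "h \<in> borel_measurable borel" by (rule borel_measurable_continuous_onI[OF h])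
  have C0: "C \<ge> 0" using order_trans[OF norm_ge_zero bound[of 0]] by simp
  have "(\<lambda>n. \<integral>z. h (x + inverse (real (Suc n)) *\<^sub>R z) * complex_of_real (gauss 1 z) \<partial>lborel)
     \<longlonglongrightarrow> (\<integral>z. h x * complex_of_real (gauss 1 z) \<partial>(lborel :: 'a measure))"
  proof (rule integral_dominated_convergence)
    show "integrable lborel (\<lambda>z::'a. C * (1 + norm x) ^ m * ((1 + norm z) ^ m * gauss 1 z))"
      using gauss_poly_integrable[of 1 m, where 'a='a] by simp
    show "AE z in lborel. (\<lambda>n. h (x + inverse (real (Suc n)) *\<^sub>R z) * complex_of_real (gauss 1 z)) \<longlonglongrightarrow> h x * complex_of_real (gauss 1 z)"
    proof (rule AE_I2)
      fix z :: 'a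
      have "(\<lambda>n. x + inverse (real (Suc n)) *\<^sub>R z) \<longlonglongrightarrow> x + 0 *\<^sub>R z"
        by (intro tendsto_intros LIMSEQ_inverse_real_of_nat)
      then have "(\<lambda>n. h (x + inverse (real (Suc n)) *\<^sub>R z)) \<longlonglongrightarrow> h x"
        using continuous_on_tendsto_compose[OF h] by auto
      then show "(\<lambda>n. h (x + inverse (real (Suc n)) *\<^sub>R z) * complex_of_real (gauss 1 z)) \<longlonglongrightarrow> h x * complex_of_real (gauss 1 z)"
        by (intro tendsto_intros)
    qed
    fix n
    show "AE z in lborel. norm (h (x + inverse (real (Suc n)) *\<^sub>R z) * complex_of_real (gauss 1 z)) \<le> C * (1 + norm x) ^ m * ((1 + norm z) ^ m * gauss 1 z)"
    proof (rule AE_I2)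
      fix z :: 'a
      define t where "t = inverse (real (Suc n))"
      have t: "0 \<le> t" "t \<le> 1" by (auto simp: t_def inverse_le_1_iff simp del: of_nat_Suc)
      have "norm (x + t *\<^sub>R z) \<le> norm x + norm z"
        using norm_triangle_ineq[of x "t *\<^sub>R z"] t mult_right_mono[of t 1 "norm z"] by simp
      also have "1 + (norm x + norm z) \<le> (1 + norm x) * (1 + norm z)" by (simp add: algebra_simps)
      finally have "1 + norm (x + t *\<^sub>R z) \<le> (1 + norm x) * (1 + norm z)" by simp
      then have "(1 + norm (x + t *\<^sub>R z)) ^ m \<le> ((1 + norm x) * (1 + norm z)) ^ m" by (intro power_mono) auto
      then have "cmod (h (x + t *\<^sub>R z)) \<le> C * ((1 + norm x) * (1 + norm z)) ^ m"
        using bound[of "x + t *\<^sub>R z"] C0 by (meson mult_left_mono order_trans)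
      then have "cmod (h (x + t *\<^sub>R z)) * gauss 1 z \<le> C * ((1 + norm x) * (1 + norm z)) ^ m * gauss 1 z"
        using gauss_pos[of 1 z] by (intro mult_right_mono) auto
      then show "norm (h (x + inverse (real (Suc n)) *\<^sub>R z) * complex_of_real (gauss 1 z)) \<le> C * (1 + norm x) ^ m * ((1 + norm z) ^ m * gauss 1 z)"
        using gauss_pos[of 1 z] unfolding t_def by (simp add: norm_mult power_mult_distrib mult.assoc)
    qed
  qed measurable
  then show ?thesis unfolding integral_mult_right_zero gauss_integral_1 .
qed

lemma gauss_scale_tendsto_1: "(\<lambda>n. gauss (inverse (real (Suc n))) \<xi>) \<longlonglongrightarrow> 1"
proof -
  have "(\<lambda>n. exp (- ((inverse (real (Suc n)))\<^sup>2 * (norm \<xi>)\<^sup>2) / 2)) \<longlonglongrightarrow> exp (- (0\<^sup>2 * (norm \<xi>)\<^sup>2) / 2)"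
    by (intro tendsto_intros LIMSEQ_inverse_real_of_nat) auto
  then show ?thesis by (simp add: gauss_def del: of_nat_Suc)
qed

lemma integral_gaussmod_tendsto:
  fixes g :: "'a::euclidean_space \<Rightarrow> complex"
  assumes g: "integrable lborel g"
  shows "(\<lambda>n. \<integral>\<xi>. g \<xi> * gaussmod x (inverse (real (Suc n))) \<xi> \<partial>lborel) \<longlonglongrightarrow> (\<integral>\<xi>. g \<xi> * exp (\<i> * complex_of_real (x \<bullet> \<xi>)) \<partial>lborel)"
proof (rule integral_dominated_convergence)
  have [measurable]: "g \<in> borel_measurable borel" using g by auto
  show "(\<lambda>\<xi>. g \<xi> * exp (\<i> * complex_of_real (x \<bullet> \<xi>))) \<in> borel_measurable lborel" by measurable
  show "\<And>n. (\<lambda>\<xi>. g \<xi> * gaussmod x (inverse (real (Suc n))) \<xi>) \<in> borel_measurable lborel" by measurable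
  show "integrable lborel (\<lambda>\<xi>. norm (g \<xi>))" using g by (rule integrable_norm)
  show "AE \<xi> in lborel. (\<lambda>n. g \<xi> * gaussmod x (inverse (real (Suc n))) \<xi>) \<longlonglongrightarrow> g \<xi> * exp (\<i> * complex_of_real (x \<bullet> \<xi>))"
  proof (rule AE_I2)
    fix \<xi>
    have "(\<lambda>n. g \<xi> * gaussmod x (inverse (real (Suc n))) \<xi>) \<longlonglongrightarrow> g \<xi> * (complex_of_real 1 * exp (\<i> * complex_of_real (x \<bullet> \<xi>)))"
      unfolding gaussmod_def by (intro tendsto_intros gauss_scale_tendsto_1)
    then show "(\<lambda>n. g \<xi> * gaussmod x (inverse (real (Suc n))) \<xi>) \<longlonglongrightarrow> g \<xi> * exp (\<i> * complex_of_real (x \<bullet> \<xi>))" by simp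
  qed
  show "AE \<xi> in lborel. norm (g \<xi> * gaussmod x (inverse (real (Suc n))) \<xi>) \<le> norm (g \<xi>)" for n
    by (rule AE_I2) (simp add: norm_mult cmod_gaussmod mult_left_le gauss_le_1 del: of_nat_Suc)
qed

text \<open>Let \<open>e\<close> tend to 0 in \<open>eq\<close>: the left side is a Gaussian average
  of \<open>h\<close> around \<open>x\<close>, and the right side loses its Gaussian factor by
  dominated convergence. Linking \<open>h\<close> and \<open>g\<close> only through modulated
  Gaussians, with polynomial growth of \<open>h\<close>, serves Schwartz functions,
  \<open>\<Phi>\<close> and distributional transforms alike.\<close>

lemma Fourier_inversion:
  fixes h g :: "'a::euclidean_space \<Rightarrow> complex"
  assumes h: "continuous_on UNIV h" and bound: "\<And>x. cmod (h x) \<le> C * (1 + norm x) ^ m" and g: "integrable lborel g"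
    and eq: "\<And>e. e > 0 \<Longrightarrow> (\<integral>y. h y * FT (gaussmod x e) y \<partial>lborel) = (\<integral>\<xi>. g \<xi> * gaussmod x e \<xi> \<partial>lborel)"
  shows "h x = invFT g x"
proof -
  have m: "h \<in> borel_measurable borel" by (rule borel_measurable_continuous_onI[OF h])
  have "(\<integral>z. h (x + inverse (real (Suc n)) *\<^sub>R z) * complex_of_real (gauss 1 z) \<partial>lborel)
      = (\<integral>\<xi>. g \<xi> * gaussmod x (inverse (real (Suc n))) \<xi> \<partial>lborel)" for n
    using eq[of "inverse (real (Suc n))"] FT_gaussmod_integral[OF m, of "inverse (real (Suc n))" x] by (simp del: of_nat_Suc)
  with approx_identity[OF h bound, of x] integral_gaussmod_tendsto[OF g, of x]
  have "h x * complex_of_real ((2 * pi) powr (DIM('a) / 2)) = (\<integral>\<xi>. g \<xi> * exp (\<i> * complex_of_real (x \<bullet> \<xi>)) \<partial>lborel)"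
    by (simp only: LIMSEQ_unique)
  then have "invFT g x = h x * complex_of_real (FTc TYPE('a) * (2 * pi) powr (DIM('a) / 2))"
    unfolding invFT_def by (metis mult.left_commute mult.commute of_real_mult)
  then show ?thesis unfolding FTc_inverse by simp
qed

section \<open>The multiplication formula and injectivity of the transform\<close>

lemma cmod_iexp_mult [simp]: "cmod (z * exp (\<i> * complex_of_real a)) = cmod z" "cmod (z * exp (- (\<i> * complex_of_real a))) = cmod z"
  by (auto simp: norm_mult)

lemma integrable_mult_iexp:
  fixes g :: "'a::euclidean_space \<Rightarrow> complex"
  assumes g: "integrable lborel g"
  shows "integrable lborel (\<lambda>\<xi>. g \<xi> * exp (\<i> * complex_of_real (x \<bullet> \<xi>)))" "integrable lborel (\<lambda>\<xi>. g \<xi> * exp (- (\<i> * complex_of_real (x \<bullet> \<xi>))))"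
proof -
  have [measurable]: "g \<in> borel_measurable borel" using g by auto
  show "integrable lborel (\<lambda>\<xi>. g \<xi> * exp (\<i> * complex_of_real (x \<bullet> \<xi>)))" "integrable lborel (\<lambda>\<xi>. g \<xi> * exp (- (\<i> * complex_of_real (x \<bullet> \<xi>))))"
    by (rule Bochner_Integration.integrable_bound[OF g]; simp)+
qed

lemma FT_measurable:
  fixes f :: "'a::euclidean_space \<Rightarrow> complex"
  assumes [measurable]: "f \<in> borel_measurable borel"
  shows "FT f \<in> borel_measurable borel"
  unfolding FT_eq[abs_def] by measurable

lemma FT_bound: "cmod (FT f (\<xi>::'a::euclidean_space)) \<le> FTc TYPE('a) * (\<integral>y. cmod (f y) \<partial>lborel)"
proof -
  have "cmod (\<integral>y. f y * exp (- (\<i> * complex_of_real (\<xi> \<bullet> y))) \<partial>lborel) \<le> (\<integral>y. cmod (f y) \<partial>lborel)"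
    using integral_norm_bound[of lborel "\<lambda>y. f y * exp (- (\<i> * complex_of_real (\<xi> \<bullet> y)))"] by simp
  then show ?thesis unfolding FT_eq using FTc_pos[where 'a='a] by (simp add: norm_mult)
qed

lemma invFT_eq_FT: "invFT g x = FT g (- x)"
  by (simp add: invFT_def FT_eq)

lemma integrable_pair_iexp:
  fixes f g :: "'a::euclidean_space \<Rightarrow> complex"
  assumes f: "integrable lborel f" and g: "integrable lborel g"
  shows "integrable (lborel \<Otimes>\<^sub>M lborel) (\<lambda>(x, y). f x * g y * exp (- (\<i> * complex_of_real (x \<bullet> y))))"
proof -
  have [measurable]: "f \<in> borel_measurable borel" "g \<in> borel_measurable borel" using f g by auto
  show ?thesis
  proof (rule lborel_pair.Fubini_integrable)
    show "integrable lborel (\<lambda>x. \<integral>y. norm (case (x, y) of (x, y) \<Rightarrow> f x * g y * exp (- (\<i> * complex_of_real (x \<bullet> y)))) \<partial>lborel)"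
      using integrable_norm[OF f] by (simp add: norm_mult)
    show "AE x in lborel. integrable lborel (\<lambda>y. case (x, y) of (x, y) \<Rightarrow> f x * g y * exp (- (\<i> * complex_of_real (x \<bullet> y))))"
      using integrable_mult_iexp(2)[OF g] by (simp add: mult.assoc)
  qed measurable
qed

lemma FT_multiplication:
  fixes f g :: "'a::euclidean_space \<Rightarrow> complex"
  assumes f: "integrable lborel f" and g: "integrable lborel g"
  shows "(\<integral>x. f x * FT g x \<partial>lborel) = (\<integral>x. FT f x * g x \<partial>lborel)"
proof -
  have "(\<integral>x. \<integral>y. f x * g y * exp (- (\<i> * complex_of_real (x \<bullet> y))) \<partial>lborel \<partial>lborel)
      = (\<integral>y. \<integral>x. f x * g y * exp (- (\<i> * complex_of_real (x \<bullet> y))) \<partial>lborel \<partial>lborel)"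
    using lborel_pair.Fubini_integral[OF integrable_pair_iexp[OF f g]] by simp
  also have "(\<lambda>x. \<integral>y. f x * g y * exp (- (\<i> * complex_of_real (x \<bullet> y))) \<partial>lborel) = (\<lambda>x. f x * (\<integral>y. g y * exp (- (\<i> * complex_of_real (x \<bullet> y))) \<partial>lborel))"
    by (simp add: mult.assoc)
  also have "(\<lambda>y. \<integral>x. f x * g y * exp (- (\<i> * complex_of_real (x \<bullet> y))) \<partial>lborel) = (\<lambda>y. (\<integral>x. f x * exp (- (\<i> * complex_of_real (y \<bullet> x))) \<partial>lborel) * g y)"
    by (simp add: mult.assoc mult.left_commute[of _ "g _"] inner_commute mult.commute[of _ "g _"])
  finally have *: "(\<integral>x. f x * (\<integral>y. g y * exp (- (\<i> * complex_of_real (x \<bullet> y))) \<partial>lborel) \<partial>lborel) =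
      (\<integral>y. (\<integral>x. f x * exp (- (\<i> * complex_of_real (y \<bullet> x))) \<partial>lborel) * g y \<partial>lborel)" .
  show ?thesis unfolding FT_eq mult.assoc mult.left_commute[of "f _" "complex_of_real (FTc TYPE('a))"]
    by (simp only: integral_mult_right_zero *)
qed

lemma FT_gaussmod_commute:
  fixes x y :: "'a::euclidean_space"
  shows "e > 0 \<Longrightarrow> FT (gaussmod x e) y = FT (gaussmod y e) x"
  by (simp add: FT_gaussmod gauss_def norm_minus_commute)

text \<open>The kernel depends on \<open>x - y\<close> only, so by translation invariance its
  integral over \<open>x\<close> is the same for every \<open>y\<close>, and integrability is
  inherited from \<open>u\<close>.\<close>

lemma integrable_pair_gauss:
  fixes u \<psi> :: "'a::euclidean_space \<Rightarrow> complex"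
  assumes u: "integrable lborel u" and [measurable]: "\<psi> \<in> borel_measurable borel" and K: "\<And>x. cmod (\<psi> x) \<le> K" and e: "e > 0"
  shows "integrable (lborel \<Otimes>\<^sub>M lborel) (\<lambda>(y, x). u y * \<psi> x * FT (gaussmod x e) y)"
proof (rule Bochner_Integration.integrable_bound)
  have [measurable]: "u \<in> borel_measurable borel" using u by auto
  define G where "G = (\<lambda>z::'a. complex_of_real (gauss (1/e) z / e ^ DIM('a)))"
  have G: "integrable lborel G"
    unfolding G_def complex_of_real_integrable_eq using e by (intro integrable_divide gauss_integrable) auto
  have [measurable]: "G \<in> borel_measurable borel" using G by auto
  have FG: "FT (gaussmod x e) y = G (- y + 1 *\<^sub>R x)" for x y :: 'a by (simp add: FT_gaussmod[OF e] G_def)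
  have Gi: "integrable lborel (\<lambda>x. G (- y + 1 *\<^sub>R x))" for y by (rule lborel_integrable_affine[OF G]) simp
  have nG: "complex_of_real (cmod (G z)) = G z" for z unfolding G_def norm_of_real using gauss_pos[of "1/e" z] e by simp
  have G_int: "(\<integral>x. cmod (G (- y + 1 *\<^sub>R x)) \<partial>lborel) = (\<integral>x. cmod (G x) \<partial>lborel)" for y
  proof -
    have "complex_of_real (\<integral>x. cmod (G (- y + 1 *\<^sub>R x)) \<partial>lborel) = complex_of_real (\<integral>x. cmod (G x) \<partial>lborel)"
      using lborel_integral_affine[of G 1 "- y"] by (simp add: integral_complex_of_real[symmetric] nG del: integral_complex_of_real)
    then show ?thesis by (simp only: of_real_eq_iff)
  qed
  show "integrable (lborel \<Otimes>\<^sub>M lborel) (\<lambda>(y, x). complex_of_real K * u y * G (- y + 1 *\<^sub>R x))"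
  proof (rule lborel_pair.Fubini_integrable)
    show "integrable lborel (\<lambda>y. \<integral>x. norm (case (y, x) of (y, x) \<Rightarrow> complex_of_real K * u y * G (- y + 1 *\<^sub>R x)) \<partial>lborel)"
      using integrable_norm[OF u] G_int by (simp add: norm_mult)
    show "AE y in lborel. integrable lborel (\<lambda>x. case (y, x) of (y, x) \<Rightarrow> complex_of_real K * u y * G (- y + 1 *\<^sub>R x))"
      using Gi by simp
  qed measurable
  show "(\<lambda>(y, x). u y * \<psi> x * FT (gaussmod x e) y) \<in> borel_measurable (lborel \<Otimes>\<^sub>M lborel)"
    unfolding FG by measurable
  have "K \<ge> 0" using order_trans[OF norm_ge_zero K[of 0]] .
  then show "AE p in lborel \<Otimes>\<^sub>M lborel. norm (case p of (y, x) \<Rightarrow> u y * \<psi> x * FT (gaussmod x e) y)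
      \<le> norm (case p of (y, x) \<Rightarrow> complex_of_real K * u y * G (- y + 1 *\<^sub>R x))"
    using K unfolding FG by (intro AE_I2) (auto simp: norm_mult mult.commute[of K] intro!: mult_right_mono mult_left_mono)
qed

text \<open>Replace \<open>\<psi>\<close> by its Gaussian averages \<open>A n\<close>. The kernel is
  symmetric, so Fubini moves it onto \<open>u\<close>, and the multiplication formula turns the
  inner integral into one of \<open>FT u\<close>, which is zero. The averages stay bounded and tend
  to a multiple of \<open>\<psi>\<close>.\<close>

lemma FT_eq_0_imp_integral_eq_0:
  fixes u \<psi> :: "'a::euclidean_space \<Rightarrow> complex"
  assumes u: "integrable lborel u" and zero: "\<And>\<xi>. FT u \<xi> = 0"
    and \<psi>: "continuous_on UNIV \<psi>" and K: "\<And>x. cmod (\<psi> x) \<le> K"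
  shows "(\<integral>y. u y * \<psi> y \<partial>lborel) = 0"
proof -
  have [measurable]: "u \<in> borel_measurable borel" using u by auto
  have [measurable]: "\<psi> \<in> borel_measurable borel" by (rule borel_measurable_continuous_onI[OF \<psi>])
  define A where "A = (\<lambda>n y. \<integral>z. \<psi> (y + inverse (real (Suc n)) *\<^sub>R z) * complex_of_real (gauss 1 z) \<partial>(lborel::'a measure))"
  have z: "(\<integral>y. u y * A n y \<partial>lborel) = 0" for n
  proof -
    define e where "e = inverse (real (Suc n))"
    have e: "e > 0" by (simp add: e_def)
    have "(\<integral>y. u y * A n y \<partial>lborel) = (\<integral>y. u y * (\<integral>x. \<psi> x * FT (gaussmod y e) x \<partial>lborel) \<partial>lborel)"
      unfolding A_def e_def[symmetric] by (subst FT_gaussmod_integral[OF _ e]) auto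
    also have "\<dots> = (\<integral>y. \<integral>x. u y * \<psi> x * FT (gaussmod x e) y \<partial>lborel \<partial>lborel)"
      by (simp add: mult.assoc FT_gaussmod_commute[OF e])
    also have "\<dots> = (\<integral>x. \<integral>y. u y * \<psi> x * FT (gaussmod x e) y \<partial>lborel \<partial>lborel)"
      using lborel_pair.Fubini_integral[OF integrable_pair_gauss[OF u _ K e]] by simp
    also have "\<dots> = (\<integral>x. \<psi> x * (\<integral>y. u y * FT (gaussmod x e) y \<partial>lborel) \<partial>lborel)"
      by (simp add: mult.assoc mult.left_commute[of _ "\<psi> _"])
    also have "\<dots> = 0"
      using zero FT_multiplication[OF u gaussmod_integrable[OF e]] by simp
    finally show ?thesis .
  qed
  have "(\<lambda>n. \<integral>y. u y * A n y \<partial>lborel) \<longlonglongrightarrow> (\<integral>y. u y * (\<psi> y * complex_of_real ((2 * pi) powr (DIM('a) / 2))) \<partial>lborel)"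
  proof (rule integral_dominated_convergence)
    define I where "I = (\<integral>z. gauss 1 z \<partial>(lborel :: 'a measure))"
    have I: "integrable lborel (gauss 1 :: 'a \<Rightarrow> real)" by (rule gauss_integrable) simp
    show "integrable lborel (\<lambda>y. cmod (u y) * (K * I))" using integrable_norm[OF u] by simp
    show "\<And>n. (\<lambda>y. u y * A n y) \<in> borel_measurable lborel" unfolding A_def by measurable
    show "AE y in lborel. (\<lambda>n. u y * A n y) \<longlonglongrightarrow> u y * (\<psi> y * complex_of_real ((2 * pi) powr (DIM('a) / 2)))"
      unfolding A_def by (rule AE_I2, intro tendsto_intros approx_identity[OF \<psi>, of K 0]) (simp add: K)
    fix n
    show "AE y in lborel. norm (u y * A n y) \<le> cmod (u y) * (K * I)"
    proof (rule AE_I2)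
      fix y
      have "cmod (A n y) \<le> (\<integral>z. cmod (\<psi> (y + inverse (real (Suc n)) *\<^sub>R z) * complex_of_real (gauss 1 z)) \<partial>(lborel::'a measure))"
        unfolding A_def by (rule integral_norm_bound)
      also have "\<dots> \<le> (\<integral>z. K * gauss 1 z \<partial>(lborel::'a measure))"
      proof (rule integral_mono)
        have le: "cmod (\<psi> (y + inverse (real (Suc n)) *\<^sub>R z) * complex_of_real (gauss 1 z)) \<le> K * gauss 1 z" for z
          using K gauss_pos[of 1 z] by (simp add: norm_mult mult_right_mono)
        show "integrable lborel (\<lambda>z. K * gauss 1 (z::'a))" using I by simp
        show "integrable lborel (\<lambda>z. cmod (\<psi> (y + inverse (real (Suc n)) *\<^sub>R z) * complex_of_real (gauss 1 z)))"
          using order_trans[OF le abs_ge_self]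
          by (intro Bochner_Integration.integrable_bound[OF \<open>integrable lborel (\<lambda>z. K * gauss 1 (z::'a))\<close>]) (auto intro!: AE_I2 simp del: of_nat_Suc)
        show "cmod (\<psi> (y + inverse (real (Suc n)) *\<^sub>R z) * complex_of_real (gauss 1 z)) \<le> K * gauss 1 z" for z by (rule le)
      qed
      also have "\<dots> = K * I" by (simp add: I_def)
      finally show "norm (u y * A n y) \<le> cmod (u y) * (K * I)" by (simp add: norm_mult mult_left_mono)
    qed
  qed measurable
  then have "(\<integral>y. u y * (\<psi> y * complex_of_real ((2 * pi) powr (DIM('a) / 2))) \<partial>lborel) = 0"
    unfolding z by (simp only: LIMSEQ_const_iff)
  then show ?thesis unfolding mult.assoc[symmetric] by simp
qed

text \<open>Indicators of closed sets are bounded limits of continuous functions, and the closed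
  sets are an intersection-stable generator of the Borel sets. Hence \<open>u\<close> integrates to
  zero over every Borel set.\<close>

lemma FT_eq_0_imp_AE_eq_0:
  fixes u :: "'a::euclidean_space \<Rightarrow> complex"
  assumes u: "integrable lborel u" and zero: "\<And>\<xi>. FT u \<xi> = 0"
  shows "AE x in lborel. u x = 0"
proof -
  have [measurable]: "u \<in> borel_measurable borel" using u by auto
  have cont: "(\<integral>y. u y * \<psi> y \<partial>lborel) = 0" if "continuous_on UNIV \<psi>" "\<And>x. cmod (\<psi> x) \<le> K" for \<psi> K
    by (rule FT_eq_0_imp_integral_eq_0[OF u zero that])
  have closed: "(\<integral>y. indicator A y *\<^sub>R u y \<partial>lborel) = 0" if A: "closed A" for A
  proof (cases "A = {}")
    case False
    have [measurable]: "A \<in> sets borel" using A by simp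
    define \<psi> where "\<psi> = (\<lambda>(n::nat) x. complex_of_real (max 0 (1 - real n * infdist x A)))"
    have \<psi>1: "cmod (\<psi> n x) \<le> 1" for n x unfolding \<psi>_def norm_of_real by (simp add: infdist_nonneg)
    have \<psi>c: "continuous_on UNIV (\<psi> n)" for n unfolding \<psi>_def by (intro continuous_intros)
    have [measurable]: "\<psi> n \<in> borel_measurable borel" for n by (rule borel_measurable_continuous_onI[OF \<psi>c])
    have "(\<lambda>n. \<integral>y. u y * \<psi> n y \<partial>lborel) \<longlonglongrightarrow> (\<integral>y. indicator A y *\<^sub>R u y \<partial>lborel)"
    proof (rule integral_dominated_convergence[OF _ _ integrable_norm[OF u]])
      show "AE y in lborel. (\<lambda>n. u y * \<psi> n y) \<longlonglongrightarrow> indicator A y *\<^sub>R u y"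
      proof (rule AE_I2)
        fix y
        show "(\<lambda>n. u y * \<psi> n y) \<longlonglongrightarrow> indicator A y *\<^sub>R u y"
        proof (cases "y \<in> A")
          case True then show ?thesis by (simp add: \<psi>_def)
        next
          case False
          then have d: "infdist y A > 0" using in_closed_iff_infdist_zero[OF A \<open>A \<noteq> {}\<close>] infdist_nonneg[of y A] by (metis less_eq_real_def)
          obtain N where N: "real N * infdist y A > 1" using reals_Archimedean3[OF d] by blast
          have "\<psi> n y = 0" if "n \<ge> N" for n
          proof -
            have "real N * infdist y A \<le> real n * infdist y A" using that d by (intro mult_right_mono) auto
            then show ?thesis using N by (simp add: \<psi>_def)
          qed
          then have "\<forall>\<^sub>F n in sequentially. u y * \<psi> n y = 0" unfolding eventually_sequentially by auto
          then show ?thesis using False by (simp add: tendsto_eventually)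
        qed
      qed
      show "AE y in lborel. norm (u y * \<psi> n y) \<le> norm (u y)" for n
        using \<psi>1 by (intro AE_I2) (simp add: norm_mult mult_left_le)
    qed measurable
    then show ?thesis using cont[OF \<psi>c \<psi>1] by (simp add: LIMSEQ_const_iff)
  qed simp
  have all: "(\<integral>y. indicator A y *\<^sub>R u y \<partial>lborel) = 0" if "A \<in> sets borel" for A
  proof -
    have s: "sets borel = sigma_sets UNIV {A::'a set. closed A}" using borel_eq_closed by (metis sets_measure_of top_greatest Pow_UNIV)
    have A: "A \<in> sigma_sets UNIV {A::'a set. closed A}" using that s by simp
    show ?thesis
    proof (rule sigma_sets_induct_disjoint[OF _ _ A])
      show "Int_stable {A::'a set. closed A}" by (auto simp: Int_stable_def)
      fix A assume "A \<in> sigma_sets UNIV {A::'a set. closed A}" and z: "(\<integral>y. indicator A y *\<^sub>R u y \<partial>lborel) = 0"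
      then have [measurable]: "A \<in> sets borel" using s by simp
      have "indicator (UNIV - A) y *\<^sub>R u y = indicator UNIV y *\<^sub>R u y - indicator A y *\<^sub>R u y" for y by (simp add: indicator_def)
      then show "(\<integral>y. indicator (UNIV - A) y *\<^sub>R u y \<partial>lborel) = 0"
        using z closed[of UNIV] u by (simp add: integrable_mult_indicator Bochner_Integration.integral_diff)
    next
      fix A :: "nat \<Rightarrow> 'a set" assume d: "disjoint_family A" and r: "range A \<subseteq> sigma_sets UNIV {A::'a set. closed A}"
        and z: "\<And>i. (\<integral>y. indicator (A i) y *\<^sub>R u y \<partial>lborel) = 0"
      have [measurable]: "A i \<in> sets borel" for i using r s by auto
      have "set_integrable lborel (\<Union> (range A)) u" unfolding set_integrable_def using u by (intro integrable_mult_indicator) auto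
      then have "(LINT x:(\<Union>i. A i)|lborel. u x) = (\<Sum>i. (LINT x:A i|lborel. u x))"
        using d by (intro lebesgue_integral_countable_add) (auto simp: disjoint_family_on_def)
      then show "(\<integral>y. indicator (\<Union> (range A)) y *\<^sub>R u y \<partial>lborel) = 0" using z by (simp add: set_lebesgue_integral_def)
    qed (use closed in auto)
  qed
  have Re: "AE x in lborel. Re (u x) = 0"
  proof (rule density_unique_real)
    fix A assume "A \<in> sets (lborel::'a measure)"
    then have [measurable]: "A \<in> sets borel" by simp
    have "(\<integral>x. Re (indicator A x *\<^sub>R u x) \<partial>lborel) = 0"
      using all[of A] u by (subst integral_Re) (auto intro: integrable_mult_indicator)
    then show "(LINT x:A|lborel. Re (u x)) = (LINT x:A|lborel. 0)" by (simp add: set_lebesgue_integral_def)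
  qed (use u in auto)
  have Im: "AE x in lborel. Im (u x) = 0"
  proof (rule density_unique_real)
    fix A assume "A \<in> sets (lborel::'a measure)"
    then have [measurable]: "A \<in> sets borel" by simp
    have "(\<integral>x. Im (indicator A x *\<^sub>R u x) \<partial>lborel) = 0"
      using all[of A] u by (subst integral_Im) (auto intro: integrable_mult_indicator)
    then show "(LINT x:A|lborel. Im (u x)) = (LINT x:A|lborel. 0)" by (simp add: set_lebesgue_integral_def)
  qed (use u in auto)
  show ?thesis using Re Im by eventually_elim (simp add: complex_eq_iff)
qed

section \<open>Schwartz functions and distributional Fourier transforms\<close>

lemma pderivs_trans: "g \<in> pderivs h \<Longrightarrow> h \<in> pderivs \<gamma> \<Longrightarrow> g \<in> pderivs \<gamma>"
  by (induction rule: pderivs.induct) (auto intro: pderivs.intros)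

lemma schwartz_deriv:
  assumes "schwartz \<gamma>" "b \<in> Basis"
  shows "schwartz (\<lambda>x. frechet_derivative \<gamma> (at x) b)"
  using assms pderivs_trans[OF _ pderivs.step[OF pderivs.self assms(2)]] unfolding schwartz_def by meson

lemma schwartz_has_derivative: "schwartz \<gamma> \<Longrightarrow> (\<gamma> has_derivative frechet_derivative \<gamma> (at x)) (at x)"
  using pderivs.self unfolding schwartz_def by (metis frechet_derivative_works)

lemma schwartz_continuous: "schwartz \<gamma> \<Longrightarrow> continuous_on UNIV \<gamma>"
  using schwartz_has_derivative has_derivative_continuous by (metis continuous_at_imp_continuous_on)

lemma schwartz_measurable: "schwartz \<gamma> \<Longrightarrow> \<gamma> \<in> borel_measurable borel"
  by (intro borel_measurable_continuous_onI schwartz_continuous)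

lemma schwartz_decay: "schwartz \<gamma> \<Longrightarrow> \<exists>C. \<forall>x. (1 + norm x) ^ N * cmod (\<gamma> x) \<le> C"
  using pderivs.self unfolding schwartz_def by blast

lemma schwartz_bounded: "schwartz \<gamma> \<Longrightarrow> \<exists>C. \<forall>x. cmod (\<gamma> x) \<le> C"
  using schwartz_decay[of \<gamma> 0] by simp

lemma schwartz_integrable: "schwartz \<gamma> \<Longrightarrow> integrable lborel \<gamma>"
  using schwartz_decay schwartz_measurable integrable_decay by metis

text \<open>The difference quotients integrate to zero by translation invariance of Lebesgue
  measure, and dominated convergence passes this on to the derivative.\<close>

lemma integral_directional_derivative_eq_0:
  fixes \<phi> :: "'a::euclidean_space \<Rightarrow> complex"
  assumes \<phi>: "integrable lborel \<phi>" and d: "\<And>x. (\<phi> has_derivative \<phi>' x) (at x)"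
    and b: "norm b = 1" and C: "\<And>x. (1 + norm x) ^ (2 * DIM('a)) * cmod (\<phi>' x b) \<le> C"
    and [measurable]: "(\<lambda>x. \<phi>' x b) \<in> borel_measurable borel"
  shows "(\<integral>x. \<phi>' x b \<partial>lborel) = 0"
proof -
  define M where "M = 2 * DIM('a)"
  have [measurable]: "\<phi> \<in> borel_measurable borel" using \<phi> by auto
  have C0: "C \<ge> 0" using order_trans[OF _ C[of 0]] by simp
  \<comment> \<open>By the mean value theorem \<open>q n x\<close> is bounded by the derivative at
    some \<open>x + s b\<close> with \<open>0 < s < 1\<close>. Passing from that point back to
    \<open>x\<close> at most doubles \<open>1 + norm\<close>, hence the factor
    \<open>2 ^ M\<close>.\<close>
  define w where "w = (\<lambda>x::'a. 2 ^ M * C / (1 + norm x) ^ M)"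
  have w: "integrable lborel w"
  proof -
    have "integrable lborel (\<lambda>x. complex_of_real (w x))"
    proof (rule integrable_decay)
      show "(1 + norm x) ^ (2 * DIM('a)) * cmod (complex_of_real (w x)) \<le> 2 ^ M * C" for x :: 'a
      proof -
        have "1 + norm x \<noteq> 0" by (metis norm_ge_zero add_nonneg_eq_0_iff zero_le_one zero_neq_one)
        then show ?thesis unfolding norm_of_real using C0 by (simp add: w_def M_def abs_mult)
      qed
      show "(\<lambda>x. complex_of_real (w x)) \<in> borel_measurable borel" unfolding w_def by measurable
    qed
    then show ?thesis by (simp only: complex_of_real_integrable_eq)
  qed
  define t where "t = (\<lambda>n. inverse (real (Suc n)))"
  have t: "0 < t n" "t n \<le> 1" for n by (auto simp: t_def inverse_le_1_iff simp del: of_nat_Suc)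
  have t0: "t \<longlonglongrightarrow> 0" unfolding t_def by (rule LIMSEQ_inverse_real_of_nat)
  define q where "q = (\<lambda>n x. (\<phi> (t n *\<^sub>R b + 1 *\<^sub>R x) - \<phi> x) /\<^sub>R t n)"
  have "(\<lambda>n. \<integral>x. q n x \<partial>lborel) \<longlonglongrightarrow> (\<integral>x. \<phi>' x b \<partial>lborel)"
  proof (rule integral_dominated_convergence[OF _ _ w])
    show "AE x in lborel. (\<lambda>n. q n x) \<longlonglongrightarrow> \<phi>' x b"
    proof (rule AE_I2)
      fix x
      have "((\<lambda>s. x + s *\<^sub>R b) has_derivative (\<lambda>s. s *\<^sub>R b)) (at 0)" by (auto intro!: derivative_eq_intros)
      then have "((\<lambda>s. \<phi> (x + s *\<^sub>R b)) has_derivative (\<lambda>s. \<phi>' x (s *\<^sub>R b))) (at 0)"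
        using has_derivative_compose[of "\<lambda>s. x + s *\<^sub>R b" "\<lambda>s. s *\<^sub>R b" 0 UNIV \<phi> "\<phi>' x"] d[of x] by simp
      moreover have "(\<lambda>s. \<phi>' x (s *\<^sub>R b)) = (\<lambda>s. s *\<^sub>R \<phi>' x b)"
        using has_derivative_linear[OF d[of x]] by (simp add: linear_cmul)
      ultimately have "((\<lambda>s. norm (\<phi> (x + s *\<^sub>R b) - \<phi> x - s *\<^sub>R \<phi>' x b) / norm s) \<longlongrightarrow> 0) (at 0)"
        by (simp add: has_derivative_at)
      moreover have "filterlim t (at 0) sequentially"
        using t0 t(1) by (auto simp: filterlim_at less_imp_neq[OF t(1), symmetric])
      ultimately have "(\<lambda>n. norm (\<phi> (x + t n *\<^sub>R b) - \<phi> x - t n *\<^sub>R \<phi>' x b) / norm (t n)) \<longlonglongrightarrow> 0"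
        by (rule filterlim_compose)
      moreover have "norm (\<phi> (x + t n *\<^sub>R b) - \<phi> x - t n *\<^sub>R \<phi>' x b) / norm (t n) = norm (q n x - \<phi>' x b)" for n
      proof -
        have eq: "q n x - \<phi>' x b = (\<phi> (x + t n *\<^sub>R b) - \<phi> x - t n *\<^sub>R \<phi>' x b) /\<^sub>R t n"
          using t(1)[of n] by (simp add: q_def add.commute scaleR_diff_right)
        have "norm v / norm r = norm (v /\<^sub>R r)" for v :: complex and r :: real
          by (simp add: divide_inverse)
        then show ?thesis unfolding eq .
      qed
      ultimately have "(\<lambda>n. norm (q n x - \<phi>' x b)) \<longlonglongrightarrow> 0" by simp
      then show "(\<lambda>n. q n x) \<longlonglongrightarrow> \<phi>' x b" by (rule LIM_zero_cancel[OF tendsto_norm_zero_cancel])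
    qed
    fix n
    show "AE x in lborel. norm (q n x) \<le> w x"
    proof (rule AE_I2)
      fix x
      define f where "f = (\<lambda>s. \<phi> (x + s *\<^sub>R b))"
      have D: "(f has_derivative (\<lambda>r. \<phi>' (x + s *\<^sub>R b) (r *\<^sub>R b))) (at s)" for s
      proof -
        have "((\<lambda>s. x + s *\<^sub>R b) has_derivative (\<lambda>s. s *\<^sub>R b)) (at s)" by (auto intro!: derivative_eq_intros)
        then show ?thesis unfolding f_def
          using has_derivative_compose[of "\<lambda>s. x + s *\<^sub>R b" "\<lambda>s. s *\<^sub>R b" s UNIV \<phi> "\<phi>' (x + s *\<^sub>R b)"] d[of "x + s *\<^sub>R b"] by simp
      qed
      have "\<exists>s\<in>{0<..<t n}. norm (f (t n) - f 0) \<le> norm (\<phi>' (x + s *\<^sub>R b) ((t n - 0) *\<^sub>R b))"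
        using D has_derivative_continuous[OF D] t[of n] by (intro mvt_general) (auto intro!: continuous_at_imp_continuous_on)
      then obtain s where s: "0 < s" "s < t n" "norm (f (t n) - f 0) \<le> norm (\<phi>' (x + s *\<^sub>R b) (t n *\<^sub>R b))" by auto
      have l: "\<phi>' (x + s *\<^sub>R b) (t n *\<^sub>R b) = t n *\<^sub>R \<phi>' (x + s *\<^sub>R b) b"
        using has_derivative_linear[OF d[of "x + s *\<^sub>R b"]] by (simp add: linear_cmul)
      have "norm (q n x) = norm (f (t n) - f 0) / t n" using t[of n] by (simp add: q_def f_def add.commute divide_inverse)
      also have "\<dots> \<le> norm (\<phi>' (x + s *\<^sub>R b) b)" using s(3) t[of n] unfolding l by (simp add: field_simps)
      also have "\<dots> \<le> w x"
      proof -
        have "norm x \<le> norm (x + s *\<^sub>R b) + norm (s *\<^sub>R b)" using norm_triangle_ineq4[of "x + s *\<^sub>R b" "s *\<^sub>R b"] by simp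
        then have "1 + norm x \<le> 2 * (1 + norm (x + s *\<^sub>R b))" using s t[of n] norm_ge_zero[of "x + s *\<^sub>R b"] b
          by (smt (verit) norm_scaleR mult_cancel_left2)
        then have "(1 + norm x) ^ M \<le> (2 * (1 + norm (x + s *\<^sub>R b))) ^ M" by (intro power_mono) auto
        then have "(1 + norm x) ^ M * norm (\<phi>' (x + s *\<^sub>R b) b) \<le> 2 ^ M * ((1 + norm (x + s *\<^sub>R b)) ^ M * norm (\<phi>' (x + s *\<^sub>R b) b))"
          unfolding power_mult_distrib mult.assoc[symmetric] by (rule mult_right_mono) simp
        also have "\<dots> \<le> 2 ^ M * C" using C[of "x + s *\<^sub>R b"] by (simp add: M_def)
        finally show ?thesis unfolding w_def by (subst pos_le_divide_eq) (auto intro!: zero_less_power add_pos_nonneg simp: mult.commute)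
      qed
      finally show "norm (q n x) \<le> w x" .
    qed
    show "q n \<in> borel_measurable lborel" unfolding q_def by measurable
  qed measurable
  moreover have "(\<integral>x. q n x \<partial>lborel) = 0" for n
  proof -
    have "(\<integral>x. q n x \<partial>lborel) = ((\<integral>x. \<phi> (t n *\<^sub>R b + 1 *\<^sub>R x) \<partial>lborel) - (\<integral>x. \<phi> x \<partial>lborel)) /\<^sub>R t n"
      unfolding q_def using lborel_integrable_affine[OF \<phi>, of 1 "t n *\<^sub>R b"] \<phi> by simp
    then show ?thesis using lborel_integral_affine[of \<phi> 1 "t n *\<^sub>R b"] by simp
  qed
  ultimately show ?thesis by (simp add: LIMSEQ_const_iff)
qed

text \<open>Integration by parts: the derivative of \<open>h\<close> times the exponential
  integrates to zero, and the product rule splits it into the two sides.\<close>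

lemma FT_deriv:
  fixes h :: "'a::euclidean_space \<Rightarrow> complex"
  assumes h: "schwartz h" and b: "b \<in> Basis"
  shows "FT (\<lambda>x. frechet_derivative h (at x) b) \<xi> = \<i> * complex_of_real (\<xi> \<bullet> b) * FT h \<xi>"
proof -
  define E where "E = (\<lambda>x. exp (- (\<i> * complex_of_real (\<xi> \<bullet> x))))"
  define h' where "h' = (\<lambda>x. frechet_derivative h (at x) b)"
  have h'S: "schwartz h'" unfolding h'_def by (rule schwartz_deriv[OF h b])
  have [measurable]: "h \<in> borel_measurable borel" "h' \<in> borel_measurable borel"
    using schwartz_measurable h h'S by auto
  have [measurable]: "E \<in> borel_measurable borel" unfolding E_def by measurable
  define \<phi>' where "\<phi>' = (\<lambda>x v. h x * (E x * (- (\<i> * complex_of_real (\<xi> \<bullet> v)))) + frechet_derivative h (at x) v * E x)"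
  have "(E has_derivative (\<lambda>v. E x * (- (\<i> * complex_of_real (\<xi> \<bullet> v))))) (at x)" for x
  proof -
    have "((\<lambda>x. - (\<i> * complex_of_real (\<xi> \<bullet> x))) has_derivative (\<lambda>v. - (\<i> * complex_of_real (\<xi> \<bullet> v)))) (at x)"
      by (auto intro!: derivative_eq_intros)
    from has_derivative_compose[OF this DERIV_exp[unfolded has_field_derivative_def]] show ?thesis unfolding E_def .
  qed
  then have d: "((\<lambda>x. h x * E x) has_derivative \<phi>' x) (at x)" for x
    unfolding \<phi>'_def by (intro has_derivative_mult schwartz_has_derivative[OF h])
  have ih: "integrable lborel h" "integrable lborel h'" using schwartz_integrable h h'S by auto
  have nE: "cmod (E x) = 1" for x by (simp add: E_def)
  have e: "\<phi>' x b = h' x * E x - \<i> * complex_of_real (\<xi> \<bullet> b) * (h x * E x)" for x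
    by (simp add: \<phi>'_def h'_def)
  obtain C0 where C0: "\<And>x. (1 + norm x) ^ (2 * DIM('a)) * cmod (h x) \<le> C0" using schwartz_decay[OF h] by blast
  obtain C1 where C1: "\<And>x. (1 + norm x) ^ (2 * DIM('a)) * cmod (h' x) \<le> C1" using schwartz_decay[OF h'S] by blast
  have "(\<integral>x. \<phi>' x b \<partial>lborel) = 0"
  proof (rule integral_directional_derivative_eq_0[OF _ d])
    show "integrable lborel (\<lambda>x. h x * E x)" unfolding E_def by (rule integrable_mult_iexp(2)[OF ih(1)])
    show "norm b = 1" using b by simp
    show "(1 + norm x) ^ (2 * DIM('a)) * cmod (\<phi>' x b) \<le> C1 + \<bar>\<xi> \<bullet> b\<bar> * C0" for x
    proof -
      have "cmod (\<phi>' x b) \<le> cmod (h' x) + \<bar>\<xi> \<bullet> b\<bar> * cmod (h x)"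
        unfolding e using norm_triangle_ineq4[of "h' x * E x" "\<i> * complex_of_real (\<xi> \<bullet> b) * (h x * E x)"] nE by (simp add: norm_mult)
      then have "(1 + norm x) ^ (2 * DIM('a)) * cmod (\<phi>' x b) \<le> (1 + norm x) ^ (2 * DIM('a)) * (cmod (h' x) + \<bar>\<xi> \<bullet> b\<bar> * cmod (h x))"
        by (intro mult_left_mono) auto
      also have "\<dots> = (1 + norm x) ^ (2 * DIM('a)) * cmod (h' x) + \<bar>\<xi> \<bullet> b\<bar> * ((1 + norm x) ^ (2 * DIM('a)) * cmod (h x))"
        by (simp add: algebra_simps)
      also have "\<dots> \<le> C1 + \<bar>\<xi> \<bullet> b\<bar> * C0" using C0[of x] C1[of x] by (intro add_mono mult_left_mono) auto
      finally show ?thesis .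
    qed
    show "(\<lambda>x. \<phi>' x b) \<in> borel_measurable borel" unfolding e by measurable
  qed
  moreover have "(\<integral>x. \<phi>' x b \<partial>lborel) = (\<integral>x. h' x * E x \<partial>lborel) - \<i> * complex_of_real (\<xi> \<bullet> b) * (\<integral>x. h x * E x \<partial>lborel)"
    unfolding e using integrable_mult_iexp(2)[OF ih(1), of \<xi>] integrable_mult_iexp(2)[OF ih(2), of \<xi>]
    by (simp add: E_def)
  ultimately show ?thesis unfolding FT_eq h'_def[symmetric] by (simp add: E_def)
qed

text \<open>\<open>FT_deriv\<close> trades each coordinate factor for a derivative of
  \<open>h\<close>, which is why the induction generalises over \<open>h\<close>.\<close>

lemma FT_schwartz_decay_1:
  fixes h :: "'a::euclidean_space \<Rightarrow> complex"
  assumes "b \<in> Basis"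
  shows "schwartz h \<Longrightarrow> \<exists>C. \<forall>\<xi>. \<bar>\<xi> \<bullet> b\<bar> ^ N * cmod (FT h \<xi>) \<le> C"
proof (induction N arbitrary: h)
  case 0
  show ?case using FT_bound[of h] by auto
next
  case (Suc N)
  obtain C where "\<And>\<xi>. \<bar>\<xi> \<bullet> b\<bar> ^ N * cmod (FT (\<lambda>x. frechet_derivative h (at x) b) \<xi>) \<le> C"
    using Suc.IH[OF schwartz_deriv[OF Suc.prems assms]] by blast
  then have "\<bar>\<xi> \<bullet> b\<bar> ^ Suc N * cmod (FT h \<xi>) \<le> C" for \<xi>
    by (simp add: FT_deriv[OF Suc.prems assms] norm_mult mult.assoc[symmetric] mult.commute[of "\<bar>\<xi> \<bullet> b\<bar>"])
  then show ?case by blast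
qed

lemma FT_schwartz_integrable:
  fixes \<gamma> :: "'a::euclidean_space \<Rightarrow> complex"
  assumes \<gamma>: "schwartz \<gamma>"
  shows "integrable lborel (FT \<gamma>)"
proof -
  define M where "M = 2 * DIM('a)"
  define d where "d = real DIM('a)"
  have "\<forall>b. \<exists>C. b \<in> Basis \<longrightarrow> (\<forall>\<xi>. \<bar>\<xi> \<bullet> b\<bar> ^ M * cmod (FT \<gamma> \<xi>) \<le> C)" using FT_schwartz_decay_1[OF _ \<gamma>] by blast
  then obtain C where C: "\<And>b \<xi>. b \<in> Basis \<Longrightarrow> \<bar>\<xi> \<bullet> b\<bar> ^ M * cmod (FT \<gamma> \<xi>) \<le> C b" by metis
  define C0 where "C0 = FTc TYPE('a) * (\<integral>y. cmod (\<gamma> y) \<partial>lborel)"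
  have Cpos: "C b \<ge> 0" if "b \<in> Basis" for b using order_trans[OF _ C[OF that, of 0]] by simp
  show ?thesis
  proof (rule integrable_decay[OF FT_measurable[OF schwartz_measurable[OF \<gamma>]]])
    fix \<xi> :: 'a
    \<comment> \<open>The largest coordinate, \<open>a\<close> in modulus, controls the norm through
      \<open>norm \<xi> \<le> d * a\<close>, so decay along that one axis is enough.\<close>
    define S where "S = (\<lambda>b. \<bar>\<xi> \<bullet> b\<bar>) ` Basis"
    have S: "finite S" "S \<noteq> {}" by (auto simp: S_def)
    then have "Max S \<in> S" by (rule Max_in)
    then obtain b where b1: "b \<in> Basis" "Max S = \<bar>\<xi> \<bullet> b\<bar>" unfolding S_def by blast
    have b: "b \<in> Basis" "\<And>c. c \<in> Basis \<Longrightarrow> \<bar>\<xi> \<bullet> c\<bar> \<le> \<bar>\<xi> \<bullet> b\<bar>"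
      using b1(1) Max_ge[OF S(1)] unfolding b1(2) by (auto simp: S_def)
    define a where "a = \<bar>\<xi> \<bullet> b\<bar>"
    have "norm \<xi> \<le> (\<Sum>c\<in>Basis. \<bar>\<xi> \<bullet> c\<bar>)" by (rule norm_le_l1)
    also have "\<dots> \<le> d * a" using sum_bounded_above[of Basis "\<lambda>c. \<bar>\<xi> \<bullet> c\<bar>" a] b(2) by (simp add: a_def d_def)
    also have "1 + d * a \<le> (1 + d) * max 1 a"
    proof (cases "1 \<le> a")
      case True then show ?thesis by (simp add: distrib_right)
    next
      case False then show ?thesis using mult_left_le[of a d] by (simp add: d_def)
    qed
    finally have "1 + norm \<xi> \<le> (1 + d) * max 1 a" by simp
    then have "(1 + norm \<xi>) ^ M \<le> ((1 + d) * max 1 a) ^ M" by (intro power_mono) auto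
    also have "\<dots> \<le> (1 + d) ^ M * (1 + a ^ M)"
      by (auto simp: power_mult_distrib max_def a_def d_def intro!: mult_left_mono)
    finally have "(1 + norm \<xi>) ^ M * cmod (FT \<gamma> \<xi>) \<le> (1 + d) ^ M * (1 + a ^ M) * cmod (FT \<gamma> \<xi>)" by (intro mult_right_mono) auto
    also have "\<dots> = (1 + d) ^ M * (cmod (FT \<gamma> \<xi>) + a ^ M * cmod (FT \<gamma> \<xi>))" by (simp add: algebra_simps)
    also have "\<dots> \<le> (1 + d) ^ M * (C0 + C b)"
      using FT_bound[of \<gamma> \<xi>] C[OF b(1), of \<xi>] by (intro mult_left_mono add_mono) (auto simp: C0_def a_def d_def)
    \<comment> \<open>The axis \<open>b\<close> depends on \<open>\<xi>\<close>; the sum over all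
      axes removes it from the constant.\<close>
    also have "C b \<le> (\<Sum>c\<in>Basis. C c)" using Cpos b(1) by (intro member_le_sum) auto
    finally show "(1 + norm \<xi>) ^ (2 * DIM('a)) * cmod (FT \<gamma> \<xi>) \<le> (1 + d) ^ M * (C0 + (\<Sum>c\<in>Basis. C c))"
      by (simp add: M_def d_def mult_left_mono)
  qed
qed

lemma schwartz_inversion:
  fixes \<gamma> :: "'a::euclidean_space \<Rightarrow> complex"
  assumes \<gamma>: "schwartz \<gamma>"
  shows "invFT (FT \<gamma>) x = \<gamma> x"
proof -
  obtain C where C: "\<And>x. cmod (\<gamma> x) \<le> C * (1 + norm x) ^ 0" using schwartz_bounded[OF \<gamma>] by auto
  show ?thesis
    by (rule Fourier_inversion[OF schwartz_continuous[OF \<gamma>] C FT_schwartz_integrable[OF \<gamma>], symmetric])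
       (simp add: FT_multiplication[OF schwartz_integrable[OF \<gamma>] gaussmod_integrable])
qed

lemma lborel_integral_reflect:
  fixes f :: "'a::euclidean_space \<Rightarrow> complex"
  assumes "f \<in> borel_measurable borel"
  shows "(\<integral>x. f (- x) \<partial>lborel) = (\<integral>x. f x \<partial>lborel)"
  using lborel_integral_affine[OF assms, of "-1" 0] by simp

text \<open>\<open>invFT g\<close> is the reflected transform of \<open>g\<close>. After a
  reflection of the integral the multiplication formula moves the transform onto \<open>w\<close>,
  the reflected \<open>FT \<gamma>\<close>, and the transform of \<open>w\<close> is
  \<open>\<gamma>\<close> by inversion.\<close>

lemma has_dist_FT_invFT:
  fixes g :: "'a::euclidean_space \<Rightarrow> complex"
  assumes g: "integrable lborel g"
  shows "has_dist_FT (invFT g) g"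
  unfolding has_dist_FT_def
proof (intro conjI allI impI)
  have [measurable]: "g \<in> borel_measurable borel" using g by auto
  show "g \<in> borel_measurable lborel" by simp
  fix \<gamma> :: "'a \<Rightarrow> complex" assume \<gamma>: "schwartz \<gamma>"
  have [measurable]: "\<gamma> \<in> borel_measurable borel" "FT \<gamma> \<in> borel_measurable borel" "FT g \<in> borel_measurable borel"
    using schwartz_measurable[OF \<gamma>] FT_measurable[of g] FT_measurable[of \<gamma>] by auto
  obtain C where C: "\<And>x. cmod (\<gamma> x) \<le> C" using schwartz_bounded[OF \<gamma>] by auto
  show "integrable lborel (\<lambda>x. g x * \<gamma> x)"
  proof (rule Bochner_Integration.integrable_bound)
    show "integrable lborel (\<lambda>x. complex_of_real C * g x)" using g by simp
    show "AE x in lborel. norm (g x * \<gamma> x) \<le> norm (complex_of_real C * g x)"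
      using order_trans[OF C abs_ge_self] by (intro AE_I2) (simp add: norm_mult mult.commute mult_right_mono)
  qed measurable
  define w where "w = (\<lambda>x. FT \<gamma> (- x))"
  have w: "integrable lborel w" unfolding w_def using lborel_integrable_affine[OF FT_schwartz_integrable[OF \<gamma>], of "-1" 0] by simp
  have FTw: "FT w \<xi> = \<gamma> \<xi>" for \<xi>
  proof -
    have "(\<integral>y. w y * exp (- (\<i> * complex_of_real (\<xi> \<bullet> y))) \<partial>lborel) = (\<integral>y. FT \<gamma> y * exp (\<i> * complex_of_real (\<xi> \<bullet> y)) \<partial>lborel)"
      using lborel_integral_reflect[of "\<lambda>y. FT \<gamma> y * exp (\<i> * complex_of_real (\<xi> \<bullet> y))"] by (simp add: w_def)
    then have "FT w \<xi> = invFT (FT \<gamma>) \<xi>" by (simp add: FT_eq invFT_def)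
    then show ?thesis using schwartz_inversion[OF \<gamma>] by simp
  qed
  have "(\<integral>x. invFT g x * FT \<gamma> x \<partial>lborel) = (\<integral>x. FT g x * w x \<partial>lborel)"
    unfolding invFT_eq_FT w_def using lborel_integral_reflect[of "\<lambda>x. FT g x * FT \<gamma> (- x)"] by simp
  also have "\<dots> = (\<integral>x. g x * FT w x \<partial>lborel)" using FT_multiplication[OF g w] by simp
  finally show "(\<integral>x. invFT g x * FT \<gamma> x \<partial>lborel) = (\<integral>x. g x * \<gamma> x \<partial>lborel)" by (simp add: FTw)
qed

text \<open>Polynomials in the coordinates. \<open>schwartz\<close> speaks of all iterated
  derivatives, and those of a modulated Gaussian are a polynomial times the same Gaussian; closure
  of this class under partial derivatives and its polynomial growth are all that is used.\<close>

inductive_set gpoly :: "('a::euclidean_space \<Rightarrow> complex) set" where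
  const: "(\<lambda>x. c) \<in> gpoly"
| coord: "b \<in> Basis \<Longrightarrow> (\<lambda>x. complex_of_real (x \<bullet> b)) \<in> gpoly"
| add: "p \<in> gpoly \<Longrightarrow> q \<in> gpoly \<Longrightarrow> (\<lambda>x. p x + q x) \<in> gpoly"
| mult: "p \<in> gpoly \<Longrightarrow> q \<in> gpoly \<Longrightarrow> (\<lambda>x. p x * q x) \<in> gpoly"

lemma gpoly_derivative:
  "p \<in> gpoly \<Longrightarrow> \<exists>p'. (\<forall>x. (p has_derivative p' x) (at x)) \<and> (\<forall>b\<in>Basis. (\<lambda>x. p' x b) \<in> gpoly)"
proof (induction rule: gpoly.induct)
  case (const c)
  then show ?case by (intro exI[of _ "\<lambda>x v. 0"]) (auto intro: gpoly.const)
next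
  case (coord b)
  have "((\<lambda>x. complex_of_real (x \<bullet> b)) has_derivative (\<lambda>v. complex_of_real (v \<bullet> b))) (at x)" for x
    by (auto intro!: derivative_eq_intros)
  then show ?case by (intro exI[of _ "\<lambda>x v. complex_of_real (v \<bullet> b)"]) (auto intro: gpoly.const)
next
  case (add p q)
  then obtain p' q' where "\<And>x. (p has_derivative p' x) (at x)" "\<And>b. b\<in>Basis \<Longrightarrow> (\<lambda>x. p' x b) \<in> gpoly"
    "\<And>x. (q has_derivative q' x) (at x)" "\<And>b. b\<in>Basis \<Longrightarrow> (\<lambda>x. q' x b) \<in> gpoly" by blast
  then show ?case
    by (intro exI[of _ "\<lambda>x v. p' x v + q' x v"]) (auto intro: gpoly.add has_derivative_add)
next
  case (mult p q)
  then obtain p' q' where "\<And>x. (p has_derivative p' x) (at x)" "\<And>b. b\<in>Basis \<Longrightarrow> (\<lambda>x. p' x b) \<in> gpoly"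
    "\<And>x. (q has_derivative q' x) (at x)" "\<And>b. b\<in>Basis \<Longrightarrow> (\<lambda>x. q' x b) \<in> gpoly" by blast
  then show ?case using mult.hyps
    by (intro exI[of _ "\<lambda>x v. p x * q' x v + p' x v * q x"]) (auto intro!: gpoly.add gpoly.mult has_derivative_mult)
qed

lemma gpoly_growth: "p \<in> gpoly \<Longrightarrow> \<exists>C N. C \<ge> 0 \<and> (\<forall>x. cmod (p x) \<le> C * (1 + norm x) ^ N)"
proof (induction rule: gpoly.induct)
  case (const c)
  show ?case by (rule exI[of _ "cmod c"], rule exI[of _ 0]) simp
next
  case (coord b)
  have "\<bar>x \<bullet> b\<bar> \<le> 1 + norm x" for x using Basis_le_norm[OF coord, of x] by linarith
  then show ?case by (intro exI[of _ 1] exI[of _ "1::nat"]) auto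
next
  case (add p q)
  then obtain C N D M where p: "C \<ge> 0" "\<And>x. cmod (p x) \<le> C * (1 + norm x) ^ N" and q: "D \<ge> 0" "\<And>x. cmod (q x) \<le> D * (1 + norm x) ^ M" by blast
  have "cmod (p x + q x) \<le> (C + D) * (1 + norm x) ^ (N + M)" for x
  proof -
    have "(1 + norm x) ^ N \<le> (1 + norm x) ^ (N + M)" "(1 + norm x) ^ M \<le> (1 + norm x) ^ (N + M)" by (auto intro!: power_increasing)
    then have "C * (1 + norm x) ^ N \<le> C * (1 + norm x) ^ (N + M)" "D * (1 + norm x) ^ M \<le> D * (1 + norm x) ^ (N + M)"
      using p(1) q(1) by (auto intro: mult_left_mono)
    then show ?thesis using p(2)[of x] q(2)[of x] norm_triangle_ineq[of "p x" "q x"] unfolding distrib_right by linarith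
  qed
  then show ?case using p q by (intro exI[of _ "C + D"] exI[of _ "N + M"]) auto
next
  case (mult p q)
  then obtain C N D M where p: "C \<ge> 0" "\<And>x. cmod (p x) \<le> C * (1 + norm x) ^ N" and q: "D \<ge> 0" "\<And>x. cmod (q x) \<le> D * (1 + norm x) ^ M" by blast
  have "cmod (p x * q x) \<le> (C * D) * (1 + norm x) ^ (N + M)" for x
  proof -
    have "cmod (p x * q x) \<le> (C * (1 + norm x) ^ N) * (D * (1 + norm x) ^ M)"
      unfolding norm_mult using p q by (intro mult_mono) auto
    then show ?thesis by (simp add: power_add mult_ac)
  qed
  then show ?case using p q by (intro exI[of _ "C * D"] exI[of _ "N + M"]) auto
qed

lemma gaussmod_has_derivative:
  fixes x \<xi> :: "'a::euclidean_space"
  shows "(gaussmod x e has_derivative (\<lambda>v. gaussmod x e \<xi> * (\<i> * complex_of_real (x \<bullet> v) - complex_of_real (e\<^sup>2 * (\<xi> \<bullet> v))))) (at \<xi>)"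
proof -
  define L where "L = (\<lambda>\<xi>. \<i> * complex_of_real (x \<bullet> \<xi>) + complex_of_real (- (e\<^sup>2 * (\<xi> \<bullet> \<xi>)) / 2))"
  have g: "gaussmod x e = (\<lambda>\<xi>. exp (L \<xi>))"
  proof
    fix \<xi> :: 'a
    have "complex_of_real (gauss e \<xi>) = exp (complex_of_real (- (e\<^sup>2 * (\<xi> \<bullet> \<xi>)) / 2))"
      by (simp only: gauss_def power2_norm_eq_inner exp_of_real)
    then show "gaussmod x e \<xi> = exp (L \<xi>)" unfolding gaussmod_def L_def exp_add by (simp only: mult.commute)
  qed
  have "(L has_derivative (\<lambda>v. \<i> * complex_of_real (x \<bullet> v) + complex_of_real (- (e\<^sup>2 * (\<xi> \<bullet> v + v \<bullet> \<xi>)) / 2))) (at \<xi>)"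
    unfolding L_def by (auto intro!: derivative_eq_intros simp: fun_eq_iff inner_commute field_simps)
  from has_derivative_compose[OF this DERIV_exp[unfolded has_field_derivative_def]] show ?thesis
    unfolding g by (simp add: inner_commute)
qed

lemma gaussmod_schwartz:
  fixes x :: "'a::euclidean_space"
  assumes e: "e > 0"
  shows "schwartz (gaussmod x e)"
proof -
  have D: "\<exists>h'. (\<forall>\<xi>. ((\<lambda>\<xi>. p \<xi> * gaussmod x e \<xi>) has_derivative h' \<xi>) (at \<xi>)) \<and>
     (\<forall>b\<in>Basis. \<exists>r\<in>gpoly. (\<lambda>\<xi>. h' \<xi> b) = (\<lambda>\<xi>. r \<xi> * gaussmod x e \<xi>))" if p: "p \<in> gpoly" for p
  proof -
    obtain p' where p': "\<And>x. (p has_derivative p' x) (at x)" "\<And>b. b\<in>Basis \<Longrightarrow> (\<lambda>x. p' x b) \<in> gpoly"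
      using gpoly_derivative[OF p] by blast
    define h' where "h' = (\<lambda>\<xi> v. p \<xi> * (gaussmod x e \<xi> * (\<i> * complex_of_real (x \<bullet> v) - complex_of_real (e\<^sup>2 * (\<xi> \<bullet> v)))) + p' \<xi> v * gaussmod x e \<xi>)"
    have "((\<lambda>\<xi>. p \<xi> * gaussmod x e \<xi>) has_derivative h' \<xi>) (at \<xi>)" for \<xi>
      unfolding h'_def by (intro has_derivative_mult p' gaussmod_has_derivative)
    moreover have "\<exists>r\<in>gpoly. (\<lambda>\<xi>. h' \<xi> b) = (\<lambda>\<xi>. r \<xi> * gaussmod x e \<xi>)" if b: "b \<in> Basis" for b
    proof
      show "(\<lambda>\<xi>. p \<xi> * (\<i> * complex_of_real (x \<bullet> b) + complex_of_real (- e\<^sup>2) * complex_of_real (\<xi> \<bullet> b)) + p' \<xi> b) \<in> gpoly"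
        by (intro gpoly.add gpoly.mult p p' b gpoly.const gpoly.coord)
      show "(\<lambda>\<xi>. h' \<xi> b) = (\<lambda>\<xi>. (p \<xi> * (\<i> * complex_of_real (x \<bullet> b) + complex_of_real (- e\<^sup>2) * complex_of_real (\<xi> \<bullet> b)) + p' \<xi> b) * gaussmod x e \<xi>)"
        by (simp add: h'_def algebra_simps)
    qed
    ultimately show ?thesis by blast
  qed
  have rep: "h \<in> pderivs (gaussmod x e) \<Longrightarrow> \<exists>p\<in>gpoly. h = (\<lambda>\<xi>. p \<xi> * gaussmod x e \<xi>)" for h
  proof (induction rule: pderivs.induct)
    case self
    show ?case by (rule bexI[OF _ gpoly.const[of 1]]) simp
  next
    case (step h b)
    then obtain p where p: "p \<in> gpoly" "h = (\<lambda>\<xi>. p \<xi> * gaussmod x e \<xi>)" by blast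
    obtain h' where h': "\<And>\<xi>. (h has_derivative h' \<xi>) (at \<xi>)" "\<exists>r\<in>gpoly. (\<lambda>\<xi>. h' \<xi> b) = (\<lambda>\<xi>. r \<xi> * gaussmod x e \<xi>)"
      using D[OF p(1)] step.hyps unfolding p(2) by blast
    have "(\<lambda>\<xi>. frechet_derivative h (at \<xi>) b) = (\<lambda>\<xi>. h' \<xi> b)"
      using frechet_derivative_at[OF h'(1)] by simp
    then show ?case using h'(2) by simp
  qed
  show ?thesis
    unfolding schwartz_def
  proof (intro ballI conjI allI)
    fix h assume "h \<in> pderivs (gaussmod x e)"
    then obtain p where p: "p \<in> gpoly" "h = (\<lambda>\<xi>. p \<xi> * gaussmod x e \<xi>)" using rep by blast
    show "h differentiable (at \<xi>)" for \<xi> using D[OF p(1)] unfolding p(2) differentiable_def by blast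
    fix N :: nat
    obtain C M where C: "C \<ge> 0" "\<And>\<xi>. cmod (p \<xi>) \<le> C * (1 + norm \<xi>) ^ M" using gpoly_growth[OF p(1)] by blast
    have "(1 + norm \<xi>) ^ N * cmod (h \<xi>) \<le> C * exp ((real (N + M))\<^sup>2 / (2 * e\<^sup>2))" for \<xi>
    proof -
      have "(1 + norm \<xi>) ^ N * cmod (h \<xi>) \<le> (1 + norm \<xi>) ^ N * (C * (1 + norm \<xi>) ^ M * gauss e \<xi>)"
        unfolding p(2) norm_mult cmod_gaussmod using C(2)[of \<xi>] gauss_pos[of e \<xi>] by (intro mult_left_mono mult_right_mono) auto
      also have "\<dots> = C * ((1 + norm \<xi>) ^ (N + M) * gauss e \<xi>)" by (simp add: power_add mult_ac)
      also have "\<dots> \<le> C * exp ((real (N + M))\<^sup>2 / (2 * e\<^sup>2))" by (intro mult_left_mono gauss_decay e C)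
      finally show ?thesis .
    qed
    then show "\<exists>C. \<forall>\<xi>. (1 + norm \<xi>) ^ N * cmod (h \<xi>) \<le> C" by blast
  qed
qed

text \<open>\<open>g\<close> and \<open>h\<close> are only known to be integrable against Schwartz
  functions. Their difference times a Gaussian is integrable, its transform at \<open>\<xi>\<close>
  is the pairing with the Schwartz function \<open>gaussmod (- \<xi>) 1\<close>, hence zero, and the
  Gaussian has no zeros.\<close>

lemma has_dist_FT_unique:
  fixes f :: "'a::euclidean_space \<Rightarrow> complex"
  assumes "has_dist_FT f g" "has_dist_FT f h"
  shows "AE x in lborel. g x = h x"
proof -
  define u where "u = (\<lambda>x. (g x - h x) * complex_of_real (gauss 1 x))"
  have i: "integrable lborel (\<lambda>x. g x * \<gamma> x)" "integrable lborel (\<lambda>x. h x * \<gamma> x)"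
    "(\<integral>x. g x * \<gamma> x \<partial>lborel) = (\<integral>x. h x * \<gamma> x \<partial>lborel)" if "schwartz \<gamma>" for \<gamma>
    using assms that unfolding has_dist_FT_def by auto
  have gm: "gaussmod y 1 x = complex_of_real (gauss 1 x) * exp (\<i> * complex_of_real (y \<bullet> x))" for y x :: 'a
    by (simp add: gaussmod_def)
  have "integrable lborel u"
  proof -
    have "integrable lborel (\<lambda>x. g x * gaussmod 0 1 x - h x * gaussmod 0 1 x)"
      by (intro Bochner_Integration.integrable_diff i gaussmod_schwartz) auto
    then show ?thesis by (simp add: u_def gm left_diff_distrib)
  qed
  moreover have "FT u \<xi> = 0" for \<xi>
  proof -
    have s: "schwartz (gaussmod (- \<xi>) 1)" by (rule gaussmod_schwartz) simp
    have "u y * exp (- (\<i> * complex_of_real (\<xi> \<bullet> y))) = g y * gaussmod (- \<xi>) 1 y - h y * gaussmod (- \<xi>) 1 y" for y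
      by (simp add: u_def gm algebra_simps)
    then show ?thesis unfolding FT_eq using i[OF s] by simp
  qed
  ultimately have "AE x in lborel. u x = 0" by (rule FT_eq_0_imp_AE_eq_0)
  then show ?thesis
  proof eventually_elim
    case (elim x)
    then show ?case using gauss_pos[of 1 x] by (simp add: u_def)
  qed
qed

text \<open>The only access to the choice in \<open>dFT\<close>: it is some transform of
  \<open>f\<close>, and uniqueness ties it to any known one almost everywhere.\<close>

lemma dFT_AE:
  assumes "has_dist_FT f g"
  shows "has_dist_FT f (dFT f)" "AE x in lborel. dFT f x = g x"
proof -
  show 1: "has_dist_FT f (dFT f)" unfolding dFT_def by (rule someI[of _ g]) (rule assms)
  show "AE x in lborel. dFT f x = g x" by (rule has_dist_FT_unique[OF 1 assms])
qed

lemma slowly_increasing_bound: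
  fixes f :: "'a::euclidean_space \<Rightarrow> complex"
  assumes "slowly_increasing f" "continuous_on UNIV f"
  obtains C m where "\<And>x. cmod (f x) \<le> C * (1 + norm x) ^ m"
proof -
  obtain m C R where R: "\<And>x. norm x \<ge> R \<Longrightarrow> cmod (f x) \<le> C * norm x ^ m"
    using assms(1) unfolding slowly_increasing_def by blast
  have "compact (f ` cball 0 R)" using assms(2) by (intro compact_continuous_image) (auto intro: continuous_on_subset)
  then obtain D where "\<And>y. y \<in> f ` cball 0 R \<Longrightarrow> cmod y \<le> D"
    using compact_imp_bounded[of "f ` cball 0 R"] unfolding bounded_iff by blast
  then have D: "\<And>x. norm x \<le> R \<Longrightarrow> cmod (f x) \<le> D" by simp
  define E where "E = max \<bar>C\<bar> \<bar>D\<bar>"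
  have "cmod (f x) \<le> E * (1 + norm x) ^ m" for x
  proof (cases "norm x \<le> R")
    case True
    have "cmod (f x) \<le> E * 1" using D[OF True] by (simp add: E_def)
    also have "\<dots> \<le> E * (1 + norm x) ^ m" by (intro mult_left_mono one_le_power) (auto simp: E_def)
    finally show ?thesis .
  next
    case False
    have "cmod (f x) \<le> C * norm x ^ m" using R False by simp
    also have "\<dots> \<le> E * (1 + norm x) ^ m" by (intro mult_mono power_mono) (auto simp: E_def)
    finally show ?thesis .
  qed
  then show ?thesis using that by blast
qed

text \<open>Modulated Gaussians are Schwartz functions, so the distributional identity contains the
  hypothesis of \<open>Fourier_inversion\<close>.\<close>

lemma has_dist_FT_imp_invFT:
  fixes f :: "'a::euclidean_space \<Rightarrow> complex"
  assumes f: "continuous_on UNIV f" "slowly_increasing f" and d: "has_dist_FT f g" and g: "integrable lborel g"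
  shows "f = invFT g"
proof
  fix x
  obtain C m where C: "\<And>x. cmod (f x) \<le> C * (1 + norm x) ^ m" using slowly_increasing_bound[OF f(2,1)] by blast
  show "f x = invFT g x"
    by (rule Fourier_inversion[OF f(1) C g]) (use d gaussmod_schwartz in \<open>auto simp: has_dist_FT_def\<close>)
qed

lemma invFT_bound: "cmod (invFT g (x::'a::euclidean_space)) \<le> FTc TYPE('a) * (\<integral>y. cmod (g y) \<partial>lborel)"
  unfolding invFT_eq_FT by (rule FT_bound)

lemma invFT_slowly_increasing: "slowly_increasing (invFT (g :: 'a::euclidean_space \<Rightarrow> complex))"
  unfolding slowly_increasing_def using invFT_bound[of g]
  by (intro exI[of _ 0] exI[of _ "FTc TYPE('a) * (\<integral>y. cmod (g y) \<partial>lborel)"]) auto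

lemma FT_continuous:
  fixes g :: "'a::euclidean_space \<Rightarrow> complex"
  assumes g: "integrable lborel g"
  shows "continuous_on UNIV (FT g)"
  unfolding continuous_on_sequentially o_def
proof (intro ballI allI impI, elim conjE)
  fix \<xi> :: 'a and X assume X: "X \<longlonglongrightarrow> \<xi>"
  have [measurable]: "g \<in> borel_measurable borel" using g by auto
  show "(\<lambda>n. FT g (X n)) \<longlonglongrightarrow> FT g \<xi>"
    unfolding FT_eq
  proof (intro tendsto_mult_left, rule integral_dominated_convergence[OF _ _ integrable_norm[OF g]])
    show "AE y in lborel. (\<lambda>n. g y * exp (- (\<i> * complex_of_real (X n \<bullet> y)))) \<longlonglongrightarrow> g y * exp (- (\<i> * complex_of_real (\<xi> \<bullet> y)))"
      by (intro AE_I2 tendsto_intros X)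
    show "AE y in lborel. norm (g y * exp (- (\<i> * complex_of_real (X n \<bullet> y)))) \<le> norm (g y)" for n by simp
  qed measurable
qed

lemma invFT_continuous:
  fixes g :: "'a::euclidean_space \<Rightarrow> complex"
  assumes g: "integrable lborel g"
  shows "continuous_on UNIV (invFT g)"
  unfolding invFT_eq_FT[abs_def] by (intro continuous_on_compose2[OF FT_continuous[OF g]] continuous_intros) auto

section \<open>Positive definite functions\<close>

lemma sum_list_eq_sum_count:
  fixes f :: "'a \<Rightarrow> complex"
  assumes "finite X"
  shows "set xs \<subseteq> X \<Longrightarrow> (\<Sum>x\<leftarrow>xs. f x) = (\<Sum>x\<in>X. of_nat (count_list xs x) * f x)"
proof (induction xs)
  case (Cons a xs)
  have "(\<Sum>x\<in>X. of_nat (count_list (a # xs) x) * f x) = (\<Sum>x\<in>X. of_nat (count_list xs x) * f x + (if x = a then f a else 0))"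
    by (intro sum.cong) (auto simp: algebra_simps)
  also have "\<dots> = (\<Sum>x\<leftarrow>xs. f x) + f a"
    using Cons assms by (simp add: sum.distrib sum.delta)
  finally show ?case by simp
qed simp

lemma sum_list_pairs_eq_sum_count:
  fixes F :: "'a \<Rightarrow> 'a \<Rightarrow> complex"
  shows "(\<Sum>x\<leftarrow>xs. \<Sum>y\<leftarrow>xs. F x y) = (\<Sum>x\<in>set xs. \<Sum>y\<in>set xs. of_nat (count_list xs x) * of_nat (count_list xs y) * F x y)"
  by (simp add: sum_list_eq_sum_count[OF finite_set subset_refl] sum_distrib_left mult.assoc)

text \<open>\<open>positive_definite\<close> speaks of sets, hence of distinct points, while the
  averaging below adds points that may coincide. Repeated points are merged and their multiplicity
  goes into the coefficient.\<close>

lemma positive_definite_list: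
  fixes \<Phi> :: "'a::euclidean_space \<Rightarrow> complex"
  assumes pd: "positive_definite \<Phi>"
  shows "0 \<le> Re (\<Sum>x\<leftarrow>xs. \<Sum>y\<leftarrow>xs. c x * cnj (c y) * \<Phi> (x - y))"
proof -
  define d where "d = (\<lambda>x. of_nat (count_list xs x) * c x)"
  have eq: "(\<Sum>x\<leftarrow>xs. \<Sum>y\<leftarrow>xs. c x * cnj (c y) * \<Phi> (x - y)) = (\<Sum>x\<in>set xs. \<Sum>y\<in>set xs. d x * cnj (d y) * \<Phi> (x - y))"
    unfolding sum_list_pairs_eq_sum_count by (simp add: d_def mult_ac)
  show ?thesis
  proof (cases "\<exists>x\<in>set xs. d x \<noteq> 0")
    case True
    then have "0 < Re (\<Sum>x\<in>set xs. \<Sum>y\<in>set xs. d x * cnj (d y) * \<Phi> (x - y))"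
      using pd unfolding positive_definite_def Let_def by blast
    then show ?thesis unfolding eq by simp
  qed (auto simp: eq)
qed

text \<open>The points 0 and \<open>x\<close> with coefficients 1 and \<open>- u\<close>, where the
  phase \<open>u\<close> makes \<open>u * \<Phi> x\<close> equal to its modulus, give
  \<open>cmod (\<Phi> x) < Re (\<Phi> 0)\<close>. Only boundedness matters later.\<close>

lemma positive_definite_bound:
  fixes \<Phi> :: "'a::euclidean_space \<Rightarrow> complex"
  assumes pd: "positive_definite \<Phi>"
  shows "cmod (\<Phi> x) \<le> 2 * cmod (\<Phi> 0)"
proof (cases "x = 0 \<or> \<Phi> x = 0")
  case False
  have sym: "\<Phi> (- x) = cnj (\<Phi> x)" using pd unfolding positive_definite_def by (metis complex_cnj_cnj)
  define u where "u = cnj (\<Phi> x) / complex_of_real (cmod (\<Phi> x))"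
  have u: "u * cnj u = 1" "u * \<Phi> x = complex_of_real (cmod (\<Phi> x))"
    using False by (auto simp: u_def complex_norm_square[symmetric] power2_eq_square mult.commute[of "cnj _"])
  define c :: "'a \<Rightarrow> complex" where "c = (\<lambda>z. if z = 0 then 1 else - u)"
  have "0 < Re (\<Sum>a\<in>{0, x}. \<Sum>b\<in>{0, x}. c a * cnj (c b) * \<Phi> (a - b))"
  proof -
    have "finite {0, x} \<and> (\<exists>z\<in>{0, x}. c z \<noteq> 0)" by (auto simp: c_def)
    then show ?thesis using pd unfolding positive_definite_def Let_def by blast
  qed
  also have "(\<Sum>a\<in>{0, x}. \<Sum>b\<in>{0, x}. c a * cnj (c b) * \<Phi> (a - b)) = \<Phi> 0 + u * cnj u * \<Phi> 0 - (u * \<Phi> x + cnj (u * \<Phi> x))"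
    using False sym by (simp add: c_def)
  finally have "cmod (\<Phi> x) < Re (\<Phi> 0)" by (simp add: u)
  then show ?thesis using complex_Re_le_cmod[of "\<Phi> 0"] by (smt (verit) norm_ge_zero)
qed auto

text \<open>Integrating out \<open>m\<close> further points from the quadratic form at \<open>xs\<close> yields
  \<open>S(xs) + 2 m \<Sum> k(x) + m r(0) + m (m - 1) I\<close>; nonnegativity for all \<open>m\<close> forces \<open>I \<ge> 0\<close>.\<close>
lemma double_integral_nonneg:
  fixes r :: "'a::euclidean_space \<Rightarrow> real"
  assumes "prob_space M" and sets: "sets M = sets (borel :: 'a measure)" and [measurable]: "r \<in> borel_measurable borel"
    and K: "\<And>x. \<bar>r x\<bar> \<le> K" and even: "\<And>x. r (- x) = r x"
    and S: "\<And>xs. 0 \<le> (\<Sum>x\<leftarrow>xs. \<Sum>y\<leftarrow>xs. r (x - y))"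
  shows "0 \<le> (\<integral>x. \<integral>y. r (x - y) \<partial>M \<partial>M)"
proof -
  interpret prob_space M by fact
  note [measurable_cong] = sets
  define k where "k = (\<lambda>x. \<integral>y. r (x - y) \<partial>M)"
  define I where "I = (\<integral>x. k x \<partial>M)"
  have [measurable]: "k \<in> borel_measurable borel"
    unfolding k_def by measurable
  have ir: "integrable M (\<lambda>y. r (x - y))" for x by (rule integrable_const_bound[of _ K]) (use K in auto)
  have Kk: "\<bar>k x\<bar> \<le> K" for x
  proof -
    have "\<bar>k x\<bar> \<le> (\<integral>y. norm (r (x - y)) \<partial>M)"
      unfolding k_def using integral_norm_bound[of M "\<lambda>y. r (x - y)"] by (simp only: real_norm_def)
    also have "\<dots> \<le> (\<integral>y. K \<partial>M)" using K by (intro integral_mono integrable_norm ir) auto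
    finally show ?thesis by (simp add: prob_space)
  qed
  have ik: "integrable M k" by (rule integrable_const_bound[of _ K]) (use Kk in auto)
  have "0 \<le> (\<Sum>x\<leftarrow>xs. \<Sum>y\<leftarrow>xs. r (x - y)) + 2 * real m * (\<Sum>x\<leftarrow>xs. k x) + real m * r 0 + real m * (real m - 1) * I" for m xs
  proof (induction m arbitrary: xs)
    case 0
    show ?case using S by simp
  next
    case (Suc m)
    define A where "A = (\<Sum>x\<leftarrow>xs. \<Sum>y\<leftarrow>xs. r (x - y))"
    have isum: "integrable M (\<lambda>y. \<Sum>x\<leftarrow>xs. r (x - y))" and sumk: "(\<integral>y. (\<Sum>x\<leftarrow>xs. r (x - y)) \<partial>M) = (\<Sum>x\<leftarrow>xs. k x)"
      by (induction xs) (auto simp: ir k_def)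
    have swap: "(\<Sum>x\<leftarrow>xs. r (y - x)) = (\<Sum>x\<leftarrow>xs. r (x - y))" for y
      by (intro arg_cong[of _ _ sum_list] map_cong refl) (metis even minus_diff_eq)
    have "0 \<le> (r 0 + 2 * (\<Sum>x\<leftarrow>xs. r (x - y)) + A) + 2 * real m * (k y + (\<Sum>x\<leftarrow>xs. k x)) + real m * r 0 + real m * (real m - 1) * I" for y
      using Suc.IH[of "y # xs"] by (simp add: A_def swap sum_list_addf)
    then have "0 \<le> (\<integral>y. (r 0 + 2 * (\<Sum>x\<leftarrow>xs. r (x - y)) + A) + 2 * real m * (k y + (\<Sum>x\<leftarrow>xs. k x)) + real m * r 0 + real m * (real m - 1) * I \<partial>M)"
      by (intro Bochner_Integration.integral_nonneg) auto
    also have "\<dots> = (r 0 + 2 * (\<Sum>x\<leftarrow>xs. k x) + A) + 2 * real m * (I + (\<Sum>x\<leftarrow>xs. k x)) + real m * r 0 + real m * (real m - 1) * I"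
      using isum ik by (simp add: sumk prob_space I_def)
    also have "\<dots> = A + 2 * real (Suc m) * (\<Sum>x\<leftarrow>xs. k x) + real (Suc m) * r 0 + real (Suc m) * (real (Suc m) - 1) * I"
      by (simp add: algebra_simps)
    finally show ?case by (simp add: A_def)
  qed
  from this[of "[]"] have Q: "0 \<le> real m * r 0 + real m * (real m - 1) * I" for m by simp
  have "0 \<le> I"
  proof (rule ccontr)
    assume "\<not> 0 \<le> I"
    then have "I < 0" by simp
    then obtain n where n: "r 0 < real n * (- I)" using reals_Archimedean3[of "- I"] by auto
    have "0 \<le> real (Suc n) * (r 0 + real n * I)" using Q[of "Suc n"] by (simp add: algebra_simps)
    then have "0 \<le> r 0 + real n * I" by (simp only: zero_le_mult_iff) auto
    then show False using n by simp
  qed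
  then show ?thesis by (simp add: I_def k_def)
qed

text \<open>Completing the square: \<open>|y + z|^2 + |y|^2 = 2 |y + z/2|^2 + |z|^2 / 2\<close>.
  Integrated over \<open>y\<close> it says that the autocorrelation of the Gaussian with parameter
  \<open>sqrt 2 * t\<close> is a multiple of \<open>gauss t\<close>, which explains the
  \<open>sqrt 2\<close>.\<close>

lemma gauss_mult_gauss:
  "gauss (sqrt 2 * t) (y + z) * gauss (sqrt 2 * t) y = gauss t z * gauss (2 * t) (z /\<^sub>R 2 + y)"
proof -
  have "(norm (y + z))\<^sup>2 + (norm y)\<^sup>2 = 2 * (norm (z /\<^sub>R 2 + y))\<^sup>2 + (norm z)\<^sup>2 / 2"
    unfolding power2_norm_eq_inner by (simp add: inner_add_left inner_add_right inner_commute field_simps)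
  then have "- ((sqrt 2 * t)\<^sup>2 * (norm (y + z))\<^sup>2) / 2 + - ((sqrt 2 * t)\<^sup>2 * (norm y)\<^sup>2) / 2 =
      - (t\<^sup>2 * (norm z)\<^sup>2) / 2 + - ((2 * t)\<^sup>2 * (norm (z /\<^sub>R 2 + y))\<^sup>2) / 2"
    by (simp add: power_mult_distrib) algebra
  then show ?thesis unfolding gauss_def exp_add[symmetric] by simp
qed

text \<open>Take for \<open>M\<close> the normalised Gaussian with parameter
  \<open>sqrt 2 * t\<close>. Substituting the difference of the two points in the double integral
  leaves, by \<open>gauss_mult_gauss\<close>, a positive multiple of the Gaussian average of
  \<open>r\<close>.\<close>

lemma gauss_average_nonneg:
  fixes r :: "'a::euclidean_space \<Rightarrow> real"
  assumes [measurable]: "r \<in> borel_measurable borel"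
    and K: "\<And>x. \<bar>r x\<bar> \<le> K" and even: "\<And>x. r (- x) = r x"
    and S: "\<And>xs. 0 \<le> (\<Sum>x\<leftarrow>xs. \<Sum>y\<leftarrow>xs. r (x - y))" and t: "t > 0"
  shows "0 \<le> (\<integral>z. r z * gauss t z \<partial>lborel)"
proof -
  define e where "e = sqrt 2 * t"
  have e: "e > 0" using t by (simp add: e_def)
  have ig: "integrable lborel (gauss e :: 'a \<Rightarrow> real)" by (rule gauss_integrable[OF e])
  define Z where "Z = (\<integral>x. gauss e x \<partial>(lborel :: 'a measure))"
  have Zpos: "Z > 0"
  proof -
    have "Z \<noteq> 0"
    proof
      assume "Z = 0"
      then have "AE x in (lborel :: 'a measure). gauss e x = 0"
        using integral_nonneg_eq_0_iff_AE[OF ig AE_I2[OF less_imp_le[OF gauss_pos]]] by (simp add: Z_def)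
      then have "AE x in (lborel :: 'a measure). False" by eventually_elim (metis gauss_pos less_irrefl)
      then have "emeasure (lborel :: 'a measure) UNIV = 0" by (simp add: AE_iff_measurable[of UNIV lborel])
      then show False by simp
    qed
    moreover have "Z \<ge> 0" unfolding Z_def by (intro Bochner_Integration.integral_nonneg) (auto intro: less_imp_le gauss_pos)
    ultimately show ?thesis by simp
  qed
  define M where "M = density (lborel :: 'a measure) (\<lambda>x. ennreal (gauss e x / Z))"
  have pos: "gauss e x / Z \<ge> 0" for x :: 'a using gauss_pos[of e x] Zpos by simp
  interpret M: prob_space M
  proof
    have "emeasure M (space M) = (\<integral>\<^sup>+x. ennreal (gauss e x / Z) \<partial>(lborel :: 'a measure))"
      by (simp add: M_def emeasure_density)
    also have "\<dots> = ennreal (\<integral>x. gauss e x / Z \<partial>(lborel :: 'a measure))"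
      using ig pos by (intro nn_integral_eq_integral) auto
    also have "\<dots> = 1" using Zpos by (simp add: Z_def)
    finally show "emeasure M (space M) = 1" .
  qed
  define J where "J = (\<lambda>f :: 'a \<Rightarrow> real. \<integral>x. f x \<partial>lborel)"
  have M_int: "(\<integral>x. f x \<partial>M) = (\<integral>x. gauss e x * f x \<partial>lborel) / Z" if [measurable]: "f \<in> borel_measurable borel" for f :: "'a \<Rightarrow> real"
    unfolding M_def using pos by (subst integral_density) auto
  have "0 \<le> (\<integral>x. \<integral>y. r (x - y) \<partial>M \<partial>M)"
    by (rule double_integral_nonneg[OF M.prob_space_axioms _ _ K even S]) (auto simp: M_def)
  also have "(\<lambda>x. \<integral>y. r (x - y) \<partial>M) = (\<lambda>x. (\<integral>y. gauss e y * r (x - y) \<partial>lborel) / Z)"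
    by (intro ext M_int) measurable
  also have "(\<integral>x. (\<integral>y. gauss e y * r (x - y) \<partial>lborel) / Z \<partial>M) = (\<integral>x. gauss e x * ((\<integral>y. gauss e y * r (x - y) \<partial>lborel) / Z) \<partial>lborel) / Z"
    by (intro M_int) measurable
  also have "\<dots> = (\<integral>x. gauss e x * (\<integral>y. gauss e y * r (x - y) \<partial>lborel) \<partial>lborel) / (Z * Z)"
    by simp
  finally have "0 \<le> (\<integral>x. gauss e x * (\<integral>y. gauss e y * r (x - y) \<partial>lborel) \<partial>lborel) / (Z * Z)" .
  then have nn: "0 \<le> (\<integral>x. gauss e x * (\<integral>y. gauss e y * r (x - y) \<partial>lborel) \<partial>lborel)"
    using mult_pos_pos[OF Zpos Zpos] by (simp only: zero_le_divide_iff) linarith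
  have shift: "(\<integral>x. f (a + x) \<partial>lborel) = (\<integral>x. f x \<partial>lborel)" if "f \<in> borel_measurable borel" for f :: "'a \<Rightarrow> real" and a
  proof -
    have "complex_of_real (\<integral>x. f (a + x) \<partial>lborel) = complex_of_real (\<integral>x. f x \<partial>lborel)"
      using lborel_integral_affine[of "\<lambda>x. complex_of_real (f x)" 1 a] that by simp
    then show ?thesis by (simp only: of_real_eq_iff)
  qed
  have Fub: "integrable (lborel \<Otimes>\<^sub>M lborel) (\<lambda>(x, z). gauss e x * gauss e (x + z) * r z)"
  proof (rule Bochner_Integration.integrable_bound)
    show "integrable (lborel \<Otimes>\<^sub>M lborel) (\<lambda>(x, z). K * gauss e x * gauss e (x + z :: 'a))"
    proof (rule lborel_pair.Fubini_integrable)
      have "(\<integral>z. norm (K * gauss e x * gauss e (x + z)) \<partial>lborel) = \<bar>K\<bar> * gauss e x * Z" for x :: 'a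
        using shift[of "gauss e" x] by (simp add: abs_mult abs_of_pos[OF gauss_pos] Z_def)
      then show "integrable lborel (\<lambda>x::'a. \<integral>z. norm (case (x, z) of (x, z) \<Rightarrow> K * gauss e x * gauss e (x + z :: 'a)) \<partial>lborel)"
        using ig by simp
      have "integrable lborel (\<lambda>z. gauss e (x + z))" for x :: 'a
      proof -
        have "integrable lborel (\<lambda>z::'a. complex_of_real (gauss e (x + 1 *\<^sub>R z)))"
          by (rule lborel_integrable_affine[of "\<lambda>z. complex_of_real (gauss e z)"]) (use ig in auto)
        then show ?thesis by (simp only: complex_of_real_integrable_eq) simp
      qed
      then show "AE x::'a in lborel. integrable lborel (\<lambda>z. case (x, z) of (x, z) \<Rightarrow> K * gauss e x * gauss e (x + z :: 'a))"
        by simp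
    qed measurable
    show "AE p in lborel \<Otimes>\<^sub>M lborel. norm (case p of (x, z) \<Rightarrow> gauss e x * gauss e (x + z) * r z)
      \<le> norm (case p of (x, z) \<Rightarrow> K * gauss e x * gauss e (x + z :: 'a))"
    proof (intro AE_I2, clarify)
      fix x z :: 'a
      have "gauss e x * gauss e (x + z) * \<bar>r z\<bar> \<le> gauss e x * gauss e (x + z) * \<bar>K\<bar>"
        using order_trans[OF K abs_ge_self, of z] gauss_pos[of e x] gauss_pos[of e "x + z"] by (intro mult_left_mono) auto
      then show "norm (gauss e x * gauss e (x + z) * r z) \<le> norm (K * gauss e x * gauss e (x + z))"
        using gauss_pos[of e x] gauss_pos[of e "x + z"] by (simp add: abs_mult mult_ac)
    qed
  qed measurable
  have "(\<integral>y. gauss e y * r (x - y) \<partial>lborel) = (\<integral>z. gauss e (x + z) * r z \<partial>lborel)" for x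
    using shift[of "\<lambda>y. gauss e y * r (x - y)" x] by (simp add: even)
  then have "(\<integral>x. gauss e x * (\<integral>y. gauss e y * r (x - y) \<partial>lborel) \<partial>lborel) = (\<integral>x. \<integral>z. gauss e x * gauss e (x + z) * r z \<partial>lborel \<partial>lborel)"
    by (simp add: mult.assoc)
  also have "\<dots> = (\<integral>z. \<integral>x. gauss e x * gauss e (x + z) * r z \<partial>lborel \<partial>lborel)"
    using lborel_pair.Fubini_integral[OF Fub] by simp
  also have "\<dots> = (\<integral>z. (r z * gauss t z) * (\<integral>x. gauss (2 * t) x \<partial>(lborel :: 'a measure)) \<partial>lborel)"
  proof (intro Bochner_Integration.integral_cong refl)
    fix z :: 'a
    have "(\<integral>x. gauss e x * gauss e (x + z) * r z \<partial>lborel) = (\<integral>x. (r z * gauss t z) * gauss (2 * t) (z /\<^sub>R 2 + x) \<partial>lborel)"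
      using gauss_mult_gauss[of t _ z] unfolding e_def by (intro Bochner_Integration.integral_cong) (auto simp: mult_ac)
    also have "\<dots> = (r z * gauss t z) * (\<integral>x. gauss (2 * t) x \<partial>(lborel :: 'a measure))"
      using shift[of "gauss (2 * t)" "z /\<^sub>R 2"] by simp
    finally show "(\<integral>x. gauss e x * gauss e (x + z) * r z \<partial>lborel) = (r z * gauss t z) * (\<integral>x. gauss (2 * t) x \<partial>(lborel :: 'a measure))" .
  qed
  also have "\<dots> = (\<integral>z. r z * gauss t z \<partial>lborel) * (\<integral>x. gauss (2 * t) x \<partial>(lborel :: 'a measure))" by simp
  finally have "0 \<le> (\<integral>z. r z * gauss t z \<partial>lborel) * (\<integral>x. gauss (2 * t) x \<partial>(lborel :: 'a measure))" using nn by simp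
  moreover have "(\<integral>x. gauss (2 * t) x \<partial>(lborel :: 'a measure)) > 0"
  proof -
    have "complex_of_real (\<integral>x. gauss (2 * t) x \<partial>(lborel :: 'a measure)) = complex_of_real ((2 * pi) powr (DIM('a) / 2) / (2 * t) ^ DIM('a) * gauss (1 / (2 * t)) (0 :: 'a))"
      using gaussmod_integral[of "2 * t" "0 :: 'a"] t by (simp add: gaussmod_def)
    then show ?thesis unfolding of_real_eq_iff using t by (simp add: gauss_pos)
  qed
  ultimately show ?thesis by (simp add: zero_le_mult_iff)
qed

section \<open>The transform of a positive definite function\<close>

locale pd_function =
  fixes \<Phi> :: "'a::euclidean_space \<Rightarrow> complex"
  assumes integrable: "integrable lborel \<Phi>" and cont: "continuous_on UNIV \<Phi>" and pd: "positive_definite \<Phi>"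
begin

lemma sym: "\<Phi> (- x) = cnj (\<Phi> x)"
  using pd unfolding positive_definite_def by (metis complex_cnj_cnj)

lemma measurable [measurable]: "\<Phi> \<in> borel_measurable borel"
  by (rule borel_measurable_continuous_onI[OF cont])

lemma FT_real: "FT \<Phi> \<xi> = complex_of_real (PhiH \<Phi> \<xi>)"
proof -
  have "cnj (FT \<Phi> \<xi>) = complex_of_real (FTc TYPE('a)) * (\<integral>y. \<Phi> (- y) * exp (- (\<i> * complex_of_real (\<xi> \<bullet> (- y)))) \<partial>lborel)"
  proof -
    have e: "cnj (\<Phi> y * exp (- (\<i> * complex_of_real (\<xi> \<bullet> y)))) = \<Phi> (- y) * exp (- (\<i> * complex_of_real (\<xi> \<bullet> (- y))))" for y
      by (simp add: exp_cnj sym)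
    show ?thesis unfolding FT_eq complex_cnj_mult[of "complex_of_real _"] complex_cnj_complex_of_real
      using Bochner_Integration.integral_cnj[of lborel "\<lambda>y. \<Phi> y * exp (- (\<i> * complex_of_real (\<xi> \<bullet> y)))"] unfolding e by simp
  qed
  also have "\<dots> = FT \<Phi> \<xi>"
    unfolding FT_eq using lborel_integral_reflect[of "\<lambda>y. \<Phi> y * exp (- (\<i> * complex_of_real (\<xi> \<bullet> y)))"] by simp
  finally show ?thesis unfolding PhiH_def by (metis complex_eq_iff complex_cnj(1) Im_complex_of_real Re_complex_of_real complex_cnj_cancel_iff cnj.simps(2) neg_equal_zero)
qed

text \<open>The exponentials can be absorbed into the coefficients, so \<open>r\<close>, the real
  part of \<open>\<Phi>\<close> times a character, inherits nonnegative quadratic forms. Its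
  Gaussian averages are nonnegative and tend to a positive multiple of
  \<open>PhiH \<Phi> \<xi>\<close>.\<close>

lemma PhiH_nonneg: "0 \<le> PhiH \<Phi> \<xi>"
proof -
  define r where "r = (\<lambda>z. Re (\<Phi> z * exp (- (\<i> * complex_of_real (\<xi> \<bullet> z)))))"
  have [measurable]: "r \<in> borel_measurable borel" unfolding r_def by measurable
  have K: "\<bar>r x\<bar> \<le> 2 * cmod (\<Phi> 0)" for x
    using abs_Re_le_cmod[of "\<Phi> x * exp (- (\<i> * complex_of_real (\<xi> \<bullet> x)))"] positive_definite_bound[OF pd, of x] unfolding r_def by simp
  have even: "r (- x) = r x" for x
  proof -
    have "\<Phi> (- x) * exp (- (\<i> * complex_of_real (\<xi> \<bullet> (- x)))) = cnj (\<Phi> x * exp (- (\<i> * complex_of_real (\<xi> \<bullet> x))))"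
      by (simp add: sym exp_cnj)
    then show ?thesis unfolding r_def by (metis complex_cnj(1) cnj.simps(1))
  qed
  have S: "0 \<le> (\<Sum>x\<leftarrow>xs. \<Sum>y\<leftarrow>xs. r (x - y))" for xs
  proof -
    define c where "c = (\<lambda>x. exp (- (\<i> * complex_of_real (\<xi> \<bullet> x))))"
    have eq: "c x * cnj (c y) * \<Phi> (x - y) = \<Phi> (x - y) * exp (- (\<i> * complex_of_real (\<xi> \<bullet> (x - y))))" for x y
      by (simp add: c_def exp_cnj exp_add[symmetric] inner_diff_right algebra_simps)
    have "r (x - y) = Re (c x * cnj (c y) * \<Phi> (x - y))" for x y unfolding eq r_def by (rule refl)
    moreover have "Re (sum_list (map f ys)) = (\<Sum>y\<leftarrow>ys. Re (f y))" for f :: "'a \<Rightarrow> complex" and ys by (induction ys) auto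
    ultimately show ?thesis using positive_definite_list[OF pd, of c xs] by simp
  qed
  have "0 \<le> Re (\<integral>z. \<Phi> z * gaussmod (- \<xi>) (inverse (real (Suc n))) z \<partial>lborel)" for n
  proof -
    define e where "e = inverse (real (Suc n))"
    have e: "e > 0" by (simp add: e_def)
    have i: "integrable lborel (\<lambda>z. \<Phi> z * gaussmod (- \<xi>) e z)"
    proof (rule Bochner_Integration.integrable_bound[OF integrable])
      show "AE z in lborel. norm (\<Phi> z * gaussmod (- \<xi>) e z) \<le> norm (\<Phi> z)"
        by (rule AE_I2) (simp add: norm_mult cmod_gaussmod mult_left_le gauss_le_1)
    qed measurable
    have "Re (\<Phi> z * gaussmod (- \<xi>) e z) = r z * gauss e z" for z
    proof -
      have "\<Phi> z * gaussmod (- \<xi>) e z = complex_of_real (gauss e z) * (\<Phi> z * exp (- (\<i> * complex_of_real (\<xi> \<bullet> z))))"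
        by (simp add: gaussmod_def)
      then show ?thesis unfolding r_def by (simp only: Re_complex_of_real Im_complex_of_real times_complex.sel) simp
    qed
    then have "Re (\<integral>z. \<Phi> z * gaussmod (- \<xi>) e z \<partial>lborel) = (\<integral>z. r z * gauss e z \<partial>lborel)"
      using integral_Re[OF i] by simp
    then show ?thesis using gauss_average_nonneg[OF _ K even S e] by (simp add: e_def)
  qed
  moreover have "(\<lambda>n. Re (\<integral>z. \<Phi> z * gaussmod (- \<xi>) (inverse (real (Suc n))) z \<partial>lborel)) \<longlonglongrightarrow> Re (\<integral>z. \<Phi> z * exp (\<i> * complex_of_real ((- \<xi>) \<bullet> z)) \<partial>lborel)"
    by (intro tendsto_Re integral_gaussmod_tendsto integrable)
  ultimately have "0 \<le> Re (\<integral>z. \<Phi> z * exp (\<i> * complex_of_real ((- \<xi>) \<bullet> z)) \<partial>lborel)"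
    by (intro LIMSEQ_le_const) auto
  then show ?thesis unfolding PhiH_def FT_eq using FTc_pos[where 'a='a] by simp
qed

lemma PhiH_measurable [measurable]: "PhiH \<Phi> \<in> borel_measurable borel"
  using FT_measurable[of \<Phi>] unfolding PhiH_def[abs_def] by measurable

lemma PhiH_bounded: "\<exists>C>0. \<forall>\<xi>. PhiH \<Phi> \<xi> \<le> C"
proof -
  define C where "C = FTc TYPE('a) * (\<integral>y. cmod (\<Phi> y) \<partial>lborel)"
  have "PhiH \<Phi> \<xi> \<le> max C 1" for \<xi>
    using FT_bound[of \<Phi> \<xi>] complex_Re_le_cmod[of "FT \<Phi> \<xi>"] unfolding C_def PhiH_def by linarith
  then show ?thesis by (intro exI[of _ "max C 1"]) auto
qed

text \<open>\<open>PhiH \<Phi>\<close> is bounded, so a larger power is at most a constant times a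
  smaller one; integrability with the least exponent yields all the others.\<close>

lemma PhiH_powr_integrable:
  assumes i: "integrable lborel (\<lambda>x. PhiH \<Phi> x powr a)" and ab: "a \<le> b"
  shows "integrable lborel (\<lambda>x. PhiH \<Phi> x powr b)"
proof -
  obtain C where C: "C > 0" "\<And>\<xi>. PhiH \<Phi> \<xi> \<le> C" using PhiH_bounded by blast
  show ?thesis
  proof (rule Bochner_Integration.integrable_bound)
    show "integrable lborel (\<lambda>x. C powr (b - a) * PhiH \<Phi> x powr a)" using i by simp
    show "AE x in lborel. norm (PhiH \<Phi> x powr b) \<le> norm (C powr (b - a) * PhiH \<Phi> x powr a)"
    proof (rule AE_I2)
      fix x
      have "PhiH \<Phi> x powr b = PhiH \<Phi> x powr (b - a) * PhiH \<Phi> x powr a" by (simp add: powr_add[symmetric])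
      also have "\<dots> \<le> C powr (b - a) * PhiH \<Phi> x powr a"
        using PhiH_nonneg[of x] C(2)[of x] ab by (intro mult_right_mono powr_mono2) auto
      finally show "norm (PhiH \<Phi> x powr b) \<le> norm (C powr (b - a) * PhiH \<Phi> x powr a)" by simp
    qed
  qed measurable
qed

lemma PhiH_inversion:
  assumes i: "integrable lborel (PhiH \<Phi>)"
  shows "\<Phi> x = invFT (\<lambda>\<xi>. complex_of_real (PhiH \<Phi> \<xi>)) x"
proof (rule Fourier_inversion[OF cont])
  show "cmod (\<Phi> x) \<le> (2 * cmod (\<Phi> 0)) * (1 + norm x) ^ 0" for x using positive_definite_bound[OF pd, of x] by simp
  show "integrable lborel (\<lambda>\<xi>. complex_of_real (PhiH \<Phi> \<xi>))" using i by simp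
  show "(\<integral>y. \<Phi> y * FT (gaussmod x e) y \<partial>lborel) = (\<integral>\<xi>. complex_of_real (PhiH \<Phi> \<xi>) * gaussmod x e \<xi> \<partial>lborel)" if "e > 0" for e
    using FT_multiplication[OF integrable gaussmod_integrable[OF that]] by (simp add: FT_real)
qed

end

section \<open>The native spaces\<close>

text \<open>\<open>Bsp r\<close> weighs transforms with the exponent \<open>r / (r - 1) = s\<close>
  and is therefore modelled on \<open>L^s\<close>. \<open>P_s\<close> and \<open>P_r\<close> place
  the kernel functions in \<open>Lspace s wm\<close> and \<open>Lspace r wm\<close>;
  \<open>P_1\<close> permits inversion of \<open>\<Phi>\<close>.\<close>

locale native_pair = pd_function +
  fixes s r :: real
  assumes s: "1 < s" and r: "r = s / (s - 1)"
    and P_s: "integrable lborel (\<lambda>x. PhiH \<Phi> x powr (s - 1))"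
    and P_r: "integrable lborel (\<lambda>x. PhiH \<Phi> x powr (r - 1))"
    and P_1: "integrable lborel (PhiH \<Phi>)"
begin

abbreviation "P \<equiv> PhiH \<Phi>"
definition c :: real where "c = FTc TYPE('a)"

text \<open>Where \<open>P = 0\<close> the density is \<open>c / 0 = 0\<close>, so \<open>wm\<close> lives on \<open>{P \<noteq> 0}\<close>.\<close>
definition wm :: "'a measure" where "wm = density (lborel :: 'a measure) (\<lambda>x. ennreal (c / P x))"
text \<open>Lebesgue measure sees \<open>{P = 0}\<close> although \<open>wm\<close> does not. Among
  functions that agree for \<open>wm\<close> this picks the version that vanishes there, as a finite
  \<open>wint\<close> demands almost everywhere.\<close>

definition cutoff :: "('a \<Rightarrow> complex) \<Rightarrow> 'a \<Rightarrow> complex" where "cutoff u = (\<lambda>x. if P x = 0 then 0 else u x)"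
definition T :: "('a \<Rightarrow> complex) \<Rightarrow> 'a \<Rightarrow> complex" where "T u = invFT (cutoff u)"
text \<open>The transform of the translate of \<open>\<Phi>\<close> by \<open>y\<close>; see
  \<open>T_k\<close>.\<close>

definition k :: "'a \<Rightarrow> 'a \<Rightarrow> complex" where "k y = (\<lambda>x. complex_of_real (P x) * exp (- (\<i> * complex_of_real (y \<bullet> x))))"

lemma r1: "1 < r" and s_r: "s = r / (r - 1)"
  using s by (auto simp: r field_simps)

lemma c_pos: "c > 0" by (simp add: c_def FTc_pos)

lemma dens_nonneg: "c / P x \<ge> 0" using c_pos PhiH_nonneg by (simp add: less_imp_le)

lemma dens_powr_nonneg: "0 \<le> (c / P x) *\<^sub>R (cmod z powr a)"
  using mult_nonneg_nonneg[OF dens_nonneg powr_ge_zero] by (simp only: real_scaleR_def)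

lemma wm_sets [measurable_cong, simp]: "sets wm = sets borel" by (simp add: wm_def)

lemma wm_measurable [simp]: "f \<in> borel_measurable wm \<longleftrightarrow> f \<in> borel_measurable borel"
  by (simp add: wm_def)

lemma cutoff_measurable [measurable]: "u \<in> borel_measurable borel \<Longrightarrow> cutoff u \<in> borel_measurable borel"
proof -
  assume [measurable]: "u \<in> borel_measurable borel"
  have "P -` {0} \<inter> space borel \<in> sets borel" by (rule measurable_sets[OF PhiH_measurable]) simp
  then have "{x \<in> space borel. P x = 0} \<in> sets borel" by (simp add: vimage_def)
  then show ?thesis unfolding cutoff_def by (intro measurable_If) auto
qed

lemma wm_integrable:
  fixes f :: "'a \<Rightarrow> 'b::{banach, second_countable_topology}"
  assumes "f \<in> borel_measurable borel"
  shows "integrable wm f \<longleftrightarrow> integrable lborel (\<lambda>x. (c / P x) *\<^sub>R f x)"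
  unfolding wm_def using assms dens_nonneg by (intro integrable_density) auto

lemma wm_integral:
  fixes f :: "'a \<Rightarrow> 'b::{banach, second_countable_topology}"
  assumes "f \<in> borel_measurable borel"
  shows "(\<integral>x. f x \<partial>wm) = (\<integral>x. (c / P x) *\<^sub>R f x \<partial>lborel)"
  unfolding wm_def using assms dens_nonneg by (intro integral_density) auto

text \<open>In modulus \<open>k y\<close> is \<open>P\<close>, and the density of \<open>wm\<close>
  takes away one power, which leaves the exponent \<open>a - 1\<close>.\<close>

lemma k_Lspace_powr:
  assumes "integrable lborel (\<lambda>x. P x powr (a - 1))"
  shows "k y \<in> Lspace a wm"
proof -
  have [measurable]: "k y \<in> borel_measurable borel" unfolding k_def by measurable
  have "(c / P x) * cmod (k y x) powr a = c * P x powr (a - 1)" for x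
    using PhiH_nonneg[of x] by (cases "P x = 0") (auto simp: k_def norm_mult powr_diff)
  then have "integrable lborel (\<lambda>x. (c / P x) *\<^sub>R (cmod (k y x) powr a))" using assms by simp
  then show ?thesis unfolding Lspace_def by (auto simp: wm_integrable)
qed

lemmas k_Lspace = k_Lspace_powr[OF P_s] and k_Lspace' = k_Lspace_powr[OF P_r]

text \<open>The factor \<open>P\<close> in \<open>k y\<close> cancels the density of
  \<open>wm\<close> off \<open>{P = 0}\<close>, and \<open>cutoff\<close> matches the integrands on
  that set. Evaluation at \<open>y\<close> is thus the pairing with \<open>k y\<close>, the
  reproducing property in the model space.\<close>

lemma T_eq:
  assumes u: "u \<in> Lspace s wm"
  shows "T u y = (\<integral>x. u x * cnj (k y x) \<partial>wm)"
proof -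
  have [measurable]: "u \<in> borel_measurable borel" using u by (simp add: Lspace_def)
  have [measurable]: "k y \<in> borel_measurable borel" unfolding k_def by measurable
  have "(c / P x) *\<^sub>R (u x * cnj (k y x)) = complex_of_real c * (cutoff u x * exp (\<i> * complex_of_real (y \<bullet> x)))" for x
    by (simp add: cutoff_def k_def exp_cnj scaleR_conv_of_real)
  then show ?thesis unfolding T_def invFT_def by (subst wm_integral) (simp_all add: c_def)
qed

text \<open>\<open>k 0\<close> is \<open>P\<close> itself, so this is Hoelder's inequality against
  \<open>P\<close> as an element of \<open>Lspace r wm\<close>.\<close>

lemma cutoff_integrable:
  assumes u: "u \<in> Lspace s wm"
  shows "integrable lborel (cutoff u)"
proof -
  have [measurable]: "u \<in> borel_measurable borel" using u by (simp add: Lspace_def)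
  have [measurable]: "k y \<in> borel_measurable borel" for y unfolding k_def by measurable
  have "(c / P x) *\<^sub>R (u x * cnj (k 0 x)) = complex_of_real c * cutoff u x" for x
    by (simp add: cutoff_def k_def scaleR_conv_of_real)
  then have "integrable lborel (\<lambda>x. complex_of_real c * cutoff u x)"
    using Holder(1)[OF s r u k_Lspace'[of 0]] by (subst (asm) wm_integrable) simp_all
  then have "integrable lborel (\<lambda>x. complex_of_real (1 / c) * (complex_of_real c * cutoff u x))" by (rule integrable_mult_right)
  then show ?thesis using c_pos by simp
qed

lemma wint_cutoff:
  assumes u: "u \<in> Lspace s wm"
  shows "wint s \<Phi> (cutoff u) = ennreal ((\<integral>x. cmod (u x) powr s \<partial>wm) / c)"
proof -
  have [measurable]: "u \<in> borel_measurable borel" using u by (simp add: Lspace_def)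
  have i: "integrable lborel (\<lambda>x. (c / P x) *\<^sub>R (cmod (u x) powr s))" using LspaceD[OF u] by (simp add: wm_integrable)
  have e: "ennreal (cmod (cutoff u x) powr s) / ennreal (P x) = ennreal ((c / P x) *\<^sub>R (cmod (u x) powr s) / c)" for x
    using PhiH_nonneg[of x] c_pos by (cases "P x = 0") (auto simp: cutoff_def divide_ennreal)
  have "wint s \<Phi> (cutoff u) = ennreal (\<integral>x. (c / P x) *\<^sub>R (cmod (u x) powr s) / c \<partial>lborel)"
    unfolding wint_def e by (rule nn_integral_eq_integral[OF integrable_divide[OF i] AE_I2[OF divide_nonneg_pos[OF dens_powr_nonneg c_pos]]])
  moreover have "(\<integral>x. cmod (u x) powr s \<partial>wm) = (\<integral>x. (c / P x) *\<^sub>R (cmod (u x) powr s) \<partial>lborel)" by (rule wm_integral) measurable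
  ultimately show ?thesis by (simp only: integral_divide_zero)
qed

lemma T_mem:
  assumes u: "u \<in> Lspace s wm"
  shows "T u \<in> Bsp r \<Phi>" "has_dist_FT (T u) (cutoff u)"
proof -
  show d: "has_dist_FT (T u) (cutoff u)" unfolding T_def by (rule has_dist_FT_invFT[OF cutoff_integrable[OF u]])
  show "T u \<in> Bsp r \<Phi>"
    unfolding Bsp_def s_r[symmetric] using d wint_cutoff[OF u] invFT_continuous[OF cutoff_integrable[OF u]] invFT_slowly_increasing
    by (auto simp: T_def intro!: exI[of _ "cutoff u"])
qed

lemma dFT_T:
  assumes u: "u \<in> Lspace s wm"
  shows "AE x in lborel. dFT (T u) x = cutoff u x" "dFT (T u) \<in> borel_measurable borel"
proof -
  show "AE x in lborel. dFT (T u) x = cutoff u x" by (rule dFT_AE[OF T_mem(2)[OF u]])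
  show "dFT (T u) \<in> borel_measurable borel" using dFT_AE(1)[OF T_mem(2)[OF u]] by (simp add: has_dist_FT_def)
qed

text \<open>A finite \<open>wint\<close> forces \<open>g = 0\<close> almost everywhere on
  \<open>{P = 0}\<close>, since \<open>a / 0 = \<infinity>\<close> for \<open>a > 0\<close>. So
  \<open>g\<close> agrees almost everywhere with its cutoff, is integrable, and inversion recovers
  \<open>f\<close> from it.\<close>

lemma Bsp_imp_T:
  assumes f: "f \<in> Bsp r \<Phi>"
  obtains u where "u \<in> Lspace s wm" "f = T u"
proof -
  obtain g where g: "continuous_on UNIV f" "slowly_increasing f" "has_dist_FT f g" "wint s \<Phi> g < \<infinity>"
    using f unfolding Bsp_def s_r[symmetric] by blast
  have [measurable]: "g \<in> borel_measurable borel" using g(3) by (simp add: has_dist_FT_def)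
  have "AE x in lborel. ennreal (cmod (g x) powr s) / ennreal (P x) \<noteq> \<infinity>"
    using g(4) unfolding wint_def by (intro nn_integral_PInf_AE) auto
  then have AE: "AE x in lborel. cutoff g x = g x"
  proof eventually_elim
    case (elim x)
    then show ?case using s by (auto simp: cutoff_def ennreal_divide_eq_top_iff)
  qed
  have "integrable lborel (\<lambda>x. (c / P x) *\<^sub>R (cmod (g x) powr s))"
  proof (rule integrableI_nonneg)
    have "(\<integral>\<^sup>+x. ennreal ((c / P x) *\<^sub>R (cmod (g x) powr s)) \<partial>lborel) \<le> (\<integral>\<^sup>+x. ennreal c * (ennreal (cmod (g x) powr s) / ennreal (P x)) \<partial>lborel)"
    proof (rule nn_integral_mono)
      fix x
      show "ennreal ((c / P x) *\<^sub>R (cmod (g x) powr s)) \<le> ennreal c * (ennreal (cmod (g x) powr s) / ennreal (P x))"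
        using PhiH_nonneg[of x] c_pos by (cases "P x = 0") (auto simp: divide_ennreal ennreal_mult[symmetric])
    qed
    also have "\<dots> = ennreal c * wint s \<Phi> g" unfolding wint_def by (intro nn_integral_cmult) measurable
    also have "\<dots> < \<infinity>" using g(4) by (simp add: ennreal_mult_less_top)
    finally show "(\<integral>\<^sup>+x. ennreal ((c / P x) *\<^sub>R (cmod (g x) powr s)) \<partial>lborel) < \<infinity>" .
    show "AE x in lborel. 0 \<le> (c / P x) *\<^sub>R (cmod (g x) powr s)" by (rule AE_I2) (rule dens_powr_nonneg)
  qed measurable
  then have gL: "g \<in> Lspace s wm" unfolding Lspace_def by (simp add: wm_integrable)
  have ig: "integrable lborel g"
    using cutoff_integrable[OF gL] integrable_cong_AE[OF _ _ AE] by simp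
  have "f = invFT g" by (rule has_dist_FT_imp_invFT[OF g(1,2,3) ig])
  also have "\<dots> = T g"
    unfolding T_def invFT_def using AE by (intro ext arg_cong2[of _ _ _ _ "(*)"] refl integral_cong_AE) (auto elim: eventually_mono)
  finally show ?thesis using that gL by blast
qed

lemma Bnorm_T:
  assumes u: "u \<in> Lspace s wm"
  shows "Bnorm r \<Phi> (T u) = Lnorm s wm u"
proof -
  have [measurable]: "u \<in> borel_measurable borel" using u by (simp add: Lspace_def)
  note [measurable] = dFT_T(2)[OF u]
  have "wint s \<Phi> (dFT (T u)) = wint s \<Phi> (cutoff u)"
    unfolding wint_def using dFT_T(1)[OF u] by (intro nn_integral_cong_AE) (auto elim!: eventually_mono)
  moreover have "0 \<le> (\<integral>x. cmod (u x) powr s \<partial>wm)" by (intro Bochner_Integration.integral_nonneg) simp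
  ultimately show ?thesis
    unfolding Bnorm_def s_r[symmetric] Lnorm_def using wint_cutoff[OF u] c_pos by (simp add: c_def FTc_def)
qed

lemma T_add: "u \<in> Lspace s wm \<Longrightarrow> v \<in> Lspace s wm \<Longrightarrow> (\<lambda>x. T u x + T v x) = T (\<lambda>x. u x + v x)"
  using Holder(1)[OF s r _ k_Lspace'] by (auto simp: T_eq Lspace_add[OF s] distrib_right)

lemma T_scale: "u \<in> Lspace s wm \<Longrightarrow> (\<lambda>x. a * T u x) = T (\<lambda>x. a * u x)"
  by (auto simp: T_eq Lspace_scale mult.assoc)

lemma T_diff: "u \<in> Lspace s wm \<Longrightarrow> v \<in> Lspace s wm \<Longrightarrow> (\<lambda>x. T u x - T v x) = T (\<lambda>x. u x - v x)"
  using Holder(1)[OF s r _ k_Lspace'] by (auto simp: T_eq Lspace_diff[OF s] left_diff_distrib)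

lemma T_zero: "T (\<lambda>x. 0) = (\<lambda>x. 0)"
  by (auto simp: T_eq Lspace_zero)

lemma T_eq_0: "u \<in> Lspace s wm \<Longrightarrow> Lnorm s wm u = 0 \<Longrightarrow> T u = (\<lambda>x. 0)"
proof
  fix y assume u: "u \<in> Lspace s wm" "Lnorm s wm u = 0"
  have "AE x in wm. u x * cnj (k y x) = 0" using Lnorm_eq_0[OF s u] by eventually_elim simp
  then show "T u y = 0" unfolding T_eq[OF u(1)] by (rule integral_eq_zero_AE)
qed

lemma Bsp_normed: "normed_fspace (Bsp r \<Phi>) (Bnorm r \<Phi>)"
  unfolding normed_fspace_def
proof (intro conjI ballI allI)
  show "(\<lambda>x. 0) \<in> Bsp r \<Phi>" using T_mem(1)[OF Lspace_zero] by (simp add: T_zero)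
  fix f assume f: "f \<in> Bsp r \<Phi>"
  obtain u where u: "u \<in> Lspace s wm" "f = T u" using Bsp_imp_T[OF f] by blast
  show "(\<lambda>x. a * f x) \<in> Bsp r \<Phi>" for a using u T_mem(1)[OF Lspace_scale[OF u(1)]] by (simp add: T_scale)
  show "0 \<le> Bnorm r \<Phi> f" using u by (simp add: Bnorm_T Lnorm_nonneg)
  show "Bnorm r \<Phi> f = 0 \<longleftrightarrow> f = (\<lambda>x. 0)"
  proof
    assume "Bnorm r \<Phi> f = 0"
    then show "f = (\<lambda>x. 0)" using T_eq_0[OF u(1)] by (simp add: u Bnorm_T)
  next
    assume "f = (\<lambda>x. 0)"
    then show "Bnorm r \<Phi> f = 0" using Bnorm_T[OF Lspace_zero] by (simp add: T_zero Lnorm_zero)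
  qed
  show "Bnorm r \<Phi> (\<lambda>x. a * f x) = cmod a * Bnorm r \<Phi> f" for a
    using u by (simp add: T_scale Bnorm_T Lspace_scale Lnorm_scale[OF s])
  fix g assume g: "g \<in> Bsp r \<Phi>"
  obtain v where v: "v \<in> Lspace s wm" "g = T v" using Bsp_imp_T[OF g] by blast
  show "(\<lambda>x. f x + g x) \<in> Bsp r \<Phi>" using u v T_mem(1)[OF Lspace_add[OF s u(1) v(1)]] by (simp add: T_add)
  show "Bnorm r \<Phi> (\<lambda>x. f x + g x) \<le> Bnorm r \<Phi> f + Bnorm r \<Phi> g"
    using u v by (simp add: T_add Bnorm_T Lspace_add[OF s] Lnorm_triangle[OF s])
qed

sublocale Bsp: normed_fspace_loc "Bsp r \<Phi>" "Bnorm r \<Phi>"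
  using Bsp_normed by unfold_locales

lemma Bsp_banach: "banach_fspace (Bsp r \<Phi>) (Bnorm r \<Phi>)"
proof (rule Bsp.banachI_fast)
  fix f :: "nat \<Rightarrow> 'a \<Rightarrow> complex"
  assume f: "\<And>n. f n \<in> Bsp r \<Phi>" and fast: "\<And>n. Bnorm r \<Phi> (\<lambda>x. f (Suc n) x - f n x) \<le> (1/2) ^ n"
  have "\<exists>u. u \<in> Lspace s wm \<and> f n = T u" for n using Bsp_imp_T[OF f[of n]] by blast
  then obtain u where u: "\<And>n. u n \<in> Lspace s wm" "\<And>n. f n = T (u n)" by metis
  have d: "Bnorm r \<Phi> (\<lambda>x. f m x - f n x) = Lnorm s wm (\<lambda>x. u m x - u n x)" for m n
    by (simp add: u T_diff Bnorm_T Lspace_diff[OF s])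
  have "\<exists>v\<in>Lspace s wm. (\<lambda>n. Lnorm s wm (\<lambda>x. u n x - v x)) \<longlonglongrightarrow> 0"
    by (rule Lspace_complete[OF s u(1) fast[unfolded d] Bsp.fast_Cauchy[OF f fast, unfolded d]])
  then obtain v where v: "v \<in> Lspace s wm" "(\<lambda>n. Lnorm s wm (\<lambda>x. u n x - v x)) \<longlonglongrightarrow> 0" by blast
  have "Bnorm r \<Phi> (\<lambda>x. f n x - T v x) = Lnorm s wm (\<lambda>x. u n x - v x)" for n
    by (simp add: u v T_diff Bnorm_T Lspace_diff[OF s])
  then show "\<exists>g\<in>Bsp r \<Phi>. (\<lambda>n. Bnorm r \<Phi> (\<lambda>x. f n x - g x)) \<longlonglongrightarrow> 0"
    using v T_mem(1)[OF v(1)] by (intro bexI[of _ "T v"]) auto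
qed

lemma Bsp_uniformly_convex: "uniformly_convex_fspace (Bsp r \<Phi>) (Bnorm r \<Phi>)"
  unfolding uniformly_convex_fspace_def
proof (intro allI impI)
  fix e :: real assume "e > 0"
  from Lnorm_uniformly_convex[OF s this, of wm] obtain \<delta> where \<delta>: "\<delta> > 0"
    "\<And>u v. u \<in> Lspace s wm \<Longrightarrow> v \<in> Lspace s wm \<Longrightarrow> Lnorm s wm u = 1 \<Longrightarrow> Lnorm s wm v = 1 \<Longrightarrow> e \<le> Lnorm s wm (\<lambda>x. u x - v x) \<Longrightarrow>
       Lnorm s wm (\<lambda>x. (u x + v x) / 2) \<le> 1 - \<delta>" by blast
  have "Bnorm r \<Phi> (\<lambda>x. (f x + g x) / 2) \<le> 1 - \<delta>"
    if f: "f \<in> Bsp r \<Phi>" and g: "g \<in> Bsp r \<Phi>" and n: "Bnorm r \<Phi> f = 1" "Bnorm r \<Phi> g = 1" "e \<le> Bnorm r \<Phi> (\<lambda>x. f x - g x)" for f g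
  proof -
    obtain u where u: "u \<in> Lspace s wm" "f = T u" using Bsp_imp_T[OF f] by blast
    obtain v where v: "v \<in> Lspace s wm" "g = T v" using Bsp_imp_T[OF g] by blast
    have "(\<lambda>x. (f x + g x) / 2) = T (\<lambda>x. (1/2) * (u x + v x))"
      using T_scale[OF Lspace_add[OF s u(1) v(1)], of "1/2"] T_add[OF u(1) v(1), symmetric] by (simp add: u v)
    then have "Bnorm r \<Phi> (\<lambda>x. (f x + g x) / 2) = Lnorm s wm (\<lambda>x. (u x + v x) / 2)"
      using Bnorm_T[OF Lspace_scale[OF Lspace_add[OF s u(1) v(1)], of "1/2"]] by simp
    also have "\<dots> \<le> 1 - \<delta>"
      using n u v by (intro \<delta>(2)) (auto simp: Bnorm_T T_diff Lspace_diff[OF s])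
    finally show ?thesis .
  qed
  then show "\<exists>\<delta>>0. \<forall>f\<in>Bsp r \<Phi>. \<forall>g\<in>Bsp r \<Phi>. Bnorm r \<Phi> f = 1 \<and> Bnorm r \<Phi> g = 1 \<and> e \<le> Bnorm r \<Phi> (\<lambda>x. f x - g x) \<longrightarrow>
      Bnorm r \<Phi> (\<lambda>x. (f x + g x) / 2) \<le> 1 - \<delta>" using \<delta>(1) by blast
qed

lemma T_k: "T (k y) = (\<lambda>x. \<Phi> (x - y))"
proof
  fix x
  have "exp (- (\<i> * complex_of_real (y \<bullet> \<xi>))) * exp (\<i> * complex_of_real (x \<bullet> \<xi>)) = exp (\<i> * complex_of_real ((x - y) \<bullet> \<xi>))" for \<xi>
    by (simp add: exp_add[symmetric] inner_diff_left algebra_simps)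
  then have e: "cutoff (k y) \<xi> * exp (\<i> * complex_of_real (x \<bullet> \<xi>)) = complex_of_real (P \<xi>) * exp (\<i> * complex_of_real ((x - y) \<bullet> \<xi>))" for \<xi>
    by (cases "P \<xi> = 0") (simp_all add: cutoff_def k_def mult.assoc)
  have "T (k y) x = invFT (\<lambda>\<xi>. complex_of_real (P \<xi>)) (x - y)"
    unfolding T_def invFT_def
    by (simp only: e)
  then show "T (k y) x = \<Phi> (x - y)" using PhiH_inversion[OF P_1] by simp
qed

lemma wm_pairing:
  assumes u: "u \<in> Lspace s wm" and [measurable]: "f \<in> borel_measurable borel" "h \<in> borel_measurable borel"
    and f: "AE x in lborel. f x = cutoff u x" and h: "AE x in lborel. h x = cutoff v x"
    and [measurable]: "v \<in> borel_measurable borel"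
  shows "complex_of_real c * (\<integral>x. f x * cnj (h x) / complex_of_real (P x) \<partial>lborel) = (\<integral>x. u x * cnj (v x) \<partial>wm)"
proof -
  have [measurable]: "u \<in> borel_measurable borel" using u by (simp add: Lspace_def)
  have "complex_of_real c * (\<integral>x. f x * cnj (h x) / complex_of_real (P x) \<partial>lborel) = complex_of_real c * (\<integral>x. u x * cnj (v x) / complex_of_real (P x) \<partial>lborel)"
  proof (intro arg_cong[of _ _ "(*) _"] integral_cong_AE)
    show "AE x in lborel. f x * cnj (h x) / complex_of_real (P x) = u x * cnj (v x) / complex_of_real (P x)"
      using f h by eventually_elim (auto simp: cutoff_def)
  qed measurable
  also have "\<dots> = (\<integral>x. (c / P x) *\<^sub>R (u x * cnj (v x)) \<partial>lborel)"
    unfolding integral_mult_right_zero[symmetric] by (intro Bochner_Integration.integral_cong refl) (simp add: scaleR_conv_of_real)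
  also have "\<dots> = (\<integral>x. u x * cnj (v x) \<partial>wm)" by (rule wm_integral[symmetric]) measurable
  finally show ?thesis .
qed

end

text \<open>Both spaces are images of \<open>L\<^sup>s(wm)\<close> and \<open>L\<^sup>r(wm)\<close> over the same measure, so the two instances differ
  only by exchanging the conjugate exponents.\<close>
locale native_dual_pair = native_pair
begin

sublocale dual: native_pair \<Phi> r s
  using r1 s_r P_r P_s P_1 by unfold_locales

lemma bpair_T:
  assumes u: "u \<in> Lspace s wm" and v: "v \<in> Lspace r wm"
  shows "bpair \<Phi> (T u) (T v) = (\<integral>x. u x * cnj (v x) \<partial>wm)"
proof -
  have [measurable]: "v \<in> borel_measurable borel" using v by (simp add: Lspace_def)
  note d = dual.dFT_T[OF v]
  show ?thesis
    using wm_pairing[OF u dFT_T(2)[OF u] d(2) dFT_T(1)[OF u] d(1)] by (simp add: bpair_def c_def FTc_def)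
qed

lemma dual_pair_Bsp: "dual_pair (Bsp r \<Phi>) (Bnorm r \<Phi>) (Bsp s \<Phi>) (Bnorm s \<Phi>) (bpair \<Phi>)"
proof (unfold_locales)
  show "banach_fspace (Bsp r \<Phi>) (Bnorm r \<Phi>)" "banach_fspace (Bsp s \<Phi>) (Bnorm s \<Phi>)" by (rule Bsp_banach dual.Bsp_banach)+
  show "uniformly_convex_fspace (Bsp r \<Phi>) (Bnorm r \<Phi>)" by (rule Bsp_uniformly_convex)
  note Dimp = dual.Bsp_imp_T and Dmem = dual.T_mem(1)
    and Dnorm = dual.Bnorm_T
  note H = Holder(1)[OF s r]
  fix f assume "f \<in> Bsp r \<Phi>"
  then obtain u where u: "u \<in> Lspace s wm" "f = T u" using Bsp_imp_T by blast
  {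
    fix g w assume "g \<in> Bsp r \<Phi>" and "w \<in> Bsp s \<Phi>"
    then obtain v v' where v: "v \<in> Lspace s wm" "g = T v" "v' \<in> Lspace r wm" "w = T v'" using Bsp_imp_T Dimp by metis
    show "bpair \<Phi> (\<lambda>x. f x + g x) w = bpair \<Phi> f w + bpair \<Phi> g w"
      using u v H[OF u(1) v(3)] H[OF v(1) v(3)] by (simp add: T_add bpair_T Lspace_add[OF s] distrib_right)
  }
  {
    fix w a assume "w \<in> Bsp s \<Phi>"
    then obtain v' where v: "v' \<in> Lspace r wm" "w = T v'" using Dimp by metis
    show "bpair \<Phi> (\<lambda>x. a * f x) w = a * bpair \<Phi> f w"
      using u v by (simp add: T_scale bpair_T Lspace_scale mult.assoc)
    show "cmod (bpair \<Phi> f w) \<le> Bnorm r \<Phi> f * Bnorm s \<Phi> w"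
      using u v Holder(2)[OF s r u(1) v(1)] by (simp add: bpair_T Bnorm_T Dnorm)
  }
  {
    fix w w' a assume "w \<in> Bsp s \<Phi>" "w' \<in> Bsp s \<Phi>"
    then obtain v v' where v: "v \<in> Lspace r wm" "w = T v" "v' \<in> Lspace r wm" "w' = T v'" using Dimp by metis
    have "(\<lambda>x. a * w x + w' x) = T (\<lambda>x. a * v x + v' x)"
      using v dual.T_add[OF Lspace_scale[OF v(1), of a] v(3)] dual.T_scale[OF v(1), of a]
      by (simp add: fun_eq_iff)
    moreover have "(\<lambda>x. a * v x + v' x) \<in> Lspace r wm" by (intro Lspace_add r1 Lspace_scale v)
    moreover have "(\<lambda>x. u x * cnj (a * v x + v' x)) = (\<lambda>x. cnj a * (u x * cnj (v x)) + u x * cnj (v' x))" by (simp add: algebra_simps)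
    ultimately show "bpair \<Phi> f (\<lambda>x. a * w x + w' x) = cnj a * bpair \<Phi> f w + bpair \<Phi> f w'"
      using u v H[OF u(1) v(1)] H[OF u(1) v(3)] by (simp add: bpair_T)
  }
  {
    assume "f \<noteq> (\<lambda>x. 0)"
    then have n: "Lnorm s wm u \<noteq> 0" using T_eq_0[OF u(1)] u by auto
    from Lnorm_has_derivative[OF s r u(1) n] obtain v where v: "v \<in> Lspace r wm" "Lnorm r wm v \<le> 1"
      "(\<integral>x. u x * cnj (v x) \<partial>wm) = complex_of_real (Lnorm s wm u)"
      "\<And>k. k \<in> Lspace s wm \<Longrightarrow> ((\<lambda>t::real. (Lnorm s wm (\<lambda>x. u x + complex_of_real t * k x) - Lnorm s wm u) / t)
        \<longlongrightarrow> Re (\<integral>x. k x * cnj (v x) \<partial>wm)) (at 0)" by blast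
    have "((\<lambda>t::real. (Bnorm r \<Phi> (\<lambda>x. f x + complex_of_real t * h x) - Bnorm r \<Phi> f) / t) \<longlongrightarrow> Re (bpair \<Phi> h (T v))) (at 0)"
      if h: "h \<in> Bsp r \<Phi>" for h
    proof -
      obtain w where w: "w \<in> Lspace s wm" "h = T w" using Bsp_imp_T[OF h] by blast
      have "(\<lambda>x. f x + complex_of_real t * h x) = T (\<lambda>x. u x + complex_of_real t * w x)" for t
        using T_add[OF u(1) Lspace_scale[OF w(1), of "complex_of_real t"]] T_scale[OF w(1), of "complex_of_real t"] u(2) w(2)
        by (simp add: fun_eq_iff)
      then have "Bnorm r \<Phi> (\<lambda>x. f x + complex_of_real t * h x) = Lnorm s wm (\<lambda>x. u x + complex_of_real t * w x)" for t
        using Bnorm_T[OF Lspace_add[OF s u(1) Lspace_scale[OF w(1), of "complex_of_real t"]]] by simp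
      then show ?thesis using v(4)[OF w(1)] u w v(1) by (simp add: Bnorm_T bpair_T)
    qed
    then show "\<exists>g\<in>Bsp s \<Phi>. Bnorm s \<Phi> g \<le> 1 \<and> bpair \<Phi> f g = complex_of_real (Bnorm r \<Phi> f) \<and>
      (\<forall>k\<in>Bsp r \<Phi>. ((\<lambda>t::real. (Bnorm r \<Phi> (\<lambda>x. f x + complex_of_real t * k x) - Bnorm r \<Phi> f) / t) \<longlongrightarrow> Re (bpair \<Phi> k g)) (at 0))"
      using v u Dmem[OF v(1)] by (intro bexI[of _ "T v"]) (auto simp: bpair_T Bnorm_T Dnorm)
  }
next
  fix w assume "w \<in> Bsp s \<Phi>"
  then obtain v where v: "v \<in> Lspace r wm" "w = T v" using dual.Bsp_imp_T by blast
  from Lspace_norming[OF r1 s_r v(1)] obtain u where u: "u \<in> Lspace s wm" "Lnorm s wm u \<le> 1"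
    "(\<integral>x. v x * cnj (u x) \<partial>wm) = complex_of_real (Lnorm r wm v)" by blast
  \<comment> \<open>\<open>Lspace_norming\<close> was applied with the exponents exchanged, so its
    pairing has the arguments in the other order; conjugation restores it.\<close>
  have "cnj (\<integral>x. v x * cnj (u x) \<partial>wm) = (\<integral>x. u x * cnj (v x) \<partial>wm)"
    using Bochner_Integration.integral_cnj[of wm "\<lambda>x. v x * cnj (u x)"] by (simp add: mult.commute)
  then have "(\<integral>x. u x * cnj (v x) \<partial>wm) = complex_of_real (Lnorm r wm v)" using u(3) by simp
  then show "\<exists>f\<in>Bsp r \<Phi>. Bnorm r \<Phi> f \<le> 1 \<and> bpair \<Phi> f w = complex_of_real (Bnorm s \<Phi> w)"
    using u v T_mem(1)[OF u(1)] by (intro bexI[of _ "T u"]) (auto simp: bpair_T Bnorm_T dual.Bnorm_T)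
qed

lemma two_sided_kernel: "two_sided_kernel_pair (Bsp r \<Phi>) (Bnorm r \<Phi>) (Bsp s \<Phi>) (Bnorm s \<Phi>) (bpair \<Phi>) (\<lambda>x y. \<Phi> (x - y))"
proof -
  interpret dual_pair "Bsp r \<Phi>" "Bnorm r \<Phi>" "Bsp s \<Phi>" "Bnorm s \<Phi>" "bpair \<Phi>" by (rule dual_pair_Bsp)
  \<comment> \<open>By Hermitian symmetry the conjugate of \<open>\<Phi> (x - y)\<close> is
    \<open>\<Phi> (y - x)\<close>, so the sections in either variable are images under
    \<open>T\<close> of the same functions \<open>k\<close>, which lie in both model spaces.\<close>
  have cnj_Phi: "(\<lambda>y. cnj (\<Phi> (x - y))) = T (k x)" for x
    unfolding T_k using sym[of "x - _"] by (simp add: fun_eq_iff) 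
  show ?thesis
  proof
    fix y
    show "(\<lambda>x. \<Phi> (x - y)) \<in> Bsp s \<Phi>"
      using dual.T_mem(1)[OF k_Lspace'] by (simp add: T_k)
    show "(\<lambda>y'. cnj (\<Phi> (y - y'))) \<in> Bsp r \<Phi>" unfolding cnj_Phi by (rule T_mem(1)[OF k_Lspace])
    show "f y = bpair \<Phi> f (\<lambda>x. \<Phi> (x - y))" if f: "f \<in> Bsp r \<Phi>" for f
    proof -
      obtain u where u: "u \<in> Lspace s wm" "f = T u" using Bsp_imp_T[OF f] by blast
      show ?thesis unfolding T_k[symmetric] u(2) bpair_T[OF u(1) k_Lspace'] by (rule T_eq[OF u(1)])
    qed
    show "cnj (g y) = bpair \<Phi> (\<lambda>y'. cnj (\<Phi> (y - y'))) g" if g: "g \<in> Bsp s \<Phi>" for g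
    proof -
      obtain v where v: "v \<in> Lspace r wm" "g = T v" using dual.Bsp_imp_T[OF g] by blast
      show ?thesis unfolding cnj_Phi v(2) bpair_T[OF k_Lspace v(1)] dual.T_eq[OF v(1)]
        using Bochner_Integration.integral_cnj[of wm "\<lambda>x. v x * cnj (k y x)"] by (simp add: mult.commute)
    qed
  qed
qed

end

theorem theorem5p6:
  fixes p q :: real and \<Phi> :: "'a::euclidean_space \<Rightarrow> complex" and \<Omega> :: "'a set"
  assumes "1 < p" and "q = p / (p - 1)"
    and "integrable lborel \<Phi>" and "continuous_on UNIV \<Phi>"
    and "positive_definite \<Phi>"
    and "integrable lborel (\<lambda>x. PhiH \<Phi> x powr (min p q - 1))"
  shows "rkbs_two_sided (BOm p \<Phi> \<Omega>) (BOm_norm p \<Phi> \<Omega>) \<Omega>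
            (N0perp p \<Phi> \<Omega>) (Bnorm q \<Phi>) UNIV (POm p \<Phi> \<Omega>) (\<lambda>x y. \<Phi> (x - y))
       \<and> (\<forall>g\<in>N0perp p \<Phi> \<Omega>. \<forall>f1\<in>Bsp p \<Phi>. \<forall>f2\<in>Bsp p \<Phi>.
            restr \<Omega> f1 = restr \<Omega> f2 \<longrightarrow> bpair \<Phi> f1 g = bpair \<Phi> f2 g)
       \<and> closed_in_fspace (Bsp q \<Phi>) (Bnorm q \<Phi>) (N0perp p \<Phi> \<Omega>)
       \<and> uniformly_convex_fspace (BOm p \<Phi> \<Omega>) (BOm_norm p \<Phi> \<Omega>)
       \<and> smooth_fspace (BOm p \<Phi> \<Omega>) (BOm_norm p \<Phi> \<Omega>)"
proof -
  interpret pd_function \<Phi> using assms by unfold_locales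
  have q: "1 < q" "p = q / (q - 1)" unfolding assms(2) using assms(1) by (auto simp: field_simps)
  \<comment> \<open>Conjugate exponents cannot both exceed 2. So the exponent of the hypothesis is
    at most 1, and it is at most \<open>p - 1\<close> and \<open>q - 1\<close> anyway.\<close>
  have min2: "min p q - 1 \<le> 1"
  proof (rule ccontr)
    assume "\<not> min p q - 1 \<le> 1"
    then have "p > 2" "q > 2" by auto
    then show False using assms(2) by (simp add: field_simps)
  qed
  note P = PhiH_powr_integrable[OF assms(6)]
  have P1: "integrable lborel (PhiH \<Phi>)"
    using P[OF min2] PhiH_nonneg by simp
  \<comment> \<open>The order is deliberate: \<open>Bsp p\<close> is modelled on \<open>L^q\<close>,
    so \<open>s\<close> becomes \<open>q\<close> and \<open>r\<close> becomes
    \<open>p\<close>.\<close>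
  interpret native_dual_pair \<Phi> q p
    using q P1 P[of "q - 1"] P[of "p - 1"] by unfold_locales auto
  interpret K: two_sided_kernel_pair "Bsp p \<Phi>" "Bnorm p \<Phi>" "Bsp q \<Phi>" "Bnorm q \<Phi>" "bpair \<Phi>" "\<lambda>x y. \<Phi> (x - y)" \<Omega>
    by (rule two_sided_kernel)
  have eq: "BOm p \<Phi> \<Omega> = K.quot" "BOm_norm p \<Phi> \<Omega> = K.quot_norm" "N0perp p \<Phi> \<Omega> = K.annih" "POm p \<Phi> \<Omega> = K.quot_pair"
    unfolding N0perp_def assms(2)[symmetric]
    by (auto simp: BOm_def K.quot_def BOm_norm_def K.quot_norm_def N0_def K.annih_def K.null_def POm_def K.quot_pair_def fun_eq_iff)
  show ?thesis
    unfolding eq using K.quot_rkbs K.annih_pair_eq K.closed_annih K.uc_quot K.smooth_quot by blast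
qed

end
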